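(* Let $X$ be a path-connected space with base point $*$, let $n$ be a dimension, and let $R$ be a commutative ring. Let $\mathbf{HQFT}(n,X)$ be the category of $n$-dimensional homotopy quantum field theories with target $X$ and values in the category $\mathbf{Mod}(R)$ of finitely generated free $R$-modules, and let $\mathbf{HCobord}(n,X)$ be the homotopy cobordism category. Then there is a natural isomorphism of categories $$\mathbf{HQFT}(n,X)\;\cong\;[\mathbf{HCobord}(n,X),\mathbf{Mod}(R)],$$ where $[\mathcal A,\mathcal B]$ denotes the category of symmetric monoidal functors $\mathcal A\to\mathcal B$.
   Context: Compositions are written in diagrammatic order. Manifolds are compact, oriented and differentiable. **$X$-manifolds.** An $X$-manifold $(M,g)$ is a closed manifold $M$ with a chosen base point in each connected component, together with a continuous map $g:M\to X$ (the characteristic map) sending all base points to $*$. An $X$-diffeomorphism $\psi:(M,g)\to(N,h)$ is an orientation-preserving diffeomorphism $M\to N$ sending base points to base points, with $\psi h=g$ (first $\psi$, then $h$). $\mathbf{Diff}(n,X)$ is the category of $n$-dimensional $X$-manifolds and $X$-diffeomorphisms; it is symmetric monoidal under disjoint union $\amalg$ with unit the empty $X$-manifold $\emptyset$. **$X$-cobordisms.** A cobordism $W:M\to N$ between closed $n$-manifolds is an $(n+1)$-manifold with $\partial W=-M\amalg N$ (incoming part $\partial_-W=M$, outgoing part $\partial_+W=N$). An $X$-cobordism $(W,F):(M,g)\to(N,h)$ is a cobordism $W:M\to N$ with a homotopy class $F$, relative to the boundary, of maps $W\to X$ with $F|_M=g$, $F|_N=h$. An $X$-diffeomorphism $\Psi:(W,F)\to(V,G)$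 between $X$-cobordisms is a diffeomorphism $\Psi:W\to V$ with $\Psi(\partial_+W)=\partial_+V$, $\Psi(\partial_-W)=\partial_-V$ and $F=\Psi G$, the last equality being one of homotopy classes of maps. Given $(W,F):(M,g)\to(N,h)$, $(V,G):(N',h')\to(P,j)$ and an $X$-diffeomorphism $\psi:(N,h)\to(N',h')$, the gluing $(W,F)\amalg_\psi(V,G):(M,g)\to(P,j)$ is obtained by gluing $W$ and $V$ along $\psi$, with the map equal to $F$ on $W$ and $G$ on $V$; for $\psi$ the identity it is written $(W,F)\circ(V,G)$. The identity cobordism of $(M,g)$ is $(I\times M,1_g)$, $I=[0,1]$, $1_g(t,x)=g(x)$. Disjoint unions of $X$-cobordisms are defined in the obvious way. **HQFTs.** An $n$-dimensional HQFT $\tau$ with target $X$ assigns a finitely generated free $R$-module $\tau(M,g)$ to every $n$-dimensional $X$-manifold, a linear isomorphism $\tau(\psi):\tau(M,g)\to\tau(N,h)$ to every $X$-diffeomorphism $\psi:(M,g)\to(N,h)$, and a linear map $\tau(W,F):\tau(M,g)\to\tau(N,h)$ to every $X$-cobordism $(W,F):(M,g)\to(N,h)$, such that: (1) $\tau$ is functorial on $\mathbf{Diff}(n,X)$; (2) $\tau$ is symmetric monoidal on $\mathbf{Diff}(n,X)$: there are natural isomorphisms $c:\tau((M,g)\amalg(N,h))\cong\tau(M,g)\otimes\tau(N,h)$ and an isomorphism $u:\tau(\emptyset)\cong R$ satisfying the usual axioms for a symmetric monoidal functor; (3) $\tau((W,F)\amalg_\psi(V,G))=\tau(W,F)\,\tau(\psi)\,\tau(V,G)$;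 (4) $\tau(I\times M,1_g)=1_{\tau(M,g)}$; (5) for $X$-cobordisms $(W,F):(M,g)\to(N,h)$, $(V,G):(M',g')\to(N',h')$ and $(P,j):\emptyset\to\emptyset$ one has $\tau((W,F)\amalg(V,G))\,c=c\,(\tau(W,F)\otimes\tau(V,G))$ and $\tau(P,j)\,u=u$; (6) for every $X$-diffeomorphism $\Psi:(W,F)\to(V,G)$ between $X$-cobordisms, $\tau(W,F)\,\tau(\Psi|_{\partial_+W})=\tau(\Psi|_{\partial_-W})\,\tau(V,G)$. A map $\theta:\tau\to\rho$ of HQFTs is a family of maps $\theta_{(M,g)}:\tau(M,g)\to\rho(M,g)$ natural with respect to both $X$-diffeomorphisms and $X$-cobordisms and compatible with the isomorphisms $c$ and $u$ of $\tau$ and $\rho$. HQFTs and these maps form the category $\mathbf{HQFT}(n,X)$. **$\mathbf{HCobord}(n,X)$.** This is the symmetric monoidal category whose objects are the $n$-dimensional $X$-manifolds, with monoidal product $\amalg$ and unit $\emptyset$, whose morphisms are generated under composition by the $X$-diffeomorphisms between $n$-dimensional $X$-manifolds and the $X$-cobordisms between them (so morphisms are classes of composable strings of these), the product of two $X$-diffeomorphisms or of two $X$-cobordisms being their disjoint union, modulo the monoidal congruence generated by: (a) composition of $X$-diffeomorphisms is the composition in $\mathbf{Diff}(n,X)$; (b) the structural isomorphisms (associator, unit isomorphisms, symmetry) are those of $\mathbf{Diff}(n,X)$, and they are natural also with respect to $X$-cobordisms; (c) $(W,F)\,\Psi|_{\partial_+W}=\Psi|_{\partial_-W}\,(V,G)$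 for every $X$-diffeomorphism $\Psi:(W,F)\to(V,G)$ between $X$-cobordisms; (d) $(W,F)\amalg_\psi(V,G)=(W,F)\,\psi\,(V,G)$; (e) $(I\times M,1_g)$ equals the identity $X$-diffeomorphism $1_{(M,g)}$ and is a two-sided unit for composition.
   Formalization: The axiom τ(P,j)u = u is required only of the empty cobordism ∅→∅, since for all closed (P,j) the claim fails; X-diffeomorphisms of cobordisms must preserve orientation and restrict to X-diffeomorphisms on the boundary, so that τ(Ψ|∂W) is defined. *)

theory Defs
  imports
    "HOL-Analysis.Analysis"
    "HOL-Algebra.Module"
    "Jordan_Normal_Form.Determinant"
begin

section \<open>Categories and symmetric monoidal functors\<close>

text \<open>Compositions are written in diagrammatic order throughout.\<close>

record ('o, 'a) cat =
  obj :: "'o set"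
  arr :: "'a set"
  source :: "'a \<Rightarrow> 'o"
  target :: "'a \<Rightarrow> 'o"
  idt :: "'o \<Rightarrow> 'a"
  cmp :: "'a \<Rightarrow> 'a \<Rightarrow> 'a"  (infixl \<open>\<cdot>\<index>\<close> 70)

record ('o, 'a) smcat = "('o, 'a) cat" +
  unt :: 'o
  teno :: "'o \<Rightarrow> 'o \<Rightarrow> 'o"
  tena :: "'a \<Rightarrow> 'a \<Rightarrow> 'a"
  assoc :: "'o \<Rightarrow> 'o \<Rightarrow> 'o \<Rightarrow> 'a"
  lunit :: "'o \<Rightarrow> 'a"
  runit :: "'o \<Rightarrow> 'a"
  symm :: "'o \<Rightarrow> 'o \<Rightarrow> 'a"

definition hom_arr :: "('o, 'a, 'z) cat_scheme \<Rightarrow> 'o \<Rightarrow> 'o \<Rightarrow> 'a set" where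
  "hom_arr C x y = {f \<in> arr C. source C f = x \<and> target C f = y}"

definition category :: "('o, 'a, 'z) cat_scheme \<Rightarrow> bool" where
  "category C \<longleftrightarrow>
     (\<forall>f\<in>arr C. source C f \<in> obj C \<and> target C f \<in> obj C) \<and>
     (\<forall>x\<in>obj C. idt C x \<in> hom_arr C x x) \<and>
     (\<forall>f\<in>arr C. \<forall>g\<in>arr C. target C f = source C g \<longrightarrow>
        cmp C f g \<in> hom_arr C (source C f) (target C g)) \<and>
     (\<forall>f\<in>arr C. cmp C (idt C (source C f)) f = f \<and> cmp C f (idt C (target C f)) = f) \<and>
     (\<forall>f\<in>arr C. \<forall>g\<in>arr C. \<forall>h\<in>arr C. target C f = source C g \<longrightarrow> target C g = source C h \<longrightarrow>
        cmp C (cmp C f g) h = cmp C f (cmp C g h))"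

definition is_functor ::
  "('o, 'a, 'z) cat_scheme \<Rightarrow> ('p, 'b, 'y) cat_scheme \<Rightarrow> ('o \<Rightarrow> 'p) \<Rightarrow> ('a \<Rightarrow> 'b) \<Rightarrow> bool" where
  "is_functor C D Fo Fa \<longleftrightarrow>
     (\<forall>x\<in>obj C. Fo x \<in> obj D) \<and>
     (\<forall>f\<in>arr C. Fa f \<in> hom_arr D (Fo (source C f)) (Fo (target C f))) \<and>
     (\<forall>x\<in>obj C. Fa (idt C x) = idt D (Fo x)) \<and>
     (\<forall>f\<in>arr C. \<forall>g\<in>arr C. target C f = source C g \<longrightarrow>
        Fa (cmp C f g) = cmp D (Fa f) (Fa g))"

definition isomorphism_of_categories ::
  "('o, 'a, 'z) cat_scheme \<Rightarrow> ('p, 'b, 'y) cat_scheme \<Rightarrow> ('o \<Rightarrow> 'p) \<Rightarrow> ('a \<Rightarrow> 'b) \<Rightarrow> bool" where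
  "isomorphism_of_categories C D Fo Fa \<longleftrightarrow>
     category C \<and> category D \<and> is_functor C D Fo Fa \<and>
     bij_betw Fo (obj C) (obj D) \<and> bij_betw Fa (arr C) (arr D)"

definition iso_arr :: "('o, 'a, 'z) cat_scheme \<Rightarrow> 'a \<Rightarrow> bool" where
  "iso_arr C f \<longleftrightarrow> f \<in> arr C \<and>
     (\<exists>g \<in> hom_arr C (target C f) (source C f).
        cmp C f g = idt C (source C f) \<and> cmp C g f = idt C (target C f))"

text \<open>A symmetric (strong) monoidal functor, with structure isomorphisms
  \<open>FC (x, y) : F(x \<otimes> y) \<rightarrow> F x \<otimes> F y\<close> and \<open>FU : F 1 \<rightarrow> 1\<close>. All components are extensional,
  so that equality of functors is equality of records.\<close>

record ('o, 'a, 'p, 'b) smfun =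
  FO :: "'o \<Rightarrow> 'p"
  FA :: "'a \<Rightarrow> 'b"
  FC :: "'o \<times> 'o \<Rightarrow> 'b"
  FU :: 'b

definition sm_functor ::
  "('o, 'a) smcat \<Rightarrow> ('p, 'b) smcat \<Rightarrow> ('o, 'a, 'p, 'b) smfun \<Rightarrow> bool" where
  "sm_functor C D F \<longleftrightarrow>
     FO F \<in> extensional (obj C) \<and> FA F \<in> extensional (arr C) \<and>
     FC F \<in> extensional (obj C \<times> obj C) \<and>
     is_functor C D (FO F) (FA F) \<and>
     (\<forall>x\<in>obj C. \<forall>y\<in>obj C. iso_arr D (FC F (x, y)) \<and>
        FC F (x, y) \<in> hom_arr D (FO F (teno C x y)) (teno D (FO F x) (FO F y))) \<and>
     iso_arr D (FU F) \<and> FU F \<in> hom_arr D (FO F (unt C)) (unt D) \<and>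
     (\<forall>f\<in>arr C. \<forall>g\<in>arr C.
        FA F (tena C f g) \<cdot>\<^bsub>D\<^esub> FC F (target C f, target C g) =
        FC F (source C f, source C g) \<cdot>\<^bsub>D\<^esub> tena D (FA F f) (FA F g)) \<and>
     (\<forall>x\<in>obj C. \<forall>y\<in>obj C. \<forall>z\<in>obj C.
        FA F (assoc C x y z) \<cdot>\<^bsub>D\<^esub> FC F (x, teno C y z) \<cdot>\<^bsub>D\<^esub>
          tena D (idt D (FO F x)) (FC F (y, z)) =
        FC F (teno C x y, z) \<cdot>\<^bsub>D\<^esub> tena D (FC F (x, y)) (idt D (FO F z)) \<cdot>\<^bsub>D\<^esub>
          assoc D (FO F x) (FO F y) (FO F z)) \<and>
     (\<forall>x\<in>obj C. FA F (lunit C x) =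
        FC F (unt C, x) \<cdot>\<^bsub>D\<^esub> tena D (FU F) (idt D (FO F x)) \<cdot>\<^bsub>D\<^esub> lunit D (FO F x)) \<and>
     (\<forall>x\<in>obj C. FA F (runit C x) =
        FC F (x, unt C) \<cdot>\<^bsub>D\<^esub> tena D (idt D (FO F x)) (FU F) \<cdot>\<^bsub>D\<^esub> runit D (FO F x)) \<and>
     (\<forall>x\<in>obj C. \<forall>y\<in>obj C.
        FA F (symm C x y) \<cdot>\<^bsub>D\<^esub> FC F (y, x) = FC F (x, y) \<cdot>\<^bsub>D\<^esub> symm D (FO F x) (FO F y))"

definition sm_transformation ::
  "('o, 'a) smcat \<Rightarrow> ('p, 'b) smcat \<Rightarrow> ('o, 'a, 'p, 'b) smfun \<Rightarrow> ('o, 'a, 'p, 'b) smfun \<Rightarrow>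
   ('o \<Rightarrow> 'b) \<Rightarrow> bool" where
  "sm_transformation C D F G \<theta> \<longleftrightarrow>
     \<theta> \<in> extensional (obj C) \<and>
     (\<forall>x\<in>obj C. \<theta> x \<in> hom_arr D (FO F x) (FO G x)) \<and>
     (\<forall>f\<in>arr C. FA F f \<cdot>\<^bsub>D\<^esub> \<theta> (target C f) = \<theta> (source C f) \<cdot>\<^bsub>D\<^esub> FA G f) \<and>
     (\<forall>x\<in>obj C. \<forall>y\<in>obj C.
        \<theta> (teno C x y) \<cdot>\<^bsub>D\<^esub> FC G (x, y) = FC F (x, y) \<cdot>\<^bsub>D\<^esub> tena D (\<theta> x) (\<theta> y)) \<and>
     \<theta> (unt C) \<cdot>\<^bsub>D\<^esub> FU G = FU F"

text \<open>The category \<open>[C, D]\<close>; its arrows are triples (source, target, components).\<close>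

definition sm_functor_category ::
  "('o, 'a) smcat \<Rightarrow> ('p, 'b) smcat \<Rightarrow>
   (('o, 'a, 'p, 'b) smfun,
    ('o, 'a, 'p, 'b) smfun \<times> ('o, 'a, 'p, 'b) smfun \<times> ('o \<Rightarrow> 'b)) cat" where
  "sm_functor_category C D =
     \<lparr> obj = {F. sm_functor C D F},
       arr = {(F, G, \<theta>). sm_functor C D F \<and> sm_functor C D G \<and> sm_transformation C D F G \<theta>},
       source = (\<lambda>(F, G, \<theta>). F),
       target = (\<lambda>(F, G, \<theta>). G),
       idt = (\<lambda>F. (F, F, \<lambda>x\<in>obj C. idt D (FO F x))),
       cmp = (\<lambda>(F, G, \<theta>) (G', H, \<eta>). (F, H, \<lambda>x\<in>obj C. \<theta> x \<cdot>\<^bsub>D\<^esub> \<eta> x)) \<rparr>"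


section \<open>The category of finitely generated free modules\<close>

text \<open>A universe of elements closed under scalars and tensor products. An element of a tensor
  product is a formal sum \<open>m\<^sub>1 \<otimes> n\<^sub>1 + \<dots> + m\<^sub>k \<otimes> n\<^sub>k\<close>, given by the chosen representative
  of its class modulo the bilinearity relations. Every finitely generated free module is isomorphic
  to one with elements in this universe.\<close>

datatype ('r, 'm) elt =
    Gen 'm
  | Sca (sca: 'r)
  | Ten (ten: "(('r, 'm) elt \<times> ('r, 'm) elt) list")

type_synonym ('r, 'm) rmod = "('r, ('r, 'm) elt) module"
type_synonym ('r, 'm) rmap = "('r, 'm) rmod \<times> ('r, 'm) rmod \<times> (('r, 'm) elt \<Rightarrow> ('r, 'm) elt)"

definition fg_free :: "'r ring \<Rightarrow> ('r, 'e) module \<Rightarrow> bool" where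
  "fg_free R M \<longleftrightarrow> module R M \<and>
     (\<exists>(k::nat) b. b \<in> {..<k} \<rightarrow> carrier M \<and>
        bij_betw (\<lambda>a. \<Oplus>\<^bsub>M\<^esub>i\<in>{..<k}. a i \<odot>\<^bsub>M\<^esub> b i) ({..<k} \<rightarrow>\<^sub>E carrier R) (carrier M))"

definition linear_maps :: "'r ring \<Rightarrow> ('r, 'e) module \<Rightarrow> ('r, 'e) module \<Rightarrow> ('e \<Rightarrow> 'e) set" where
  "linear_maps R M N = {f \<in> carrier M \<rightarrow>\<^sub>E carrier N.
     (\<forall>x\<in>carrier M. \<forall>y\<in>carrier M. f (x \<oplus>\<^bsub>M\<^esub> y) = f x \<oplus>\<^bsub>N\<^esub> f y) \<and>
     (\<forall>r\<in>carrier R. \<forall>x\<in>carrier M. f (r \<odot>\<^bsub>M\<^esub> x) = r \<odot>\<^bsub>N\<^esub> f x)}"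

inductive tensor_eq ::
  "'r ring \<Rightarrow> ('r, 'e) module \<Rightarrow> ('r, 'e) module \<Rightarrow> ('e \<times> 'e) list \<Rightarrow> ('e \<times> 'e) list \<Rightarrow> bool"
  for R M N where
  refl: "xs \<in> lists (carrier M \<times> carrier N) \<Longrightarrow> tensor_eq R M N xs xs"
| sym: "tensor_eq R M N xs ys \<Longrightarrow> tensor_eq R M N ys xs"
| trans: "tensor_eq R M N xs ys \<Longrightarrow> tensor_eq R M N ys zs \<Longrightarrow> tensor_eq R M N xs zs"
| append: "tensor_eq R M N xs xs' \<Longrightarrow> tensor_eq R M N ys ys' \<Longrightarrow>
    tensor_eq R M N (xs @ ys) (xs' @ ys')"
| comm: "xs \<in> lists (carrier M \<times> carrier N) \<Longrightarrow> ys \<in> lists (carrier M \<times> carrier N) \<Longrightarrow>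
    tensor_eq R M N (xs @ ys) (ys @ xs)"
| add_left: "m \<in> carrier M \<Longrightarrow> m' \<in> carrier M \<Longrightarrow> y \<in> carrier N \<Longrightarrow>
    tensor_eq R M N [(m \<oplus>\<^bsub>M\<^esub> m', y)] [(m, y), (m', y)]"
| add_right: "m \<in> carrier M \<Longrightarrow> y \<in> carrier N \<Longrightarrow> y' \<in> carrier N \<Longrightarrow>
    tensor_eq R M N [(m, y \<oplus>\<^bsub>N\<^esub> y')] [(m, y), (m, y')]"
| scalar: "r \<in> carrier R \<Longrightarrow> m \<in> carrier M \<Longrightarrow> y \<in> carrier N \<Longrightarrow>
    tensor_eq R M N [(r \<odot>\<^bsub>M\<^esub> m, y)] [(m, r \<odot>\<^bsub>N\<^esub> y)]"
| zero: "y \<in> carrier N \<Longrightarrow> tensor_eq R M N [(\<zero>\<^bsub>M\<^esub>, y)] []"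

definition tensor_sum ::
  "'r ring \<Rightarrow> ('r, 'm) rmod \<Rightarrow> ('r, 'm) rmod \<Rightarrow> (('r, 'm) elt \<times> ('r, 'm) elt) list \<Rightarrow> ('r, 'm) elt"
  where "tensor_sum R M N xs = Ten (SOME ys. tensor_eq R M N ys xs)"

text \<open>The fields \<^const>\<open>mult\<close> and \<^const>\<open>one\<close> of a module record have no meaning.\<close>

definition tensor_module :: "'r ring \<Rightarrow> ('r, 'm) rmod \<Rightarrow> ('r, 'm) rmod \<Rightarrow> ('r, 'm) rmod" where
  "tensor_module R M N =
     \<lparr> carrier = tensor_sum R M N ` lists (carrier M \<times> carrier N),
       mult = undefined,
       one = undefined,
       zero = tensor_sum R M N [],
       add = (\<lambda>x y. tensor_sum R M N (ten x @ ten y)),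
       smult = (\<lambda>r x. tensor_sum R M N (map (\<lambda>(m, y). (r \<odot>\<^bsub>M\<^esub> m, y)) (ten x))) \<rparr>"

definition scalar_module :: "'r ring \<Rightarrow> ('r, 'm) rmod" where
  "scalar_module R =
     \<lparr> carrier = Sca ` carrier R,
       mult = undefined,
       one = undefined,
       zero = Sca \<zero>\<^bsub>R\<^esub>,
       add = (\<lambda>x y. Sca (sca x \<oplus>\<^bsub>R\<^esub> sca y)),
       smult = (\<lambda>r x. Sca (r \<otimes>\<^bsub>R\<^esub> sca x)) \<rparr>"

definition tensor_map :: "'r ring \<Rightarrow> ('r, 'm) rmap \<Rightarrow> ('r, 'm) rmap \<Rightarrow> ('r, 'm) rmap" where
  "tensor_map R = (\<lambda>(M, M', f) (N, N', g).
     (tensor_module R M N, tensor_module R M' N',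
      \<lambda>x\<in>carrier (tensor_module R M N).
        tensor_sum R M' N' (map (\<lambda>(m, y). (f m, g y)) (ten x))))"

definition FMod :: "'r ring \<Rightarrow> (('r, 'm) rmod, ('r, 'm) rmap) smcat" where
  "FMod R =
     \<lparr> obj = {M. fg_free R M},
       arr = {(M, N, f). fg_free R M \<and> fg_free R N \<and> f \<in> linear_maps R M N},
       source = (\<lambda>(M, N, f). M),
       target = (\<lambda>(M, N, f). N),
       idt = (\<lambda>M. (M, M, \<lambda>x\<in>carrier M. x)),
       cmp = (\<lambda>(M, N, f) (N', P, g). (M, P, \<lambda>x\<in>carrier M. g (f x))),
       unt = scalar_module R,
       teno = tensor_module R,
       tena = tensor_map R,
       assoc = (\<lambda>L M N.
         (tensor_module R (tensor_module R L M) N, tensor_module R L (tensor_module R M N),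
          \<lambda>x\<in>carrier (tensor_module R (tensor_module R L M) N).
            tensor_sum R L (tensor_module R M N)
              [(l, tensor_sum R M N [(m, y)]). (t, y) \<leftarrow> ten x, (l, m) \<leftarrow> ten t])),
       lunit = (\<lambda>M. (tensor_module R (scalar_module R) M, M,
          \<lambda>x\<in>carrier (tensor_module R (scalar_module R) M).
            foldr (\<lambda>(r, m) a. sca r \<odot>\<^bsub>M\<^esub> m \<oplus>\<^bsub>M\<^esub> a) (ten x) \<zero>\<^bsub>M\<^esub>)),
       runit = (\<lambda>M. (tensor_module R M (scalar_module R), M,
          \<lambda>x\<in>carrier (tensor_module R M (scalar_module R)).
            foldr (\<lambda>(m, r) a. sca r \<odot>\<^bsub>M\<^esub> m \<oplus>\<^bsub>M\<^esub> a) (ten x) \<zero>\<^bsub>M\<^esub>)),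
       symm = (\<lambda>M N. (tensor_module R M N, tensor_module R N M,
          \<lambda>x\<in>carrier (tensor_module R M N).
            tensor_sum R N M (map (\<lambda>(m, y). (y, m)) (ten x)))) \<rparr>"


section \<open>Oriented smooth manifolds with boundary\<close>

subsection \<open>Smooth maps between subsets of Euclidean spaces\<close>

text \<open>\<^term>\<open>Euclidean_space n\<close> consists of the sequences \<open>x\<close> with \<open>x i = 0\<close> for \<open>i \<ge> n\<close>.\<close>

definition partial_deriv :: "nat \<Rightarrow> ((nat \<Rightarrow> real) \<Rightarrow> real) \<Rightarrow> (nat \<Rightarrow> real) \<Rightarrow> real" where
  "partial_deriv i f x = deriv (\<lambda>t. f (x(i := t))) (x i)"

primrec C_k_on :: "nat \<Rightarrow> (nat \<Rightarrow> real) set \<Rightarrow> nat \<Rightarrow> ((nat \<Rightarrow> real) \<Rightarrow> real) \<Rightarrow> bool" where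
  "C_k_on n U 0 f \<longleftrightarrow> continuous_map (subtopology (Euclidean_space n) U) euclideanreal f"
| "C_k_on n U (Suc k) f \<longleftrightarrow>
     continuous_map (subtopology (Euclidean_space n) U) euclideanreal f \<and>
     (\<forall>i<n. (\<forall>x\<in>U. (\<lambda>t. f (x(i := t))) differentiable (at (x i))) \<and>
            C_k_on n U k (partial_deriv i f))"

definition smooth_on :: "nat \<Rightarrow> (nat \<Rightarrow> real) set \<Rightarrow> ((nat \<Rightarrow> real) \<Rightarrow> real) \<Rightarrow> bool" where
  "smooth_on n U f \<longleftrightarrow> (\<forall>k. C_k_on n U k f)"

text \<open>\<open>F\<close> is smooth near \<open>x\<close> and agrees near \<open>x\<close> with \<open>f\<close>, which is only considered on \<open>S\<close>.\<close>

definition smooth_extension ::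
  "nat \<Rightarrow> (nat \<Rightarrow> real) set \<Rightarrow> ((nat \<Rightarrow> real) \<Rightarrow> (nat \<Rightarrow> real)) \<Rightarrow> (nat \<Rightarrow> real) \<Rightarrow>
   ((nat \<Rightarrow> real) \<Rightarrow> (nat \<Rightarrow> real)) \<Rightarrow> bool" where
  "smooth_extension n S f x F \<longleftrightarrow>
     (\<exists>U. openin (Euclidean_space n) U \<and> x \<in> U \<and> (\<forall>j<n. smooth_on n U (\<lambda>y. F y j)) \<and>
          (\<forall>y\<in>S \<inter> U. \<forall>j<n. F y j = f y j))"

definition jacobian ::
  "nat \<Rightarrow> ((nat \<Rightarrow> real) \<Rightarrow> (nat \<Rightarrow> real)) \<Rightarrow> (nat \<Rightarrow> real) \<Rightarrow> real" where
  "jacobian n F x =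
     Determinant.det (Matrix.mat n n (\<lambda>(i, j). partial_deriv j (\<lambda>y. F y i) x))"

text \<open>\<open>f : S \<rightarrow> \<real>\<^sup>n\<close> is smooth and its Jacobian determinant has sign \<open>\<sigma> \<in> {1, -1}\<close>
  everywhere. All \<open>S\<close> that occur are relatively open in a half space, so that the derivative of
  an extension at a point of \<open>S\<close> is determined by \<open>f\<close>.\<close>

definition smooth_with_sign ::
  "nat \<Rightarrow> (nat \<Rightarrow> real) set \<Rightarrow> ((nat \<Rightarrow> real) \<Rightarrow> (nat \<Rightarrow> real)) \<Rightarrow> real \<Rightarrow> bool" where
  "smooth_with_sign n S f \<sigma> \<longleftrightarrow>
     (\<forall>x\<in>S. \<exists>F. smooth_extension n S f x F \<and> sgn (jacobian n F x) = \<sigma>)"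

subsection \<open>Manifolds\<close>

text \<open>A smooth structure together with an orientation is a maximal atlas of signed charts
  \<open>(U, \<phi>, s)\<close>: the sign \<open>s\<close> says whether \<open>\<phi>\<close> preserves (\<open>1\<close>) or reverses (\<open>-1\<close>) the orientation.
  Signs are needed in dimension 0, and in dimension 1 at boundary points. Charts take values in the
  half space \<open>x\<^sub>0 \<le> 0\<close>, on whose boundary the first basis vector points outward. In dimension 0
  the half space is the whole space.\<close>

type_synonym 'p chart = "'p set \<times> ('p \<Rightarrow> nat \<Rightarrow> real) \<times> real"

record 'p mfd =
  space :: "'p topology"
  atlas :: "'p chart set"

abbreviation points :: "('p, 'z) mfd_scheme \<Rightarrow> 'p set" where
  "points M \<equiv> topspace (mfd.space M)"

definition half_space :: "nat \<Rightarrow> (nat \<Rightarrow> real) topology" where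
  "half_space n = subtopology (Euclidean_space n) {x. x 0 \<le> 0}"

definition is_chart :: "nat \<Rightarrow> 'p topology \<Rightarrow> 'p chart \<Rightarrow> bool" where
  "is_chart n T = (\<lambda>(U, \<phi>, s).
     openin T U \<and> \<phi> \<in> extensional U \<and> s \<in> {1, -1} \<and> openin (half_space n) (\<phi> ` U) \<and>
     homeomorphic_map (subtopology T U) (subtopology (half_space n) (\<phi> ` U)) \<phi>)"

definition compatible :: "nat \<Rightarrow> 'p chart \<Rightarrow> 'p chart \<Rightarrow> bool" where
  "compatible n = (\<lambda>(U, \<phi>, s) (V, \<xi>, t).
     smooth_with_sign n (\<phi> ` (U \<inter> V)) (\<lambda>y. \<xi> (inv_into U \<phi> y)) (s * t) \<and>
     smooth_with_sign n (\<xi> ` (U \<inter> V)) (\<lambda>y. \<phi> (inv_into V \<xi> y)) (s * t))"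

definition manifold :: "nat \<Rightarrow> 'p mfd \<Rightarrow> bool" where
  "manifold n M \<longleftrightarrow>
     compact_space (mfd.space M) \<and> Hausdorff_space (mfd.space M) \<and>
     (\<Union>(U, \<phi>, s)\<in>atlas M. U) = points M \<and>
     (\<forall>c\<in>atlas M. is_chart n (mfd.space M) c) \<and>
     (\<forall>c\<in>atlas M. \<forall>d\<in>atlas M. compatible n c d) \<and>
     (\<forall>c. is_chart n (mfd.space M) c \<and> (\<forall>d\<in>atlas M. compatible n c d) \<longrightarrow> c \<in> atlas M)"

definition boundary :: "nat \<Rightarrow> 'p mfd \<Rightarrow> 'p set" where
  "boundary n M = {p. n > 0 \<and> (\<exists>(U, \<phi>, s)\<in>atlas M. p \<in> U \<and> \<phi> p 0 = 0)}"

definition closed_manifold :: "nat \<Rightarrow> 'p mfd \<Rightarrow> bool" where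
  "closed_manifold n M \<longleftrightarrow> manifold n M \<and> boundary n M = {}"

definition oriented_smooth :: "nat \<Rightarrow> 'p mfd \<Rightarrow> 'q mfd \<Rightarrow> ('p \<Rightarrow> 'q) \<Rightarrow> bool" where
  "oriented_smooth n M N f \<longleftrightarrow>
     (\<forall>(U, \<phi>, s)\<in>atlas M. \<forall>(V, \<xi>, t)\<in>atlas N.
        smooth_with_sign n (\<phi> ` (U \<inter> f -` V)) (\<lambda>y. \<xi> (f (inv_into U \<phi> y))) (s * t))"

definition oriented_diffeo :: "nat \<Rightarrow> 'p mfd \<Rightarrow> 'q mfd \<Rightarrow> ('p \<Rightarrow> 'q) \<Rightarrow> bool" where
  "oriented_diffeo n M N f \<longleftrightarrow>
     f \<in> extensional (points M) \<and> homeomorphic_map (mfd.space M) (mfd.space N) f \<and>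
     oriented_smooth n M N f \<and> oriented_smooth n N M (inv_into (points M) f)"

definition oriented_embedding :: "nat \<Rightarrow> 'p mfd \<Rightarrow> 'q mfd \<Rightarrow> ('p \<Rightarrow> 'q) \<Rightarrow> bool" where
  "oriented_embedding n M N f \<longleftrightarrow>
     embedding_map (mfd.space M) (mfd.space N) f \<and> oriented_smooth n M N f"

text \<open>A smooth embedding of a closed \<open>n\<close>-manifold into the boundary of an \<open>(n+1)\<close>-manifold that
  preserves (\<open>\<sigma> = 1\<close>) or reverses (\<open>\<sigma> = -1\<close>) orientation, the boundary being oriented by the
  outward-normal-first convention: forgetting coordinate 0 turns a positive chart of \<open>W\<close> at a
  boundary point into a positive chart of the boundary.\<close>

definition boundary_embedding :: "nat \<Rightarrow> 'p mfd \<Rightarrow> 'q mfd \<Rightarrow> ('p \<Rightarrow> 'q) \<Rightarrow> real \<Rightarrow> bool" where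
  "boundary_embedding n M W i \<sigma> \<longleftrightarrow>
     i \<in> extensional (points M) \<and> embedding_map (mfd.space M) (mfd.space W) i \<and>
     i ` points M \<subseteq> boundary (Suc n) W \<and>
     (\<forall>(U, \<phi>, s)\<in>atlas M. \<forall>(V, \<xi>, t)\<in>atlas W.
        smooth_with_sign n (\<phi> ` (U \<inter> i -` V))
          (\<lambda>y k. \<xi> (i (inv_into U \<phi> y)) (Suc k)) (\<sigma> * s * t))"

subsection \<open>A universe of points and disjoint unions\<close>

text \<open>\<open>Tag False\<close> and \<open>Tag True\<close> are the injections into a disjoint union; \<open>At t p\<close> is the point
  \<open>(t, p)\<close> of a cylinder. Every compact manifold is diffeomorphic to one with points in this type.\<close>

datatype 'u pt = Pt 'u | Tag bool "'u pt" | At real "'u pt"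

fun untag :: "'u pt \<Rightarrow> bool \<times> 'u pt" where
  "untag (Tag b p) = (b, p)"
| "untag _ = undefined"

fun unat :: "'u pt \<Rightarrow> real \<times> 'u pt" where
  "unat (At t p) = (t, p)"
| "unat _ = undefined"

fun case_tag :: "('u pt \<Rightarrow> 'c) \<Rightarrow> ('u pt \<Rightarrow> 'c) \<Rightarrow> 'u pt \<Rightarrow> 'c" where
  "case_tag f g (Tag b p) = (if b then g p else f p)"
| "case_tag f g _ = undefined"

definition sum_set :: "'u pt set \<Rightarrow> 'u pt set \<Rightarrow> 'u pt set" where
  "sum_set A B = Tag False ` A \<union> Tag True ` B"

definition sum_space :: "'u pt topology \<Rightarrow> 'u pt topology \<Rightarrow> 'u pt topology" where
  "sum_space S T = pullback_topology (sum_set (topspace S) (topspace T)) untag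
     (sum_topology (\<lambda>b. if b then T else S) UNIV)"

definition sum_mfd :: "nat \<Rightarrow> 'u pt mfd \<Rightarrow> 'u pt mfd \<Rightarrow> 'u pt mfd" where
  "sum_mfd n M N =
     \<lparr> space = sum_space (mfd.space M) (mfd.space N),
       atlas = {(U, \<phi>, s). is_chart n (sum_space (mfd.space M) (mfd.space N)) (U, \<phi>, s) \<and>
         (Tag False -` U, \<lambda>p\<in>Tag False -` U. \<phi> (Tag False p), s) \<in> atlas M \<and>
         (Tag True -` U, \<lambda>p\<in>Tag True -` U. \<phi> (Tag True p), s) \<in> atlas N} \<rparr>"

definition empty_mfd :: "'p mfd" where
  "empty_mfd = \<lparr> space = discrete_topology {}, atlas = {({}, \<lambda>_. undefined, s) | s. s \<in> {1, -1}} \<rparr>"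


section \<open>Manifolds with a map to the target space\<close>

record ('u, 'x) xman =
  und :: "'u pt mfd"
  base :: "'u pt set"
  chi :: "'u pt \<Rightarrow> 'x"

type_synonym ('u, 'x) xdiff = "('u, 'x) xman \<times> ('u, 'x) xman \<times> ('u pt \<Rightarrow> 'u pt)"

abbreviation xpoints :: "('u, 'x) xman \<Rightarrow> 'u pt set" where
  "xpoints M \<equiv> points (und M)"

definition x_manifold :: "nat \<Rightarrow> 'x topology \<Rightarrow> 'x \<Rightarrow> ('u, 'x) xman \<Rightarrow> bool" where
  "x_manifold n X x0 M \<longleftrightarrow>
     closed_manifold n (und M) \<and>
     base M \<subseteq> xpoints M \<and>
     (\<forall>C\<in>connected_components_of (mfd.space (und M)). \<exists>!b. b \<in> base M \<inter> C) \<and>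
     chi M \<in> extensional (xpoints M) \<and>
     continuous_map (mfd.space (und M)) X (chi M) \<and>
     (\<forall>b\<in>base M. chi M b = x0)"

definition x_diffeo :: "nat \<Rightarrow> ('u, 'x) xman \<Rightarrow> ('u, 'x) xman \<Rightarrow> ('u pt \<Rightarrow> 'u pt) \<Rightarrow> bool" where
  "x_diffeo n M N f \<longleftrightarrow>
     oriented_diffeo n (und M) (und N) f \<and> f ` base M \<subseteq> base N \<and>
     (\<forall>p\<in>xpoints M. chi N (f p) = chi M p)"

definition sum_xman :: "nat \<Rightarrow> ('u, 'x) xman \<Rightarrow> ('u, 'x) xman \<Rightarrow> ('u, 'x) xman" where
  "sum_xman n M N =
     \<lparr> und = sum_mfd n (und M) (und N),
       base = sum_set (base M) (base N),
       chi = case_tag (chi M) (chi N) \<rparr>"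

definition empty_xman :: "('u, 'x) xman" where
  "empty_xman = \<lparr> und = empty_mfd, base = {}, chi = \<lambda>_. undefined \<rparr>"

definition Diff :: "nat \<Rightarrow> 'x topology \<Rightarrow> 'x \<Rightarrow> (('u, 'x) xman, ('u, 'x) xdiff) smcat" where
  "Diff n X x0 =
     \<lparr> obj = {M. x_manifold n X x0 M},
       arr = {(M, N, f). x_manifold n X x0 M \<and> x_manifold n X x0 N \<and> x_diffeo n M N f},
       source = (\<lambda>(M, N, f). M),
       target = (\<lambda>(M, N, f). N),
       idt = (\<lambda>M. (M, M, \<lambda>p\<in>xpoints M. p)),
       cmp = (\<lambda>(M, N, f) (N', P, g). (M, P, \<lambda>p\<in>xpoints M. g (f p))),
       unt = empty_xman,
       teno = sum_xman n,
       tena = (\<lambda>(M, N, f) (M', N', g). (sum_xman n M M', sum_xman n N N',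
          \<lambda>p\<in>xpoints (sum_xman n M M'). case_tag (\<lambda>q. Tag False (f q)) (\<lambda>q. Tag True (g q)) p)),
       assoc = (\<lambda>L M N.
         (sum_xman n (sum_xman n L M) N, sum_xman n L (sum_xman n M N),
          \<lambda>p\<in>xpoints (sum_xman n (sum_xman n L M) N).
            case_tag (case_tag (\<lambda>q. Tag False q) (\<lambda>q. Tag True (Tag False q)))
                     (\<lambda>q. Tag True (Tag True q)) p)),
       lunit = (\<lambda>M. (sum_xman n empty_xman M, M,
          \<lambda>p\<in>xpoints (sum_xman n empty_xman M). snd (untag p))),
       runit = (\<lambda>M. (sum_xman n M empty_xman, M,
          \<lambda>p\<in>xpoints (sum_xman n M empty_xman). snd (untag p))),
       symm = (\<lambda>M N. (sum_xman n M N, sum_xman n N M,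
          \<lambda>p\<in>xpoints (sum_xman n M N). case_tag (Tag True) (Tag False) p)) \<rparr>"


section \<open>Cobordisms with a map to the target space\<close>

text \<open>The identification \<open>\<partial>W = -M \<amalg> N\<close> is given by embeddings \<open>inc\<close> of \<open>M\<close> and \<open>out\<close> of \<open>N\<close>.
  The field \<open>hcl\<close> is the homotopy class relative to the boundary.\<close>

record ('u, 'x) xcob =
  src :: "('u, 'x) xman"
  tgt :: "('u, 'x) xman"
  body :: "'u pt mfd"
  inc :: "'u pt \<Rightarrow> 'u pt"
  out :: "'u pt \<Rightarrow> 'u pt"
  hcl :: "('u pt \<Rightarrow> 'x) set"

abbreviation wpoints :: "('u, 'x) xcob \<Rightarrow> 'u pt set" where
  "wpoints W \<equiv> points (body W)"

definition rel_homotopy_class :: "'p topology \<Rightarrow> 'p set \<Rightarrow> 'x topology \<Rightarrow> ('p \<Rightarrow> 'x) \<Rightarrow> ('p \<Rightarrow> 'x) set"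
  where "rel_homotopy_class T B X f =
     {k \<in> extensional (topspace T). homotopic_with (\<lambda>l. \<forall>p\<in>B. l p = f p) T X f k}"

definition x_cobordism :: "nat \<Rightarrow> 'x topology \<Rightarrow> 'x \<Rightarrow> ('u, 'x) xcob \<Rightarrow> bool" where
  "x_cobordism n X x0 W \<longleftrightarrow>
     x_manifold n X x0 (src W) \<and> x_manifold n X x0 (tgt W) \<and>
     manifold (Suc n) (body W) \<and>
     boundary_embedding n (und (src W)) (body W) (inc W) (- 1) \<and>
     boundary_embedding n (und (tgt W)) (body W) (out W) 1 \<and>
     inc W ` xpoints (src W) \<inter> out W ` xpoints (tgt W) = {} \<and>
     inc W ` xpoints (src W) \<union> out W ` xpoints (tgt W) = boundary (Suc n) (body W) \<and>
     (\<exists>f. f \<in> extensional (wpoints W) \<and> continuous_map (mfd.space (body W)) X f \<and>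
          (\<forall>q\<in>xpoints (src W). f (inc W q) = chi (src W) q) \<and>
          (\<forall>q\<in>xpoints (tgt W). f (out W q) = chi (tgt W) q) \<and>
          hcl W = rel_homotopy_class (mfd.space (body W)) (boundary (Suc n) (body W)) X f)"

text \<open>The restrictions of \<open>\<Psi> : W \<rightarrow> V\<close> to the incoming and outgoing boundaries, read through the
  boundary identifications.\<close>

definition restr_in :: "('u, 'x) xcob \<Rightarrow> ('u, 'x) xcob \<Rightarrow> ('u pt \<Rightarrow> 'u pt) \<Rightarrow> ('u, 'x) xdiff" where
  "restr_in W V \<Psi> = (src W, src V,
     \<lambda>q\<in>xpoints (src W). inv_into (xpoints (src V)) (inc V) (\<Psi> (inc W q)))"

definition restr_out :: "('u, 'x) xcob \<Rightarrow> ('u, 'x) xcob \<Rightarrow> ('u pt \<Rightarrow> 'u pt) \<Rightarrow> ('u, 'x) xdiff" where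
  "restr_out W V \<Psi> = (tgt W, tgt V,
     \<lambda>q\<in>xpoints (tgt W). inv_into (xpoints (tgt V)) (out V) (\<Psi> (out W q)))"

text \<open>The diffeomorphism is orientation-preserving and its boundary restrictions preserve base
  points, so that they are \<open>X\<close>-diffeomorphisms.\<close>

definition cob_diffeo ::
  "nat \<Rightarrow> 'x topology \<Rightarrow> 'x \<Rightarrow> ('u, 'x) xcob \<Rightarrow> ('u, 'x) xcob \<Rightarrow> ('u pt \<Rightarrow> 'u pt) \<Rightarrow> bool" where
  "cob_diffeo n X x0 W V \<Psi> \<longleftrightarrow>
     x_cobordism n X x0 W \<and> x_cobordism n X x0 V \<and>
     oriented_diffeo (Suc n) (body W) (body V) \<Psi> \<and>
     \<Psi> ` inc W ` xpoints (src W) = inc V ` xpoints (src V) \<and>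
     \<Psi> ` out W ` xpoints (tgt W) = out V ` xpoints (tgt V) \<and>
     restr_in W V \<Psi> \<in> arr (Diff n X x0) \<and>
     restr_out W V \<Psi> \<in> arr (Diff n X x0) \<and>
     hcl W = (\<lambda>k. \<lambda>p\<in>wpoints W. k (\<Psi> p)) ` hcl V"

text \<open>\<open>U\<close> is obtained by gluing \<open>W\<close> and \<open>V\<close> along \<open>\<psi> : tgt W \<rightarrow> src V\<close>. The smooth structure of
  the glued space is not canonical (it is unique only up to diffeomorphism relative to the
  boundary), so gluing is a relation rather than a function: \<open>U\<close> is any cobordism that is the union
  of smoothly embedded copies of \<open>W\<close> and \<open>V\<close> meeting exactly along the boundary part identified
  by \<open>\<psi>\<close>, with the class of a map that lies in the given classes on \<open>W\<close> and on \<open>V\<close>.\<close>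

definition gluing ::
  "nat \<Rightarrow> 'x topology \<Rightarrow> 'x \<Rightarrow> ('u, 'x) xcob \<Rightarrow> ('u, 'x) xdiff \<Rightarrow> ('u, 'x) xcob \<Rightarrow> ('u, 'x) xcob \<Rightarrow> bool"
  where
  "gluing n X x0 W \<psi> V U \<longleftrightarrow>
     x_cobordism n X x0 W \<and> x_cobordism n X x0 V \<and> x_cobordism n X x0 U \<and>
     \<psi> \<in> hom_arr (Diff n X x0) (tgt W) (src V) \<and>
     src U = src W \<and> tgt U = tgt V \<and>
     (\<exists>a b. oriented_embedding (Suc n) (body W) (body U) a \<and>
            oriented_embedding (Suc n) (body V) (body U) b \<and>
            a ` wpoints W \<union> b ` wpoints V = wpoints U \<and>
            a ` wpoints W \<inter> b ` wpoints V = a ` out W ` xpoints (tgt W) \<and>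
            (\<forall>q\<in>xpoints (tgt W). a (out W q) = b (inc V ((snd (snd \<psi>)) q))) \<and>
            (\<forall>q\<in>xpoints (src W). inc U q = a (inc W q)) \<and>
            (\<forall>q\<in>xpoints (tgt V). out U q = b (out V q)) \<and>
            (\<exists>h\<in>hcl U. (\<lambda>p\<in>wpoints W. h (a p)) \<in> hcl W \<and> (\<lambda>p\<in>wpoints V. h (b p)) \<in> hcl V))"

definition sum_xcob :: "nat \<Rightarrow> ('u, 'x) xcob \<Rightarrow> ('u, 'x) xcob \<Rightarrow> ('u, 'x) xcob" where
  "sum_xcob n W V =
     \<lparr> src = sum_xman n (src W) (src V),
       tgt = sum_xman n (tgt W) (tgt V),
       body = sum_mfd (Suc n) (body W) (body V),
       inc = (\<lambda>p\<in>xpoints (sum_xman n (src W) (src V)).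
         case_tag (\<lambda>q. Tag False (inc W q)) (\<lambda>q. Tag True (inc V q)) p),
       out = (\<lambda>p\<in>xpoints (sum_xman n (tgt W) (tgt V)).
         case_tag (\<lambda>q. Tag False (out W q)) (\<lambda>q. Tag True (out V q)) p),
       hcl = {case_tag f g | f g. f \<in> hcl W \<and> g \<in> hcl V} \<rparr>"

definition empty_xcob :: "('u, 'x) xcob" where
  "empty_xcob =
     \<lparr> src = empty_xman, tgt = empty_xman, body = empty_mfd,
       inc = \<lambda>_. undefined, out = \<lambda>_. undefined, hcl = {\<lambda>_. undefined} \<rparr>"

text \<open>\<open>W = (I \<times> M, 1\<^sub>g)\<close>: the oriented smooth structure is the one whose maximal atlas contains
  the charts \<open>(t, p) \<mapsto> (t - 1, \<phi> p)\<close> near \<open>t = 1\<close> and, with opposite sign,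
  \<open>(t, p) \<mapsto> (- t, \<phi> p)\<close> near \<open>t = 0\<close>.\<close>

definition is_cylinder :: "nat \<Rightarrow> 'x topology \<Rightarrow> 'x \<Rightarrow> ('u, 'x) xman \<Rightarrow> ('u, 'x) xcob \<Rightarrow> bool" where
  "is_cylinder n X x0 M W \<longleftrightarrow>
     x_cobordism n X x0 W \<and> src W = M \<and> tgt W = M \<and>
     mfd.space (body W) = pullback_topology {At t p | t p. t \<in> {0..1} \<and> p \<in> xpoints M} unat
        (prod_topology (top_of_set {0..1}) (mfd.space (und M))) \<and>
     inc W = (\<lambda>p\<in>xpoints M. At 0 p) \<and> out W = (\<lambda>p\<in>xpoints M. At 1 p) \<and>
     (\<forall>(U, \<phi>, s)\<in>atlas (und M).
        ({At t p | t p. t \<in> {0<..1} \<and> p \<in> U},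
         \<lambda>w\<in>{At t p | t p. t \<in> {0<..1} \<and> p \<in> U}.
           case_nat (fst (unat w) - 1) (\<phi> (snd (unat w))), s) \<in> atlas (body W) \<and>
        ({At t p | t p. t \<in> {0..<1} \<and> p \<in> U},
         \<lambda>w\<in>{At t p | t p. t \<in> {0..<1} \<and> p \<in> U}.
           case_nat (- fst (unat w)) (\<phi> (snd (unat w))), - s) \<in> atlas (body W)) \<and>
     (\<lambda>w\<in>wpoints W. chi M (snd (unat w))) \<in> hcl W"


section \<open>Homotopy quantum field theories\<close>

text \<open>Functoriality and monoidality with respect to \<open>X\<close>-diffeomorphisms say that \<open>DF\<close>,
  consisting of the values on manifolds and \<open>X\<close>-diffeomorphisms and of the isomorphisms \<open>c\<close> and
  \<open>u\<close>, is a symmetric monoidal functor; \<open>CF\<close> is the assignment on \<open>X\<close>-cobordisms. The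
  compatibility with \<open>u\<close> concerns the empty cobordism \<open>\<emptyset> \<rightarrow> \<emptyset>\<close>; it is not required
  of arbitrary cobordisms \<open>\<emptyset> \<rightarrow> \<emptyset>\<close>, whose values are the invariants of closed manifolds.\<close>

record ('u, 'x, 'r, 'm) hqft =
  DF :: "(('u, 'x) xman, ('u, 'x) xdiff, ('r, 'm) rmod, ('r, 'm) rmap) smfun"
  CF :: "('u, 'x) xcob \<Rightarrow> ('r, 'm) rmap"

definition is_hqft :: "nat \<Rightarrow> 'x topology \<Rightarrow> 'x \<Rightarrow> 'r ring \<Rightarrow> ('u, 'x, 'r, 'm) hqft \<Rightarrow> bool" where
  "is_hqft n X x0 R \<tau> \<longleftrightarrow>
     sm_functor (Diff n X x0) (FMod R) (DF \<tau>) \<and>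
     CF \<tau> \<in> extensional {W. x_cobordism n X x0 W} \<and>
     (\<forall>W. x_cobordism n X x0 W \<longrightarrow>
        CF \<tau> W \<in> hom_arr (FMod R) (FO (DF \<tau>) (src W)) (FO (DF \<tau>) (tgt W))) \<and>
     (\<forall>W \<psi> V U. gluing n X x0 W \<psi> V U \<longrightarrow>
        CF \<tau> U = CF \<tau> W \<cdot>\<^bsub>FMod R\<^esub> FA (DF \<tau>) \<psi> \<cdot>\<^bsub>FMod R\<^esub> CF \<tau> V) \<and>
     (\<forall>M W. is_cylinder n X x0 M W \<longrightarrow> CF \<tau> W = idt (FMod R) (FO (DF \<tau>) M)) \<and>
     (\<forall>W V. x_cobordism n X x0 W \<longrightarrow> x_cobordism n X x0 V \<longrightarrow>
        CF \<tau> (sum_xcob n W V) \<cdot>\<^bsub>FMod R\<^esub> FC (DF \<tau>) (tgt W, tgt V) =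
        FC (DF \<tau>) (src W, src V) \<cdot>\<^bsub>FMod R\<^esub> tena (FMod R) (CF \<tau> W) (CF \<tau> V)) \<and>
     CF \<tau> empty_xcob \<cdot>\<^bsub>FMod R\<^esub> FU (DF \<tau>) = FU (DF \<tau>) \<and>
     (\<forall>W V \<Psi>. cob_diffeo n X x0 W V \<Psi> \<longrightarrow>
        CF \<tau> W \<cdot>\<^bsub>FMod R\<^esub> FA (DF \<tau>) (restr_out W V \<Psi>) =
        FA (DF \<tau>) (restr_in W V \<Psi>) \<cdot>\<^bsub>FMod R\<^esub> CF \<tau> V)"

definition hqft_map ::
  "nat \<Rightarrow> 'x topology \<Rightarrow> 'x \<Rightarrow> 'r ring \<Rightarrow> ('u, 'x, 'r, 'm) hqft \<Rightarrow> ('u, 'x, 'r, 'm) hqft \<Rightarrow>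
   (('u, 'x) xman \<Rightarrow> ('r, 'm) rmap) \<Rightarrow> bool" where
  "hqft_map n X x0 R \<tau> \<rho> \<theta> \<longleftrightarrow>
     sm_transformation (Diff n X x0) (FMod R) (DF \<tau>) (DF \<rho>) \<theta> \<and>
     (\<forall>W. x_cobordism n X x0 W \<longrightarrow>
        CF \<tau> W \<cdot>\<^bsub>FMod R\<^esub> \<theta> (tgt W) = \<theta> (src W) \<cdot>\<^bsub>FMod R\<^esub> CF \<rho> W)"

definition HQFT ::
  "nat \<Rightarrow> 'x topology \<Rightarrow> 'x \<Rightarrow> 'r ring \<Rightarrow>
   (('u, 'x, 'r, 'm) hqft,
    ('u, 'x, 'r, 'm) hqft \<times> ('u, 'x, 'r, 'm) hqft \<times> (('u, 'x) xman \<Rightarrow> ('r, 'm) rmap)) cat" where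
  "HQFT n X x0 R =
     \<lparr> obj = {\<tau>. is_hqft n X x0 R \<tau>},
       arr = {(\<tau>, \<rho>, \<theta>). is_hqft n X x0 R \<tau> \<and> is_hqft n X x0 R \<rho> \<and> hqft_map n X x0 R \<tau> \<rho> \<theta>},
       source = (\<lambda>(\<tau>, \<rho>, \<theta>). \<tau>),
       target = (\<lambda>(\<tau>, \<rho>, \<theta>). \<rho>),
       idt = (\<lambda>\<tau>. (\<tau>, \<tau>, \<lambda>M\<in>obj (Diff n X x0). idt (FMod R) (FO (DF \<tau>) M))),
       cmp = (\<lambda>(\<tau>, \<rho>, \<theta>) (\<rho>', \<kappa>, \<eta>). (\<tau>, \<kappa>, \<lambda>M\<in>obj (Diff n X x0). \<theta> M \<cdot>\<^bsub>FMod R\<^esub> \<eta> M)) \<rparr>"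


section \<open>The homotopy cobordism category\<close>

text \<open>Formal composites and monoidal products of the generators. Modulo \<open>hrel\<close> below, every
  well-typed term equals a composable string of generators, since \<open>s \<otimes> t = (s \<otimes> 1) (1 \<otimes> t)\<close>
  and identities may be written as \<open>X\<close>-diffeomorphisms or as cylinders.\<close>

datatype ('u, 'x) hterm =
    TDiff "('u, 'x) xdiff"
  | TCob "('u, 'x) xcob"
  | TComp "('u, 'x) hterm" "('u, 'x) hterm"
  | TTen "('u, 'x) hterm" "('u, 'x) hterm"

inductive htyped ::
  "nat \<Rightarrow> 'x topology \<Rightarrow> 'x \<Rightarrow> ('u, 'x) hterm \<Rightarrow> ('u, 'x) xman \<Rightarrow> ('u, 'x) xman \<Rightarrow> bool"
  for n X x0 where
  diff: "\<psi> \<in> hom_arr (Diff n X x0) M N \<Longrightarrow> htyped n X x0 (TDiff \<psi>) M N"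
| cob: "x_cobordism n X x0 W \<Longrightarrow> htyped n X x0 (TCob W) (src W) (tgt W)"
| comp: "htyped n X x0 s M N \<Longrightarrow> htyped n X x0 t N P \<Longrightarrow> htyped n X x0 (TComp s t) M P"
| ten: "htyped n X x0 s M N \<Longrightarrow> htyped n X x0 t M' N' \<Longrightarrow>
    htyped n X x0 (TTen s t) (sum_xman n M M') (sum_xman n N N')"

text \<open>The smallest congruence that yields a category and a bifunctorial product and contains the
  relations defining the homotopy cobordism category.\<close>

inductive hrel ::
  "nat \<Rightarrow> 'x topology \<Rightarrow> 'x \<Rightarrow> ('u, 'x) hterm \<Rightarrow> ('u, 'x) hterm \<Rightarrow> bool"
  for n X x0 where
  refl: "htyped n X x0 s M N \<Longrightarrow> hrel n X x0 s s"
| sym: "hrel n X x0 s t \<Longrightarrow> hrel n X x0 t s"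
| trans: "hrel n X x0 s t \<Longrightarrow> hrel n X x0 t r \<Longrightarrow> hrel n X x0 s r"
| comp_cong: "hrel n X x0 s s' \<Longrightarrow> hrel n X x0 t t' \<Longrightarrow>
    htyped n X x0 s M N \<Longrightarrow> htyped n X x0 s' M N \<Longrightarrow>
    htyped n X x0 t N P \<Longrightarrow> htyped n X x0 t' N P \<Longrightarrow>
    hrel n X x0 (TComp s t) (TComp s' t')"
| ten_cong: "hrel n X x0 s s' \<Longrightarrow> hrel n X x0 t t' \<Longrightarrow>
    htyped n X x0 s M N \<Longrightarrow> htyped n X x0 s' M N \<Longrightarrow>
    htyped n X x0 t M' N' \<Longrightarrow> htyped n X x0 t' M' N' \<Longrightarrow>
    hrel n X x0 (TTen s t) (TTen s' t')"
| comp_assoc: "htyped n X x0 r M N \<Longrightarrow> htyped n X x0 s N P \<Longrightarrow> htyped n X x0 t P Q \<Longrightarrow>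
    hrel n X x0 (TComp (TComp r s) t) (TComp r (TComp s t))"
| id_left: "htyped n X x0 s M N \<Longrightarrow>
    hrel n X x0 (TComp (TDiff (idt (Diff n X x0) M)) s) s"
| id_right: "htyped n X x0 s M N \<Longrightarrow>
    hrel n X x0 (TComp s (TDiff (idt (Diff n X x0) N))) s"
| interchange: "htyped n X x0 s M N \<Longrightarrow> htyped n X x0 s' N P \<Longrightarrow>
    htyped n X x0 t M' N' \<Longrightarrow> htyped n X x0 t' N' P' \<Longrightarrow>
    hrel n X x0 (TComp (TTen s t) (TTen s' t')) (TTen (TComp s s') (TComp t t'))"
| ten_diff: "\<psi> \<in> arr (Diff n X x0) \<Longrightarrow> \<xi> \<in> arr (Diff n X x0) \<Longrightarrow>
    hrel n X x0 (TTen (TDiff \<psi>) (TDiff \<xi>)) (TDiff (tena (Diff n X x0) \<psi> \<xi>))"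
| ten_cob: "x_cobordism n X x0 W \<Longrightarrow> x_cobordism n X x0 V \<Longrightarrow>
    hrel n X x0 (TTen (TCob W) (TCob V)) (TCob (sum_xcob n W V))"
| comp_diff: "\<psi> \<in> hom_arr (Diff n X x0) M N \<Longrightarrow> \<xi> \<in> hom_arr (Diff n X x0) N P \<Longrightarrow>
    hrel n X x0 (TComp (TDiff \<psi>) (TDiff \<xi>)) (TDiff (\<psi> \<cdot>\<^bsub>Diff n X x0\<^esub> \<xi>))"
| assoc_nat: "htyped n X x0 r L L' \<Longrightarrow> htyped n X x0 s M M' \<Longrightarrow> htyped n X x0 t N N' \<Longrightarrow>
    hrel n X x0 (TComp (TTen (TTen r s) t) (TDiff (assoc (Diff n X x0) L' M' N')))
                (TComp (TDiff (assoc (Diff n X x0) L M N)) (TTen r (TTen s t)))"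
| lunit_nat: "htyped n X x0 s M N \<Longrightarrow>
    hrel n X x0 (TComp (TTen (TDiff (idt (Diff n X x0) empty_xman)) s)
                       (TDiff (lunit (Diff n X x0) N)))
                (TComp (TDiff (lunit (Diff n X x0) M)) s)"
| runit_nat: "htyped n X x0 s M N \<Longrightarrow>
    hrel n X x0 (TComp (TTen s (TDiff (idt (Diff n X x0) empty_xman)))
                       (TDiff (runit (Diff n X x0) N)))
                (TComp (TDiff (runit (Diff n X x0) M)) s)"
| symm_nat: "htyped n X x0 s M N \<Longrightarrow> htyped n X x0 t M' N' \<Longrightarrow>
    hrel n X x0 (TComp (TTen s t) (TDiff (symm (Diff n X x0) N N')))
                (TComp (TDiff (symm (Diff n X x0) M M')) (TTen t s))"
| cob_diffeo: "cob_diffeo n X x0 W V \<Psi> \<Longrightarrow>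
    hrel n X x0 (TComp (TCob W) (TDiff (restr_out W V \<Psi>)))
                (TComp (TDiff (restr_in W V \<Psi>)) (TCob V))"
| gluing: "gluing n X x0 W \<psi> V U \<Longrightarrow>
    hrel n X x0 (TCob U) (TComp (TComp (TCob W) (TDiff \<psi>)) (TCob V))"
| cylinder: "is_cylinder n X x0 M W \<Longrightarrow>
    hrel n X x0 (TCob W) (TDiff (idt (Diff n X x0) M))"

type_synonym ('u, 'x) harr = "('u, 'x) xman \<times> ('u, 'x) xman \<times> ('u, 'x) hterm set"

definition hclass ::
  "nat \<Rightarrow> 'x topology \<Rightarrow> 'x \<Rightarrow> ('u, 'x) xman \<Rightarrow> ('u, 'x) xman \<Rightarrow> ('u, 'x) hterm \<Rightarrow> ('u, 'x) harr"
  where "hclass n X x0 M N s = (M, N, {t. htyped n X x0 t M N \<and> hrel n X x0 s t})"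

definition diff_class :: "nat \<Rightarrow> 'x topology \<Rightarrow> 'x \<Rightarrow> ('u, 'x) xdiff \<Rightarrow> ('u, 'x) harr" where
  "diff_class n X x0 \<psi> =
     hclass n X x0 (source (Diff n X x0) \<psi>) (target (Diff n X x0) \<psi>) (TDiff \<psi>)"

definition cob_class :: "nat \<Rightarrow> 'x topology \<Rightarrow> 'x \<Rightarrow> ('u, 'x) xcob \<Rightarrow> ('u, 'x) harr" where
  "cob_class n X x0 W = hclass n X x0 (src W) (tgt W) (TCob W)"

definition HCobord :: "nat \<Rightarrow> 'x topology \<Rightarrow> 'x \<Rightarrow> (('u, 'x) xman, ('u, 'x) harr) smcat" where
  "HCobord n X x0 =
     \<lparr> obj = obj (Diff n X x0),
       arr = {hclass n X x0 M N s | M N s. htyped n X x0 s M N},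
       source = (\<lambda>(M, N, A). M),
       target = (\<lambda>(M, N, A). N),
       idt = (\<lambda>M. diff_class n X x0 (idt (Diff n X x0) M)),
       cmp = (\<lambda>(M, N, A) (N', P, B).
         (M, P, {r. htyped n X x0 r M P \<and> (\<exists>s\<in>A. \<exists>t\<in>B. hrel n X x0 (TComp s t) r)})),
       unt = unt (Diff n X x0),
       teno = teno (Diff n X x0),
       tena = (\<lambda>(M, N, A) (M', N', B).
         (sum_xman n M M', sum_xman n N N',
          {r. htyped n X x0 r (sum_xman n M M') (sum_xman n N N') \<and>
              (\<exists>s\<in>A. \<exists>t\<in>B. hrel n X x0 (TTen s t) r)})),
       assoc = (\<lambda>L M N. diff_class n X x0 (assoc (Diff n X x0) L M N)),
       lunit = (\<lambda>M. diff_class n X x0 (lunit (Diff n X x0) M)),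
       runit = (\<lambda>M. diff_class n X x0 (runit (Diff n X x0) M)),
       symm = (\<lambda>M N. diff_class n X x0 (symm (Diff n X x0) M N)) \<rparr>"


section \<open>Restriction to generators\<close>

text \<open>The canonical comparison functor restricts a symmetric monoidal functor on the homotopy
  cobordism category to \<open>X\<close>-diffeomorphisms and \<open>X\<close>-cobordisms, keeping the values on objects, the
  structure isomorphisms, and the components of transformations.\<close>

definition restr_functor ::
  "nat \<Rightarrow> 'x topology \<Rightarrow> 'x \<Rightarrow>
   (('u, 'x) xman, ('u, 'x) harr, ('r, 'm) rmod, ('r, 'm) rmap) smfun \<Rightarrow> ('u, 'x, 'r, 'm) hqft" where
  "restr_functor n X x0 F =
     \<lparr> DF = \<lparr> FO = FO F, FA = (\<lambda>\<psi>\<in>arr (Diff n X x0). FA F (diff_class n X x0 \<psi>)),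
              FC = FC F, FU = FU F \<rparr>,
       CF = (\<lambda>W\<in>{W. x_cobordism n X x0 W}. FA F (cob_class n X x0 W)) \<rparr>"

definition restr_transformation where
  "restr_transformation n X x0 =
     (\<lambda>(F, G, \<theta>). (restr_functor n X x0 F, restr_functor n X x0 G, \<theta>))"

end

theory Submission
  imports Defs
begin

text \<open>A symmetric monoidal functor \<open>F\<close> on the homotopy cobordism category is determined by its values
  on the generators, because \<open>F (s \<otimes> t) = c (F s \<otimes> F t) c\<^sup>-\<^sup>1\<close>. Conversely, this formula extends an HQFT
  recursively to all terms. Under the extension every defining relation of the homotopy cobordism
  category becomes an axiom of HQFTs or a consequence of the naturality of the structure isomorphisms
  of modules, so the extension descends to classes of terms. In the same way a family of maps that is
  natural on generators is natural on all terms.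

  The geometric input is that \<open>X\<close>-diffeomorphisms are closed under composition, which is the chain
  rule, that \<open>X\<close>-manifolds, \<open>X\<close>-diffeomorphisms and \<open>X\<close>-cobordisms are closed under disjoint unions, and
  that the empty cobordism is a cylinder, so that its value is the identity.\<close>

section \<open>Calculus in coordinates\<close>

text \<open>A product of terms is evaluated with the inverse of c, yet equations are not verified by
  computing with that inverse: both sides are composed with c on the right, where the naturality
  square of c applies, and c is cancelled at the end. The cancelled arrows include tensor products
  such as 1 \<otimes> c, whose endpoints are not known to be finitely generated free. Hence arrows
  are handled in the category of all modules, and cancellability is a notion of its own there.

  The relation on terms carries no types, so soundness of the evaluation is proved together with the
  equality of endpoints.

  Elements of a tensor product are chosen representatives of formal sums, and the structure maps of
  modules are written on these representatives. The universal property turns them into linear maps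
  determined by their values on pure tensors, which makes naturality a check on generators.

  On the geometric side atlases are maximal and signed. Compatibility of charts is read as
  smoothness of the identity, so that one gluing principle for smooth maps also yields the atlas of
  a disjoint union.\<close>

lemma Euclidean_space_upd:
  "x \<in> topspace (Euclidean_space n) \<Longrightarrow> i < n \<Longrightarrow> x(i := t) \<in> topspace (Euclidean_space n)"
  by (auto simp: topspace_Euclidean_space)

text \<open>\<open>Euclidean_space n\<close> has the subspace topology of an infinite product, so a
  basic neighbourhood may restrict every coordinate. The coordinates from \<open>n\<close> on vanish
  on the space, which leaves finitely many conditions and hence a cube.\<close>

lemma openin_Euclidean_space_box:
  assumes U: "openin (Euclidean_space n) U" and x: "x \<in> U"
  shows "\<exists>e>0. \<forall>y\<in>topspace (Euclidean_space n). (\<forall>i<n. \<bar>y i - x i\<bar> < e) \<longrightarrow> y \<in> U"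
proof -
  obtain V where V: "openin (powertop_real UNIV) V" "U = V \<inter> topspace (Euclidean_space n)"
    using U unfolding Euclidean_space_def by (auto simp: openin_subtopology)
  then obtain W where W: "\<And>i. openin euclideanreal (W i)" "x \<in> Pi\<^sub>E UNIV W" "Pi\<^sub>E UNIV W \<subseteq> V"
    using x by (force simp: openin_product_topology_alt)
  have "\<exists>e>0. \<forall>t. \<bar>t - x i\<bar> < e \<longrightarrow> t \<in> W i" for i
  proof -
    have "open (W i)" "x i \<in> W i"
      using W by auto
    then show ?thesis
      by (metis dist_real_def open_dist)
  qed
  then obtain e where e: "\<And>i. e i > 0" "\<And>i t. \<bar>t - x i\<bar> < e i \<Longrightarrow> t \<in> W i"
    by metis
  \<comment> \<open>The entry 1 keeps the set nonempty when \<open>n = 0\<close>.\<close>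
  define d where "d = Min (insert 1 (e ` {..<n}))"
  have "d > 0"
    unfolding d_def using e by (subst Min_gr_iff) auto
  moreover have d: "d \<le> e i" if "i < n" for i
    unfolding d_def using that by (intro Min_le) auto
  have "y \<in> U" if y: "y \<in> topspace (Euclidean_space n)" "\<And>i. i < n \<Longrightarrow> \<bar>y i - x i\<bar> < d" for y
  proof -
    have "y i \<in> W i" for i
    proof (cases "i < n")
      case True
      then show ?thesis using d e(2) y(2) by (meson less_le_trans)
    next
      case False
      then have "y i = 0" "x i = 0"
        using y(1) V(2) x by (auto simp: topspace_Euclidean_space)
      then show ?thesis
        using W(2) by (metis PiE_mem UNIV_I)
    qed
    then show ?thesis
      using V(2) W(3) y(1) by auto
  qed
  ultimately show ?thesis
    by blast
qed

lemma continuous_map_Euclidean_space_box: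
  assumes "openin (Euclidean_space n) U" and f: "continuous_map (subtopology (Euclidean_space n) U) euclideanreal f"
    and "x \<in> U" "\<epsilon> > 0"
  shows "\<exists>d>0. \<forall>y\<in>topspace (Euclidean_space n). (\<forall>i<n. \<bar>y i - x i\<bar> < d) \<longrightarrow> y \<in> U \<and> \<bar>f y - f x\<bar> < \<epsilon>"
proof -
  have "openin (Euclidean_space n) {y \<in> U. f y \<in> ball (f x) \<epsilon>}"
  proof -
    have "openin (subtopology (Euclidean_space n) U) {y \<in> topspace (Euclidean_space n) \<inter> U. f y \<in> ball (f x) \<epsilon>}"
      using openin_continuous_map_preimage[OF f, of "ball (f x) \<epsilon>"] by simp
    moreover have "topspace (Euclidean_space n) \<inter> U = U"
      using openin_subset[OF assms(1)] by blast
    ultimately show ?thesis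
      using assms(1) by (simp add: openin_open_subtopology)
  qed
  moreover have "x \<in> {y \<in> U. f y \<in> ball (f x) \<epsilon>}"
    using assms by auto
  ultimately show ?thesis
    by (drule_tac openin_Euclidean_space_box) (auto simp: dist_real_def abs_minus_commute)
qed

section \<open>Partial derivatives and linear approximation\<close>

lemma partial_deriv_has_derivative:
  assumes "C_k_on n U (Suc k) f" "x \<in> U" "i < n"
  shows "((\<lambda>t. f (x(i := t))) has_real_derivative partial_deriv i f x) (at (x i))"
  using assms unfolding partial_deriv_def by (simp add: DERIV_deriv_iff_real_differentiable)

lemma partial_deriv_eqI:
  "((\<lambda>t. f (x(i := t))) has_real_derivative D) (at (x i)) \<Longrightarrow> partial_deriv i f x = D"
  unfolding partial_deriv_def by (rule DERIV_imp_deriv)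

text \<open>The difference \<open>g y - g x\<close> is telescoped by changing one coordinate at a time, and the mean value
  theorem applies to each step.\<close>

lemma C1_linear_approximation:
  assumes U: "openin (Euclidean_space n) U" and g: "C_k_on n U (Suc 0) g"
    and x: "x \<in> U" and \<epsilon>: "\<epsilon> > 0"
  shows "\<exists>d>0. \<forall>y\<in>topspace (Euclidean_space n). (\<forall>i<n. \<bar>y i - x i\<bar> < d) \<longrightarrow>
    \<bar>g y - g x - (\<Sum>j<n. partial_deriv j g x * (y j - x j))\<bar> \<le> \<epsilon> * (\<Sum>j<n. \<bar>y j - x j\<bar>)"
proof -
  let ?E = "topspace (Euclidean_space n)"
  have xE: "x \<in> ?E"
    using U x openin_subset by blast
  have "\<forall>j<n. \<exists>d>0. \<forall>y\<in>?E. (\<forall>i<n. \<bar>y i - x i\<bar> < d) \<longrightarrow>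
      y \<in> U \<and> \<bar>partial_deriv j g y - partial_deriv j g x\<bar> < \<epsilon>"
    using continuous_map_Euclidean_space_box[OF U _ x \<epsilon>] g by simp
  then obtain e where e: "\<And>j. j < n \<Longrightarrow> e j > 0"
      "\<And>j y. j < n \<Longrightarrow> y \<in> ?E \<Longrightarrow> (\<forall>i<n. \<bar>y i - x i\<bar> < e j) \<Longrightarrow>
         y \<in> U \<and> \<bar>partial_deriv j g y - partial_deriv j g x\<bar> < \<epsilon>"
    by metis
  define d where "d = Min (insert 1 (e ` {..<n}))"
  have d0: "d > 0"
    unfolding d_def using e(1) by (subst Min_gr_iff) auto
  have dle: "d \<le> e i" if "i < n" for i
    unfolding d_def using that by (intro Min_le) auto
  have near: "y \<in> U \<and> \<bar>partial_deriv j g y - partial_deriv j g x\<bar> < \<epsilon>"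
    if "j < n" "y \<in> ?E" "\<forall>i<n. \<bar>y i - x i\<bar> < d" for j y
    using e(2)[OF that(1,2)] that(3) dle[OF that(1)] by fastforce
  \<comment> \<open>Induction on the number \<open>k\<close> of leading coordinates in which
    \<open>y\<close> may differ from \<open>x\<close>. For \<open>k = n\<close> this is no
    restriction, as both points vanish beyond.\<close>
  have "k \<le> n \<longrightarrow> (\<forall>y\<in>?E. (\<forall>i<n. \<bar>y i - x i\<bar> < d) \<longrightarrow> (\<forall>i\<ge>k. y i = x i) \<longrightarrow>
    \<bar>g y - g x - (\<Sum>j<k. partial_deriv j g x * (y j - x j))\<bar> \<le> \<epsilon> * (\<Sum>j<k. \<bar>y j - x j\<bar>))" for k
  proof (induction k)
    case 0
    have "y = x" if "\<forall>i\<ge>0. y i = x i" for y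
      using that by auto
    then show ?case
      by auto
  next
    case (Suc k)
    show ?case
    proof (intro impI ballI)
      fix y
      assume k: "Suc k \<le> n" and yE: "y \<in> ?E" and y: "\<forall>i<n. \<bar>y i - x i\<bar> < d" "\<forall>i\<ge>Suc k. y i = x i"
      define z where "z = y(k := x k)"
      have z: "z \<in> ?E" "\<forall>i<n. \<bar>z i - x i\<bar> < d" "\<forall>i\<ge>k. z i = x i"
        unfolding z_def using yE y k d0 by (auto simp: Euclidean_space_upd le_Suc_eq)
      have IH: "\<bar>g z - g x - (\<Sum>j<k. partial_deriv j g x * (z j - x j))\<bar> \<le> \<epsilon> * (\<Sum>j<k. \<bar>z j - x j\<bar>)"
        using Suc k z by simp
      let ?c = "partial_deriv k g x"
      let ?S = "closed_segment (x k) (y k)"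
      \<comment> \<open>The points with k-th coordinate between \<open>x k\<close> and
        \<open>y k\<close> stay in the cube where the partial derivatives vary by less than
        \<epsilon>.\<close>
      have near': "y(k := t) \<in> U \<and> \<bar>partial_deriv k g (y(k := t)) - ?c\<bar> < \<epsilon>" if "t \<in> ?S" for t
      proof (rule near)
        have "\<bar>t - x k\<bar> \<le> \<bar>y k - x k\<bar>"
          using that by (auto simp: closed_segment_eq_real_ivl split: if_splits)
        then have "\<bar>t - x k\<bar> < d"
          using y(1) k by (metis Suc_le_lessD le_less_trans)
        then show "\<forall>i<n. \<bar>(y(k := t)) i - x i\<bar> < d"
          using y(1) by auto
      qed (use k yE in \<open>auto simp: Euclidean_space_upd\<close>)
      \<comment> \<open>Subtracting the linear part \<open>?c * t\<close> makes the derivative along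
        the segment smaller than \<epsilon>, so the mean value bound gives the new summand of the
        estimate.\<close>
      have "norm ((g (y(k := y k)) - ?c * y k) - (g (y(k := x k)) - ?c * x k)) \<le> \<epsilon> * norm (y k - x k)"
      proof (rule field_differentiable_bound[of ?S "\<lambda>t. g (y(k := t)) - ?c * t" "\<lambda>t. partial_deriv k g (y(k := t)) - ?c"])
        fix t assume t: "t \<in> ?S"
        have "((\<lambda>t. g (y(k := t))) has_real_derivative partial_deriv k g (y(k := t))) (at t)"
          using partial_deriv_has_derivative[OF g, of "y(k := t)" k] near'[OF t] k by simp
        then have "((\<lambda>t. g (y(k := t)) - ?c * t) has_real_derivative partial_deriv k g (y(k := t)) - ?c) (at t)"
          by (auto intro!: derivative_eq_intros)
        then show "((\<lambda>t. g (y(k := t)) - ?c * t) has_real_derivative partial_deriv k g (y(k := t)) - ?c) (at t within ?S)"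
          by (rule DERIV_subset) simp
      qed (use near' in \<open>auto intro: less_imp_le\<close>)
      then have step: "\<bar>g y - g z - ?c * (y k - x k)\<bar> \<le> \<epsilon> * \<bar>y k - x k\<bar>"
        by (simp add: z_def algebra_simps)
      have "(\<Sum>j<k. partial_deriv j g x * (z j - x j)) = (\<Sum>j<k. partial_deriv j g x * (y j - x j))"
        "(\<Sum>j<k. \<bar>z j - x j\<bar>) = (\<Sum>j<k. \<bar>y j - x j\<bar>)"
        by (auto simp: z_def)
      with IH step show "\<bar>g y - g x - (\<Sum>j<Suc k. partial_deriv j g x * (y j - x j))\<bar>
          \<le> \<epsilon> * (\<Sum>j<Suc k. \<bar>y j - x j\<bar>)"
        unfolding sum.lessThan_Suc by (simp only: distrib_left)
    qed
  qed
  from this[of n] have "\<bar>g y - g x - (\<Sum>j<n. partial_deriv j g x * (y j - x j))\<bar> \<le> \<epsilon> * (\<Sum>j<n. \<bar>y j - x j\<bar>)"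
    if "y \<in> ?E" "\<forall>i<n. \<bar>y i - x i\<bar> < d" for y
    using that xE by (simp add: topspace_Euclidean_space)
  with d0 show ?thesis
    by blast
qed

text \<open>The remainder of the linear approximation is at most \<epsilon> times the distance, and
  the distance divided by \<open>t - t0\<close> stays bounded because the difference quotients of
  the curve converge. So the remainder disappears in the limit.\<close>

lemma has_derivative_along_curve:
  assumes U: "openin (Euclidean_space n) U" and g: "C_k_on n U (Suc 0) g" and x: "\<gamma> t0 \<in> U"
    and \<gamma>E: "\<And>t. \<gamma> t \<in> topspace (Euclidean_space n)"
    and \<gamma>: "\<And>j. j < n \<Longrightarrow> ((\<lambda>t. \<gamma> t j) has_real_derivative \<gamma>' j) (at t0)"
  shows "((\<lambda>t. g (\<gamma> t)) has_real_derivative (\<Sum>j<n. partial_deriv j g (\<gamma> t0) * \<gamma>' j)) (at t0)"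
proof -
  let ?r = "\<lambda>t. g (\<gamma> t) - g (\<gamma> t0) - (\<Sum>j<n. partial_deriv j g (\<gamma> t0) * (\<gamma> t j - \<gamma> t0 j))"
  let ?q = "\<lambda>t j. (\<gamma> t j - \<gamma> t0 j) / (t - t0)"
  have q: "((\<lambda>t. ?q t j) \<longlongrightarrow> \<gamma>' j) (at t0)" if "j < n" for j
    using \<gamma>[OF that] by (simp add: has_field_derivative_iff)
  \<comment> \<open>A bound for the sum of the absolute difference quotients near \<open>t0\<close>:
    it exceeds their limit by 1, which also makes it positive when the velocity is zero.\<close>
  let ?K = "(\<Sum>j<n. \<bar>\<gamma>' j\<bar>) + 1"
  have K: "?K > 0"
    by (simp add: add_nonneg_pos sum_nonneg)
  have "((\<lambda>t. \<Sum>j<n. \<bar>?q t j\<bar>) \<longlongrightarrow> (\<Sum>j<n. \<bar>\<gamma>' j\<bar>)) (at t0)"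
    by (intro tendsto_intros q) auto
  then have evK: "\<forall>\<^sub>F t in at t0. (\<Sum>j<n. \<bar>?q t j\<bar>) < ?K"
    by (rule order_tendstoD) simp
  have "((\<lambda>t. ?r t / (t - t0)) \<longlongrightarrow> 0) (at t0)"
  proof (rule tendstoI)
    fix e :: real assume "e > 0"
    define \<epsilon> where "\<epsilon> = e / ?K"
    have \<epsilon>: "\<epsilon> > 0" using \<open>e > 0\<close> K by (simp add: \<epsilon>_def)
    from C1_linear_approximation[OF U g x \<epsilon>] obtain d where d: "d > 0"
      "\<And>y. y \<in> topspace (Euclidean_space n) \<Longrightarrow> (\<forall>i<n. \<bar>y i - \<gamma> t0 i\<bar> < d) \<Longrightarrow>
         \<bar>g y - g (\<gamma> t0) - (\<Sum>j<n. partial_deriv j g (\<gamma> t0) * (y j - \<gamma> t0 j))\<bar> \<le> \<epsilon> * (\<Sum>j<n. \<bar>y j - \<gamma> t0 j\<bar>)"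
      by blast
    have "\<forall>\<^sub>F t in at t0. \<forall>i\<in>{..<n}. \<bar>\<gamma> t i - \<gamma> t0 i\<bar> < d"
    proof (rule eventually_ball_finite)
      show "\<forall>i\<in>{..<n}. \<forall>\<^sub>F t in at t0. \<bar>\<gamma> t i - \<gamma> t0 i\<bar> < d"
      proof
        fix i assume "i \<in> {..<n}"
        then have "isCont (\<lambda>t. \<gamma> t i) t0"
          using \<gamma> DERIV_isCont by blast
        then have "((\<lambda>t. \<gamma> t i) \<longlongrightarrow> \<gamma> t0 i) (at t0)"
          by (simp add: isCont_def)
        then show "\<forall>\<^sub>F t in at t0. \<bar>\<gamma> t i - \<gamma> t0 i\<bar> < d"
          using d(1) by (auto dest: tendstoD simp: dist_real_def)
      qed
    qed simp
    moreover have "\<forall>\<^sub>F t in at t0. t \<noteq> t0"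
      by (simp add: eventually_at_filter)
    ultimately show "\<forall>\<^sub>F t in at t0. dist (?r t / (t - t0)) 0 < e"
      using evK
    proof eventually_elim
      case (elim t)
      have "\<bar>?r t\<bar> \<le> \<epsilon> * (\<Sum>j<n. \<bar>\<gamma> t j - \<gamma> t0 j\<bar>)"
        using d(2)[OF \<gamma>E] elim(1) by simp
      then have "\<bar>?r t\<bar> / \<bar>t - t0\<bar> \<le> \<epsilon> * (\<Sum>j<n. \<bar>\<gamma> t j - \<gamma> t0 j\<bar>) / \<bar>t - t0\<bar>"
        by (rule divide_right_mono) simp
      also have "\<dots> = \<epsilon> * (\<Sum>j<n. \<bar>?q t j\<bar>)"
        by (simp add: sum_divide_distrib[symmetric] abs_divide)
      also have "\<dots> < \<epsilon> * ?K"
        using elim(3) \<epsilon> by (rule mult_strict_left_mono)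
      also have "\<dots> = e"
        using K by (simp add: \<epsilon>_def)
      finally show ?case
        by (simp add: dist_real_def abs_divide)
    qed
  qed
  then have "((\<lambda>t. ?r t / (t - t0) + (\<Sum>j<n. partial_deriv j g (\<gamma> t0) * ?q t j))
      \<longlongrightarrow> 0 + (\<Sum>j<n. partial_deriv j g (\<gamma> t0) * \<gamma>' j)) (at t0)"
    by (intro tendsto_intros q) auto
  moreover have "?r t / (t - t0) + (\<Sum>j<n. partial_deriv j g (\<gamma> t0) * ?q t j)
      = (g (\<gamma> t) - g (\<gamma> t0)) / (t - t0)" for t
    by (simp add: diff_divide_distrib sum_divide_distrib right_diff_distrib)
  ultimately show ?thesis
    by (simp add: has_field_derivative_iff)
qed

section \<open>Arithmetic of functions of class C^k\<close>

lemma C_k_on_imp_continuous: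
  "C_k_on n U k f \<Longrightarrow> continuous_map (subtopology (Euclidean_space n) U) euclideanreal f"
  by (cases k) auto

lemma C_k_on_Suc_imp: "C_k_on n U (Suc k) f \<Longrightarrow> C_k_on n U k f"
  by (induction k arbitrary: f) auto

text \<open>A partial derivative only sees values on a short coordinate segment, and such segments
  stay in the open set \<open>U\<close>. This is what allows formulas for partial derivatives that
  hold on \<open>U\<close> only.\<close>

lemma C_k_on_cong:
  assumes U: "openin (Euclidean_space n) U" and "\<And>y. y \<in> U \<Longrightarrow> f y = g y" "C_k_on n U k f"
  shows "C_k_on n U k g"
  using assms(2,3)
proof (induction k arbitrary: f g)
  case 0
  then show ?case
    by (auto elim!: continuous_map_eq)
next
  case (Suc k)
  have ev: "\<forall>\<^sub>F t in nhds (x i). f (x(i := t)) = g (x(i := t))" if "i < n" "x \<in> U" for i x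
  proof -
    obtain e where e: "e > 0" "\<And>y. y\<in>topspace (Euclidean_space n) \<Longrightarrow> (\<forall>i<n. \<bar>y i - x i\<bar> < e) \<Longrightarrow> y \<in> U"
      using openin_Euclidean_space_box[OF U \<open>x \<in> U\<close>] by blast
    have "x \<in> topspace (Euclidean_space n)"
      using U openin_subset \<open>x \<in> U\<close> by blast
    then have "f (x(i := t)) = g (x(i := t))" if "dist t (x i) < e" for t
    proof (intro Suc.prems(1) e(2))
      show "x(i := t) \<in> topspace (Euclidean_space n)"
        by (rule Euclidean_space_upd) fact+
    qed (use that e(1) in \<open>auto simp: dist_real_def\<close>)
    then show ?thesis
      using e(1) unfolding eventually_nhds_metric by blast
  qed
  have pd: "partial_deriv i f x = partial_deriv i g x" if "i < n" "x \<in> U" for i x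
    unfolding partial_deriv_def using ev[OF that] by (rule deriv_cong_ev) simp
  have "(\<lambda>t. g (x(i := t))) differentiable (at (x i))" if "i < n" "x \<in> U" for i x
  proof -
    have "((\<lambda>t. f (x(i := t))) has_real_derivative partial_deriv i f x) (at (x i))"
      using partial_deriv_has_derivative[OF Suc.prems(2) that(2,1)] .
    then have "((\<lambda>t. g (x(i := t))) has_real_derivative partial_deriv i f x) (at (x i))"
      using DERIV_cong_ev[OF HOL.refl ev[OF that] HOL.refl] by blast
    then show ?thesis
      by (auto simp: real_differentiable_def)
  qed
  moreover have "continuous_map (subtopology (Euclidean_space n) U) euclideanreal g"
    using Suc.prems C_k_on_imp_continuous by (metis Int_iff continuous_map_eq topspace_subtopology)
  moreover have "C_k_on n U k (partial_deriv i g)" if "i < n" for i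
    using Suc.IH[of "partial_deriv i f" "partial_deriv i g"] pd that Suc.prems(2) by simp
  ultimately show ?case
    by simp
qed

lemma C_k_on_subset: "C_k_on n U k f \<Longrightarrow> V \<subseteq> U \<Longrightarrow> C_k_on n V k f"
  by (induction k arbitrary: f) (auto simp: subset_iff elim: continuous_map_from_subtopology_mono)

lemma C_k_on_const: "C_k_on n U k (\<lambda>_. c)"
proof (induction k arbitrary: c)
  case (Suc k)
  have "partial_deriv i (\<lambda>_. c) = (\<lambda>_. 0)" for i
    by (auto simp: partial_deriv_def)
  with Suc show ?case
    by simp
qed simp

text \<open>The partial derivatives may be given by any formula valid on \<open>U\<close>. Outside
  of \<open>U\<close> it need not agree with \<open>partial_deriv i f\<close>, which is a total
  function.\<close>

lemma C_k_on_SucI: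
  assumes U: "openin (Euclidean_space n) U"
    and "continuous_map (subtopology (Euclidean_space n) U) euclideanreal f"
    and f': "\<And>i x. i < n \<Longrightarrow> x \<in> U \<Longrightarrow> ((\<lambda>t. f (x(i := t))) has_real_derivative f' i x) (at (x i))"
    and "\<And>i. i < n \<Longrightarrow> C_k_on n U k (f' i)"
  shows "C_k_on n U (Suc k) f"
proof -
  have "f' i x = partial_deriv i f x" if "i < n" "x \<in> U" for i x
    using partial_deriv_eqI[OF f'[OF that]] by simp
  then have "C_k_on n U k (partial_deriv i f)" if "i < n" for i
    using C_k_on_cong[OF U _ assms(4)[OF that]] that by blast
  with assms show ?thesis
    by (auto simp: real_differentiable_def)
qed

lemma C_k_on_add:
  assumes U: "openin (Euclidean_space n) U" and "C_k_on n U k f" "C_k_on n U k g"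
  shows "C_k_on n U k (\<lambda>x. f x + g x)"
  using assms(2,3)
proof (induction k arbitrary: f g)
  case 0
  then show ?case
    by (auto intro: continuous_map_add)
next
  case (Suc k)
  show ?case
  proof (rule C_k_on_SucI[OF U, where f' = "\<lambda>i x. partial_deriv i f x + partial_deriv i g x"])
    show "((\<lambda>t. f (x(i := t)) + g (x(i := t))) has_real_derivative partial_deriv i f x + partial_deriv i g x) (at (x i))"
      if "i < n" "x \<in> U" for i x
      using Suc.prems that by (intro DERIV_add partial_deriv_has_derivative)
  qed (use Suc in \<open>auto intro: continuous_map_add\<close>)
qed

lemma C_k_on_mult:
  assumes U: "openin (Euclidean_space n) U" and "C_k_on n U k f" "C_k_on n U k g"
  shows "C_k_on n U k (\<lambda>x. f x * g x)"
  using assms(2,3)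
proof (induction k arbitrary: f g)
  case 0
  then show ?case
    by (auto intro: continuous_map_real_mult)
next
  case (Suc k)
  show ?case
  proof (rule C_k_on_SucI[OF U, where f' = "\<lambda>i x. partial_deriv i f x * g x + partial_deriv i g x * f x"])
    show "((\<lambda>t. f (x(i := t)) * g (x(i := t))) has_real_derivative
        partial_deriv i f x * g x + partial_deriv i g x * f x) (at (x i))"
      if "i < n" "x \<in> U" for i x
      using DERIV_mult[OF partial_deriv_has_derivative[OF Suc.prems(1) that(2,1)]
          partial_deriv_has_derivative[OF Suc.prems(2) that(2,1)]] by (simp only: fun_upd_triv)
    show "C_k_on n U k (\<lambda>x. partial_deriv i f x * g x + partial_deriv i g x * f x)" if "i < n" for i
      using Suc.prems that by (intro C_k_on_add[OF U] Suc.IH) (auto intro: C_k_on_Suc_imp)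
  qed (use Suc in \<open>auto intro: continuous_map_real_mult\<close>)
qed

lemma C_k_on_sum:
  assumes U: "openin (Euclidean_space n) U" and "finite J" "\<And>j. j \<in> J \<Longrightarrow> C_k_on n U k (f j)"
  shows "C_k_on n U k (\<lambda>x. \<Sum>j\<in>J. f j x)"
  using assms(2,3) by (induction J rule: finite_induct) (auto intro: C_k_on_const C_k_on_add[OF U])

text \<open>A smooth extension is only constrained in its first \<open>n\<close> coordinates, so it has to be
  truncated before another one can be applied to its values.\<close>

definition trunc :: "nat \<Rightarrow> (nat \<Rightarrow> real) \<Rightarrow> nat \<Rightarrow> real" where
  "trunc n x = (\<lambda>j. if j < n then x j else 0)"

lemma trunc_in_Euclidean_space [simp]: "trunc n x \<in> topspace (Euclidean_space n)"
  by (simp add: trunc_def topspace_Euclidean_space)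

lemma trunc_eqI: "y \<in> topspace (Euclidean_space n) \<Longrightarrow> (\<And>j. j < n \<Longrightarrow> x j = y j) \<Longrightarrow> trunc n x = y"
  by (auto simp: trunc_def topspace_Euclidean_space fun_eq_iff)

lemma continuous_map_trunc:
  assumes "\<And>j. j < n \<Longrightarrow> continuous_map T euclideanreal (\<lambda>y. F y j)"
  shows "continuous_map T (Euclidean_space n) (\<lambda>y. trunc n (F y))"
  using assms unfolding trunc_def by (simp add: continuous_map_componentwise_Euclidean_space)

section \<open>The chain rule and Jacobians\<close>

text \<open>The truncated image of a coordinate line is a curve in \<open>Euclidean_space n\<close>
  whose velocity consists of the i-th partial derivatives of the components of
  \<open>F\<close>.\<close>

lemma chain_rule:
  assumes V: "openin (Euclidean_space n) V" and g: "C_k_on n V (Suc 0) g"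
    and F: "\<And>j. j < n \<Longrightarrow> C_k_on n U (Suc 0) (\<lambda>y. F y j)"
    and x: "x \<in> U" "trunc n (F x) \<in> V" and i: "i < n"
  shows "((\<lambda>t. g (trunc n (F (x(i := t))))) has_real_derivative
     (\<Sum>j<n. partial_deriv j g (trunc n (F x)) * partial_deriv i (\<lambda>y. F y j) x)) (at (x i))"
proof -
  have "((\<lambda>t. trunc n (F (x(i := t))) j) has_real_derivative partial_deriv i (\<lambda>y. F y j) x) (at (x i))"
    if "j < n" for j
    using partial_deriv_has_derivative[OF F[OF that] x(1) i] that by (simp add: trunc_def)
  then show ?thesis
    using has_derivative_along_curve[OF V g, of "\<lambda>t. trunc n (F (x(i := t)))" "x i"] x by simp
qed

text \<open>By the chain rule a partial derivative of the composite is a sum of products, each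
  containing some \<open>partial_deriv j g\<close> composed with \<open>F\<close>. This is a
  composite of one order less, so \<open>g\<close> is arbitrary in the induction on
  \<open>k\<close>.\<close>

lemma C_k_on_compose:
  assumes U: "openin (Euclidean_space n) U" and V: "openin (Euclidean_space n) V"
    and F: "\<And>j. j < n \<Longrightarrow> C_k_on n U k (\<lambda>y. F y j)" and g: "C_k_on n V k g"
    and UV: "\<And>y. y \<in> U \<Longrightarrow> trunc n (F y) \<in> V"
  shows "C_k_on n U k (\<lambda>y. g (trunc n (F y)))"
  using F g
proof (induction k arbitrary: g)
  case 0
  have "continuous_map (subtopology (Euclidean_space n) U) (subtopology (Euclidean_space n) V) (\<lambda>y. trunc n (F y))"
    using 0 UV by (auto simp: continuous_map_in_subtopology intro!: continuous_map_trunc)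
  from continuous_map_compose[OF this] 0 show ?case
    by (simp add: o_def)
next
  case (Suc k)
  have F': "C_k_on n U (Suc 0) (\<lambda>y. F y j)" if "j < n" for j
    using Suc.prems(1)[OF that] by (auto intro: C_k_on_imp_continuous)
  have g': "C_k_on n V (Suc 0) g"
    using Suc.prems(2) by (auto intro: C_k_on_imp_continuous)
  show ?case
  proof (rule C_k_on_SucI[OF U])
    have "continuous_map (subtopology (Euclidean_space n) U) (subtopology (Euclidean_space n) V) (\<lambda>y. trunc n (F y))"
      using Suc.prems UV by (auto simp: continuous_map_in_subtopology intro!: continuous_map_trunc)
    from continuous_map_compose[OF this C_k_on_imp_continuous[OF g']]
    show "continuous_map (subtopology (Euclidean_space n) U) euclideanreal (\<lambda>y. g (trunc n (F y)))"
      by (simp add: o_def)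
    show "((\<lambda>t. g (trunc n (F (x(i := t))))) has_real_derivative
       (\<Sum>j<n. partial_deriv j g (trunc n (F x)) * partial_deriv i (\<lambda>y. F y j) x)) (at (x i))"
      if "i < n" "x \<in> U" for i x
      by (rule chain_rule[OF V g' F']) (use that UV in auto)
    show "C_k_on n U k (\<lambda>x. \<Sum>j<n. partial_deriv j g (trunc n (F x)) * partial_deriv i (\<lambda>y. F y j) x)"
      if "i < n" for i
    proof (intro C_k_on_sum[OF U] C_k_on_mult[OF U])
      fix j assume "j \<in> {..<n}"
      then show "C_k_on n U k (\<lambda>x. partial_deriv j g (trunc n (F x)))"
        using Suc.prems by (intro Suc.IH) (auto intro: C_k_on_Suc_imp)
      show "C_k_on n U k (\<lambda>x. partial_deriv i (\<lambda>y. F y j) x)"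
        using Suc.prems(1)[of j] \<open>j \<in> {..<n}\<close> that by simp
    qed simp
  qed
qed

lemma smooth_on_compose:
  assumes "openin (Euclidean_space n) U" "openin (Euclidean_space n) V"
    "\<And>j. j < n \<Longrightarrow> smooth_on n U (\<lambda>y. F y j)" "smooth_on n V g" "\<And>y. y \<in> U \<Longrightarrow> trunc n (F y) \<in> V"
  shows "smooth_on n U (\<lambda>y. g (trunc n (F y)))"
  using assms unfolding smooth_on_def by (auto intro: C_k_on_compose)

lemma smooth_on_subset: "smooth_on n U f \<Longrightarrow> V \<subseteq> U \<Longrightarrow> smooth_on n V f"
  unfolding smooth_on_def by (auto intro: C_k_on_subset)

text \<open>The chain rule says that Jacobian matrices multiply, and determinants are
  multiplicative.\<close>

lemma jacobian_compose:
  assumes V: "openin (Euclidean_space n) V" and G: "\<And>j. j < n \<Longrightarrow> smooth_on n V (\<lambda>y. G y j)"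
    and F: "\<And>j. j < n \<Longrightarrow> smooth_on n U (\<lambda>y. F y j)"
    and x: "x \<in> U" "trunc n (F x) \<in> V"
  shows "jacobian n (\<lambda>y. G (trunc n (F y))) x = jacobian n G (trunc n (F x)) * jacobian n F x"
proof -
  let ?A = "Matrix.mat n n (\<lambda>(i, j). partial_deriv j (\<lambda>y. G y i) (trunc n (F x)))"
  let ?B = "Matrix.mat n n (\<lambda>(i, j). partial_deriv j (\<lambda>y. F y i) x)"
  have F1: "C_k_on n U (Suc 0) (\<lambda>y. F y j)" if "j < n" for j
    using F[OF that] unfolding smooth_on_def by blast
  have G1: "C_k_on n V (Suc 0) (\<lambda>y. G y j)" if "j < n" for j
    using G[OF that] unfolding smooth_on_def by blast
  have "partial_deriv k (\<lambda>y. G (trunc n (F y)) i) x =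
      (\<Sum>j<n. partial_deriv j (\<lambda>y. G y i) (trunc n (F x)) * partial_deriv k (\<lambda>y. F y j) x)"
    if "i < n" "k < n" for i k
    by (rule partial_deriv_eqI, rule chain_rule[OF V G1 F1 x]) (use that in auto)
  then have "Matrix.mat n n (\<lambda>(i, j). partial_deriv j (\<lambda>y. G (trunc n (F y)) i) x) = ?A * ?B"
    by (intro eq_matI) (auto simp: scalar_prod_def atLeast0LessThan)
  moreover have "Determinant.det (?A * ?B) = Determinant.det ?A * Determinant.det ?B"
    by (rule Determinant.det_mult[of _ n]) auto
  ultimately show ?thesis
    by (simp add: jacobian_def)
qed

subsection \<open>Smooth maps with a Jacobian of given sign\<close>

lemma smooth_with_signI:
  assumes "\<And>x. x \<in> S \<Longrightarrow> \<exists>F U. sgn (jacobian n F x) = \<sigma> \<and> openin (Euclidean_space n) U \<and> x \<in> U \<and>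
    (\<forall>j<n. smooth_on n U (\<lambda>y. F y j)) \<and> (\<forall>y\<in>S \<inter> U. \<forall>j<n. F y j = f y j)"
  shows "smooth_with_sign n S f \<sigma>"
  unfolding smooth_with_sign_def smooth_extension_def
proof
  fix x assume "x \<in> S"
  from assms[OF this] show "\<exists>F. (\<exists>U. openin (Euclidean_space n) U \<and> x \<in> U \<and> (\<forall>j<n. smooth_on n U (\<lambda>y. F y j)) \<and>
      (\<forall>y\<in>S \<inter> U. \<forall>j<n. F y j = f y j)) \<and> sgn (jacobian n F x) = \<sigma>"
    by blast
qed

lemma smooth_with_signE:
  assumes "smooth_with_sign n S f \<sigma>" "x \<in> S"
  obtains F U where "sgn (jacobian n F x) = \<sigma>" "openin (Euclidean_space n) U" "x \<in> U"
    "\<And>j. j < n \<Longrightarrow> smooth_on n U (\<lambda>y. F y j)"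
    "\<And>y j. y \<in> S \<Longrightarrow> y \<in> U \<Longrightarrow> j < n \<Longrightarrow> F y j = f y j"
proof -
  obtain F where F: "smooth_extension n S f x F" "sgn (jacobian n F x) = \<sigma>"
    using assms unfolding smooth_with_sign_def by blast
  then obtain U where "openin (Euclidean_space n) U" "x \<in> U" "\<forall>j<n. smooth_on n U (\<lambda>y. F y j)"
      "\<forall>y\<in>S \<inter> U. \<forall>j<n. F y j = f y j"
    unfolding smooth_extension_def by blast
  with F(2) show ?thesis
    by (intro that[of F U]) auto
qed

text \<open>The comparison function \<open>g\<close> and its domain \<open>T\<close> may change from
  point to point. For maps between manifolds this means that a different intermediate chart may be
  used near each point.\<close>

lemma smooth_with_sign_local_cong:
  assumes "\<And>x. x \<in> S \<Longrightarrow> \<exists>U T g. openin (Euclidean_space n) U \<and> x \<in> U \<and> S \<inter> U \<subseteq> T \<and>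
    smooth_with_sign n T g \<sigma> \<and> (\<forall>y\<in>S \<inter> U. \<forall>j<n. g y j = f y j)"
  shows "smooth_with_sign n S f \<sigma>"
proof (rule smooth_with_signI)
  fix x assume x: "x \<in> S"
  from assms[OF x] obtain U T g where U: "openin (Euclidean_space n) U" "x \<in> U" "S \<inter> U \<subseteq> T"
    "smooth_with_sign n T g \<sigma>" "\<forall>y\<in>S \<inter> U. \<forall>j<n. g y j = f y j"
    by blast
  have "x \<in> T"
    using U x by blast
  obtain F V where F: "sgn (jacobian n F x) = \<sigma>" "openin (Euclidean_space n) V" "x \<in> V"
      "\<And>j. j < n \<Longrightarrow> smooth_on n V (\<lambda>y. F y j)"
      "\<And>y j. y \<in> T \<Longrightarrow> y \<in> V \<Longrightarrow> j < n \<Longrightarrow> F y j = g y j"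
    using smooth_with_signE[OF U(4) \<open>x \<in> T\<close>] by blast
  show "\<exists>F U. sgn (jacobian n F x) = \<sigma> \<and> openin (Euclidean_space n) U \<and> x \<in> U \<and>
    (\<forall>j<n. smooth_on n U (\<lambda>y. F y j)) \<and> (\<forall>y\<in>S \<inter> U. \<forall>j<n. F y j = f y j)"
  proof (intro exI conjI allI impI ballI)
    show "smooth_on n (U \<inter> V) (\<lambda>y. F y j)" if "j < n" for j
      using F(4)[OF that] by (rule smooth_on_subset) simp
    show "F y j = f y j" if "y \<in> S \<inter> (U \<inter> V)" "j < n" for y j
      using F(5)[of y j] U(3,5) that by auto
  qed (use U F in auto)
qed

lemma smooth_with_sign_cong:
  assumes "smooth_with_sign n S f \<sigma>" "T \<subseteq> S" "\<And>x j. x \<in> T \<Longrightarrow> j < n \<Longrightarrow> f x j = g x j"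
    "T \<subseteq> topspace (Euclidean_space n)"
  shows "smooth_with_sign n T g \<sigma>"
proof (rule smooth_with_sign_local_cong)
  fix x assume "x \<in> T"
  then show "\<exists>U S g'. openin (Euclidean_space n) U \<and> x \<in> U \<and> T \<inter> U \<subseteq> S \<and>
    smooth_with_sign n S g' \<sigma> \<and> (\<forall>y\<in>T \<inter> U. \<forall>j<n. g' y j = g y j)"
    by (intro exI[of _ "topspace (Euclidean_space n)"] exI[of _ S] exI[of _ f]) (use assms in auto)
qed

text \<open>Composing two extensions gives an extension of the composite. Its Jacobian is the
  product of theirs, so the signs multiply.\<close>

lemma smooth_with_sign_compose:
  assumes f: "smooth_with_sign n S f \<sigma>" and g: "smooth_with_sign n T g \<tau>"
    and fT: "f ` S \<subseteq> T" and T: "T \<subseteq> topspace (Euclidean_space n)"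
  shows "smooth_with_sign n S (\<lambda>x. g (f x)) (\<sigma> * \<tau>)"
proof (rule smooth_with_signI)
  fix x assume x: "x \<in> S"
  obtain F U where F: "sgn (jacobian n F x) = \<sigma>" "openin (Euclidean_space n) U" "x \<in> U"
      "\<And>j. j < n \<Longrightarrow> smooth_on n U (\<lambda>y. F y j)" "\<And>y j. y \<in> S \<Longrightarrow> y \<in> U \<Longrightarrow> j < n \<Longrightarrow> F y j = f y j"
    using smooth_with_signE[OF f x] by blast
  have "f x \<in> T"
    using fT x by auto
  then obtain G V where G: "sgn (jacobian n G (f x)) = \<tau>" "openin (Euclidean_space n) V" "f x \<in> V"
      "\<And>j. j < n \<Longrightarrow> smooth_on n V (\<lambda>y. G y j)" "\<And>y j. y \<in> T \<Longrightarrow> y \<in> V \<Longrightarrow> j < n \<Longrightarrow> G y j = g y j"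
    using smooth_with_signE[OF g] by blast
  \<comment> \<open>On \<open>S\<close> the extension agrees with \<open>f\<close> in the first
    \<open>n\<close> coordinates, and the remaining coordinates of \<open>f\<close> vanish, so
    truncation recovers \<open>f\<close> exactly.\<close>
  have tr: "trunc n (F y) = f y" if "y \<in> S" "y \<in> U" for y
    using that F(5) fT T by (intro trunc_eqI) auto
  \<comment> \<open>The extension \<open>F\<close> may leave the domain of \<open>G\<close>;
    \<open>W\<close> is the open part of \<open>U\<close> on which the composite makes
    sense.\<close>
  define W where "W = {y \<in> U. trunc n (F y) \<in> V}"
  have "continuous_map (subtopology (Euclidean_space n) U) (Euclidean_space n) (\<lambda>y. trunc n (F y))"
    using F(4) by (intro continuous_map_trunc) (auto simp: smooth_on_def intro: C_k_on_imp_continuous)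
  from openin_continuous_map_preimage[OF this G(2)]
  have "openin (subtopology (Euclidean_space n) U) W"
    using openin_subset[OF F(2)] by (simp add: W_def Int_absorb1)
  then have W: "openin (Euclidean_space n) W"
    using F(2) openin_open_subtopology by blast
  have Fx: "trunc n (F x) = f x"
    using tr x F(3) by blast
  have "x \<in> W"
    using F(3) G(3) Fx by (simp add: W_def)
  moreover have "smooth_on n W (\<lambda>y. G (trunc n (F y)) j)" if "j < n" for j
  proof (rule smooth_on_compose[OF W G(2) _ G(4)[OF that]])
    show "smooth_on n W (\<lambda>y. F y j)" if "j < n" for j
      using F(4)[OF that] by (rule smooth_on_subset) (auto simp: W_def)
  qed (auto simp: W_def)
  moreover have "G (trunc n (F y)) j = g (f y) j" if "y \<in> S" "y \<in> W" "j < n" for y j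
    using that tr G(5) fT by (auto simp: W_def image_subset_iff)
  moreover have "jacobian n (\<lambda>y. G (trunc n (F y))) x = jacobian n G (f x) * jacobian n F x"
    using jacobian_compose[of n V G U F x, OF G(2,4) F(4,3)] G(3) Fx by simp
  then have "sgn (jacobian n (\<lambda>y. G (trunc n (F y))) x) = \<sigma> * \<tau>"
    using F(1) G(1) by (simp add: sgn_mult)
  ultimately show "\<exists>H U. sgn (jacobian n H x) = \<sigma> * \<tau> \<and> openin (Euclidean_space n) U \<and> x \<in> U \<and>
      (\<forall>j<n. smooth_on n U (\<lambda>y. H y j)) \<and> (\<forall>y\<in>S \<inter> U. \<forall>j<n. H y j = g (f y) j)"
    using W by (intro exI[of _ "\<lambda>y. G (trunc n (F y))"] exI[of _ W]) auto
qed

section \<open>Disjoint unions of topological spaces\<close>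

text \<open>Selecting by the tag lets a statement about both summands of a disjoint union be
  formulated and proved once, for an arbitrary tag \<open>b\<close>.\<close>

definition side :: "bool \<Rightarrow> 'a \<Rightarrow> 'a \<Rightarrow> 'a" where
  "side b x y = (if b then y else x)"

lemma side_simps [simp]: "side False x y = x" "side True x y = y"
  by (simp_all add: side_def)

lemma side_cases: "P x \<Longrightarrow> P y \<Longrightarrow> P (side b x y)"
  by (simp add: side_def)

definition un_tag :: "'u pt \<Rightarrow> 'u pt" where
  "un_tag w = snd (untag w)"

lemma un_tag_Tag [simp]: "un_tag (Tag b p) = p"
  by (simp add: un_tag_def)

lemma Tag_in_sum_set [simp]: "Tag b p \<in> sum_set A B \<longleftrightarrow> p \<in> side b A B"
  by (cases b) (auto simp: sum_set_def)

lemma sum_setE: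
  assumes "w \<in> sum_set A B"
  obtains b p where "w = Tag b p" "p \<in> side b A B"
  using assms by (force simp: sum_set_def)

lemma case_tag_Tag [simp]: "case_tag f g (Tag b p) = side b f g p"
  by (simp add: side_def)

lemma topspace_side: "topspace (side b S T) = side b (topspace S) (topspace T)"
  by (cases b) auto

text \<open>\<open>untag\<close> only trades the constructor \<open>Tag\<close> for pairs. The
  characterisation by the two preimages is that of a coproduct, and the later topological facts
  about disjoint unions are derived from it.\<close>

lemma openin_sum_space:
  "openin (sum_space S T) U \<longleftrightarrow>
     U \<subseteq> sum_set (topspace S) (topspace T) \<and> (\<forall>b. openin (side b S T) (Tag b -` U))"
proof
  assume "openin (sum_space S T) U"
  then obtain V where V: "openin (sum_topology (\<lambda>b. side b S T) UNIV) V"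
      "U = untag -` V \<inter> sum_set (topspace S) (topspace T)"
    by (auto simp: sum_space_def openin_pullback_topology side_def)
  have "(b, x) \<in> V \<Longrightarrow> x \<in> side b (topspace S) (topspace T)" for b x
    using openin_subset[OF V(1)] by (auto simp: topspace_side)
  then have "Tag b -` U = {x. (b, x) \<in> V}" for b
    by (auto simp: V(2))
  with V show "U \<subseteq> sum_set (topspace S) (topspace T) \<and> (\<forall>b. openin (side b S T) (Tag b -` U))"
    by (simp add: openin_sum_topology)
next
  assume U: "U \<subseteq> sum_set (topspace S) (topspace T) \<and> (\<forall>b. openin (side b S T) (Tag b -` U))"
  let ?V = "{(b, x). Tag b x \<in> U}"
  have "openin (sum_topology (\<lambda>b. side b S T) UNIV) ?V"
  proof -
    have "p \<in> topspace (side b S T)" if "Tag b p \<in> U" for b p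
      using U openin_subset[of "side b S T" "Tag b -` U"] that by auto
    then show ?thesis
      using U by (auto simp: openin_sum_topology vimage_def)
  qed
  moreover have "U = untag -` ?V \<inter> sum_set (topspace S) (topspace T)"
    using U by (auto elim!: sum_setE)
  ultimately show "openin (sum_space S T) U"
    unfolding sum_space_def openin_pullback_topology side_def by blast
qed

lemma topspace_sum_space [simp]: "topspace (sum_space S T) = sum_set (topspace S) (topspace T)"
proof
  show "topspace (sum_space S T) \<subseteq> sum_set (topspace S) (topspace T)"
    using openin_sum_space[of S T "topspace (sum_space S T)"] by simp
  have "Tag b -` sum_set (topspace S) (topspace T) = topspace (side b S T)" for b
    by (auto simp: topspace_side)
  then have "openin (sum_space S T) (sum_set (topspace S) (topspace T))"
    by (simp add: openin_sum_space)
  then show "sum_set (topspace S) (topspace T) \<subseteq> topspace (sum_space S T)"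
    by (rule openin_subset)
qed

lemma Tag_vimage_image [simp]: "Tag b -` Tag c ` A = (if b = c then A else {})"
  by auto

lemma openin_Tag_image: "openin (side b S T) U \<Longrightarrow> openin (sum_space S T) (Tag b ` U)"
  using openin_subset[of "side b S T" U] by (auto simp: openin_sum_space topspace_side)

lemma continuous_map_Tag: "continuous_map (side b S T) (sum_space S T) (Tag b)"
proof -
  have "{x \<in> topspace (side b S T). Tag b x \<in> U} = Tag b -` U" if "openin (sum_space S T) U" for U
    using that openin_subset[of "side b S T" "Tag b -` U"] by (auto simp: openin_sum_space)
  then show ?thesis
    by (auto simp: continuous_map_def topspace_side openin_sum_space)
qed

lemma continuous_map_from_sum_space:
  assumes "\<And>b. continuous_map (side b S T) Y (\<lambda>p. f (Tag b p))"
  shows "continuous_map (sum_space S T) Y f"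
  unfolding continuous_map_def
proof (intro conjI allI impI)
  show "f \<in> topspace (sum_space S T) \<rightarrow> topspace Y"
  proof
    fix w assume "w \<in> topspace (sum_space S T)"
    then obtain b p where "w = Tag b p" "p \<in> topspace (side b S T)"
      by (auto elim!: sum_setE simp: topspace_side)
    then show "f w \<in> topspace Y"
      using continuous_map_image_subset_topspace[OF assms[of b]] by auto
  qed
  fix U assume U: "openin Y U"
  have "Tag b -` {x \<in> topspace (sum_space S T). f x \<in> U} = {x \<in> topspace (side b S T). f (Tag b x) \<in> U}" for b
    by (auto simp: topspace_side)
  then show "openin (sum_space S T) {x \<in> topspace (sum_space S T). f x \<in> U}"
    using openin_continuous_map_preimage[OF assms U] by (auto simp: openin_sum_space)
qed

lemma embedding_map_Tag: "embedding_map (side b S T) (sum_space S T) (Tag b)"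
proof (rule injective_open_imp_embedding_map)
  show "open_map (side b S T) (sum_space S T) (Tag b)"
    by (simp add: open_map_def openin_Tag_image)
qed (auto simp: continuous_map_Tag inj_on_def)

lemma homeomorphic_map_Tag:
  assumes "U \<subseteq> topspace (side b S T)"
  shows "homeomorphic_map (subtopology (side b S T) U) (subtopology (sum_space S T) (Tag b ` U)) (Tag b)"
proof -
  have "homeomorphic_map (side b S T) (subtopology (sum_space S T) (Tag b ` topspace (side b S T))) (Tag b)"
    using embedding_map_Tag by (simp add: embedding_map_def)
  then have "homeomorphic_map (subtopology (side b S T) U)
      (subtopology (subtopology (sum_space S T) (Tag b ` topspace (side b S T))) (Tag b ` U)) (Tag b)"
    by (rule homeomorphic_map_subtopologies) (use assms in \<open>auto simp: topspace_side\<close>)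
  moreover have "Tag b ` topspace (side b S T) \<inter> Tag b ` U = Tag b ` U"
    using assms by auto
  ultimately show ?thesis
    by (simp add: subtopology_subtopology)
qed

lemma homeomorphic_map_un_tag:
  assumes "U \<subseteq> topspace (side b S T)"
  shows "homeomorphic_map (subtopology (sum_space S T) (Tag b ` U)) (subtopology (side b S T) U) un_tag"
proof -
  obtain g where g: "homeomorphic_maps (subtopology (side b S T) U) (subtopology (sum_space S T) (Tag b ` U)) (Tag b) g"
    using homeomorphic_map_Tag[OF assms] unfolding homeomorphic_map_maps by blast
  have "g w = un_tag w" if "w \<in> topspace (subtopology (sum_space S T) (Tag b ` U))" for w
    using g that assms unfolding homeomorphic_maps_map by (auto simp: topspace_side)
  moreover have "homeomorphic_map (subtopology (sum_space S T) (Tag b ` U)) (subtopology (side b S T) U) g"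
    using g by (simp add: homeomorphic_maps_map)
  ultimately show ?thesis
    by (rule homeomorphic_map_eq[rotated])
qed

lemma compact_space_sum_space:
  assumes "compact_space S" "compact_space T"
  shows "compact_space (sum_space S T)"
proof -
  have "compactin (sum_space S T) (Tag b ` topspace (side b S T))" for b
    using assms by (intro image_compactin[OF _ continuous_map_Tag]) (cases b, auto simp: compact_space_def)
  then have "compactin (sum_space S T) (Tag False ` topspace S \<union> Tag True ` topspace T)"
    using compactin_Un by (metis side_simps)
  then show ?thesis
    by (simp add: compact_space_def sum_set_def)
qed

lemma Hausdorff_space_sum_space:
  assumes "Hausdorff_space S" "Hausdorff_space T"
  shows "Hausdorff_space (sum_space S T)"
  unfolding Hausdorff_space_def
proof (intro allI impI)
  fix v w assume vw: "v \<in> topspace (sum_space S T) \<and> w \<in> topspace (sum_space S T) \<and> v \<noteq> w"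
  then obtain b p c q where v: "v = Tag b p" "p \<in> topspace (side b S T)" and w: "w = Tag c q" "q \<in> topspace (side c S T)"
    by (auto elim!: sum_setE simp: topspace_side)
  show "\<exists>U V. openin (sum_space S T) U \<and> openin (sum_space S T) V \<and> v \<in> U \<and> w \<in> V \<and> disjnt U V"
  proof (cases "b = c")
    case True
    have "Hausdorff_space (side b S T)"
      using assms by (rule side_cases)
    then obtain U V where "openin (side b S T) U" "openin (side b S T) V" "p \<in> U" "q \<in> V" "disjnt U V"
      using v w vw True unfolding Hausdorff_space_def by blast
    then show ?thesis
      using v w True by (intro exI[of _ "Tag b ` U"] exI[of _ "Tag b ` V"]) (auto simp: openin_Tag_image disjnt_def)
  next
    case False
    then show ?thesis
      using v w
      by (intro exI[of _ "Tag b ` topspace (side b S T)"] exI[of _ "Tag c ` topspace (side c S T)"])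
        (auto simp: openin_Tag_image disjnt_def)
  qed
qed

text \<open>A summand is open and closed, so a connected set that meets it lies in it and can be
  moved back by \<open>un_tag\<close>. This is what gives a unique base point in each component of a
  disjoint union.\<close>

lemma connected_component_of_sum_space:
  assumes p: "p \<in> topspace (side b S T)"
  shows "connected_component_of_set (sum_space S T) (Tag b p) = Tag b ` connected_component_of_set (side b S T) p"
proof
  show "Tag b ` connected_component_of_set (side b S T) p \<subseteq> connected_component_of_set (sum_space S T) (Tag b p)"
    using connectedin_continuous_map_image[OF continuous_map_Tag[of b S T]]
    by (force simp: connected_component_of_def)
  let ?A = "Tag b ` topspace (side b S T)"
  have A: "openin (sum_space S T) ?A" "closedin (sum_space S T) ?A"
  proof -
    show "openin (sum_space S T) ?A"
      by (simp add: openin_Tag_image)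
    have "topspace (sum_space S T) - ?A = Tag (\<not> b) ` topspace (side (\<not> b) S T)"
      by (cases b) (auto simp: sum_set_def)
    then show "closedin (sum_space S T) ?A"
      unfolding closedin_def
      using openin_subset[OF openin_Tag_image[of b S T "topspace (side b S T)"]]
        openin_Tag_image[of "\<not> b" S T "topspace (side (\<not> b) S T)"] by simp
  qed
  show "connected_component_of_set (sum_space S T) (Tag b p) \<subseteq> Tag b ` connected_component_of_set (side b S T) p"
  proof
    fix w assume "w \<in> connected_component_of_set (sum_space S T) (Tag b p)"
    then obtain C where C: "connectedin (sum_space S T) C" "Tag b p \<in> C" "w \<in> C"
      by (auto simp: connected_component_of_def)
    have CA: "C \<subseteq> ?A"
      using connectedin_clopen_cases[OF C(1) A(2,1)] C(2) p by (auto simp: disjnt_def)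
    then have "connectedin (subtopology (sum_space S T) ?A) C"
      using C(1) by (simp add: connectedin_subtopology)
    then have conn: "connectedin (side b S T) (un_tag ` C)"
      using connectedin_continuous_map_image homeomorphic_imp_continuous_map[OF homeomorphic_map_un_tag[OF subset_refl]]
      by (metis subtopology_topspace)
    have "p \<in> un_tag ` C" "un_tag w \<in> un_tag ` C" "w = Tag b (un_tag w)"
      using C CA by force+
    then have "un_tag w \<in> connected_component_of_set (side b S T) p"
      using conn unfolding connected_component_of_def by blast
    then show "w \<in> Tag b ` connected_component_of_set (side b S T) p"
      using \<open>w = Tag b (un_tag w)\<close> by (rule image_eqI[rotated])
  qed
qed

lemma connected_components_of_sum_space:
  assumes "C \<in> connected_components_of (sum_space S T)"
  obtains b C' where "C = Tag b ` C'" "C' \<in> connected_components_of (side b S T)"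
proof -
  obtain w where w: "w \<in> topspace (sum_space S T)" "C = connected_component_of_set (sum_space S T) w"
    using assms by (auto simp: connected_components_of_def)
  then obtain b p where p: "w = Tag b p" "p \<in> topspace (side b S T)"
    by (auto elim!: sum_setE simp: topspace_side)
  then show ?thesis
    using w that[of b "connected_component_of_set (side b S T) p"]
    by (auto simp: connected_component_of_sum_space connected_components_of_def)
qed

text \<open>Products distribute over disjoint unions: an open box in \<open>A\<close> times a
  summand is carried by \<open>Tag b\<close> to an open box. With the unit interval as
  \<open>A\<close> this joins two homotopies into one.\<close>

lemma continuous_map_prod_sum_space:
  assumes "\<And>b. continuous_map (prod_topology A (side b S T)) Y (\<lambda>(t, p). h (t, Tag b p))"
  shows "continuous_map (prod_topology A (sum_space S T)) Y h"
  unfolding continuous_map_def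
proof (intro conjI allI impI)
  show "h \<in> topspace (prod_topology A (sum_space S T)) \<rightarrow> topspace Y"
  proof
    fix z assume "z \<in> topspace (prod_topology A (sum_space S T))"
    then obtain t b p where "z = (t, Tag b p)" "t \<in> topspace A" "p \<in> topspace (side b S T)"
      by (auto elim!: sum_setE simp: topspace_side)
    then show "h z \<in> topspace Y"
      using continuous_map_image_subset_topspace[OF assms[of b]] by fastforce
  qed
  fix U assume U: "openin Y U"
  let ?P = "{z \<in> topspace (prod_topology A (sum_space S T)). h z \<in> U}"
  show "openin (prod_topology A (sum_space S T)) ?P"
    unfolding openin_prod_topology_alt
  proof (intro allI impI)
    fix t w assume tw: "(t, w) \<in> ?P"
    then obtain b p where w: "w = Tag b p" "p \<in> topspace (side b S T)"
      by (auto elim!: sum_setE simp: topspace_side)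
    let ?Q = "{z \<in> topspace (prod_topology A (side b S T)). (\<lambda>(t, p). h (t, Tag b p)) z \<in> U}"
    have "openin (prod_topology A (side b S T)) ?Q"
      by (rule openin_continuous_map_preimage[OF assms U])
    moreover have "(t, p) \<in> ?Q"
      using tw w by auto
    ultimately obtain V W where V: "openin A V" "openin (side b S T) W" "t \<in> V" "p \<in> W" "V \<times> W \<subseteq> ?Q"
      unfolding openin_prod_topology_alt by meson
    have "V \<times> Tag b ` W \<subseteq> ?P"
      using V(5) by (auto simp: subset_iff topspace_side)
    then show "\<exists>V W. openin A V \<and> openin (sum_space S T) W \<and> t \<in> V \<and> w \<in> W \<and> V \<times> W \<subseteq> ?P"
      using V w by (intro exI[of _ V] exI[of _ "Tag b ` W"]) (auto simp: openin_Tag_image)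
  qed
qed

section \<open>Smooth maps in charts\<close>

lemma is_chartD:
  assumes "is_chart n T (U, \<phi>, s)"
  shows "openin T U" "\<phi> \<in> extensional U" "s = 1 \<or> s = -1" "openin (half_space n) (\<phi> ` U)"
    "homeomorphic_map (subtopology T U) (subtopology (half_space n) (\<phi> ` U)) \<phi>"
    "U \<subseteq> topspace T" "inj_on \<phi> U" "\<phi> ` U \<subseteq> topspace (Euclidean_space n)"
proof -
  show c: "openin T U" "\<phi> \<in> extensional U" "s = 1 \<or> s = -1" "openin (half_space n) (\<phi> ` U)"
    "homeomorphic_map (subtopology T U) (subtopology (half_space n) (\<phi> ` U)) \<phi>"
    using assms by (auto simp: is_chart_def)
  show U: "U \<subseteq> topspace T"
    using c(1) by (rule openin_subset)
  show "inj_on \<phi> U"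
    using homeomorphic_imp_injective_map[OF c(5)] U by (simp add: Int_absorb1)
  show "\<phi> ` U \<subseteq> topspace (Euclidean_space n)"
    using openin_subset[OF c(4)] by (auto simp: half_space_def)
qed

text \<open>Near a boundary point the image of a chart is not open in Euclidean space. Cutting it
  with an open set \<open>B\<close> gives the neighbourhoods that
  \<open>smooth_with_sign_local_cong\<close> asks for.\<close>

lemma chart_open_image:
  assumes c: "is_chart n T (U, \<phi>, s)" and A: "openin T A"
  obtains B where "openin (Euclidean_space n) B" "\<phi> ` (U \<inter> A) = \<phi> ` U \<inter> B"
proof -
  note c = is_chartD[OF c]
  have "openin (subtopology T U) (U \<inter> A)"
    using A by (auto simp: openin_subtopology)
  then have "openin (subtopology (half_space n) (\<phi> ` U)) (\<phi> ` (U \<inter> A))"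
    using homeomorphic_imp_open_map[OF c(5)] by (simp add: open_map_def)
  then have "openin (half_space n) (\<phi> ` (U \<inter> A))"
    using c(4) by (simp add: openin_open_subtopology)
  then obtain B where "openin (Euclidean_space n) B" "\<phi> ` (U \<inter> A) = B \<inter> {x. x 0 \<le> 0}"
    by (auto simp: half_space_def openin_subtopology)
  moreover have "\<phi> ` U \<subseteq> {x. x 0 \<le> 0}"
    using openin_subset[OF c(4)] by (auto simp: half_space_def)
  ultimately show ?thesis
    by (intro that[of B]) auto
qed

text \<open>Orientation preserving smooth maps and boundary embeddings at once: \<open>pr\<close> is the identity or
  forgets coordinate 0, and \<open>\<sigma>\<close> is the sign of the Jacobian with respect to positive charts.\<close>

definition smooth_rel ::
  "nat \<Rightarrow> 'p mfd \<Rightarrow> 'q mfd \<Rightarrow> ((nat \<Rightarrow> real) \<Rightarrow> nat \<Rightarrow> real) \<Rightarrow> real \<Rightarrow> ('p \<Rightarrow> 'q) \<Rightarrow> bool" where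
  "smooth_rel n M N pr \<sigma> f \<longleftrightarrow>
     (\<forall>(U, \<phi>, s)\<in>atlas M. \<forall>(V, \<xi>, t)\<in>atlas N.
        smooth_with_sign n (\<phi> ` (U \<inter> f -` V)) (\<lambda>y. pr (\<xi> (f (inv_into U \<phi> y)))) (\<sigma> * s * t))"

lemma smooth_relD:
  "smooth_rel n M N pr \<sigma> f \<Longrightarrow> (U, \<phi>, s) \<in> atlas M \<Longrightarrow> (V, \<xi>, t) \<in> atlas N \<Longrightarrow>
    smooth_with_sign n (\<phi> ` (U \<inter> f -` V)) (\<lambda>y. pr (\<xi> (f (inv_into U \<phi> y)))) (\<sigma> * s * t)"
  by (auto simp: smooth_rel_def)

lemma oriented_smooth_conv: "oriented_smooth n M N f \<longleftrightarrow> smooth_rel n M N (\<lambda>x. x) 1 f"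
  by (simp add: oriented_smooth_def smooth_rel_def)

definition charted :: "nat \<Rightarrow> 'p mfd \<Rightarrow> bool" where
  "charted n M \<longleftrightarrow> (\<forall>c\<in>atlas M. is_chart n (mfd.space M) c)"

lemma smooth_rel_cong:
  assumes M: "charted n M" and f: "smooth_rel n M N pr \<sigma> f" and fg: "\<And>p. p \<in> points M \<Longrightarrow> f p = g p"
  shows "smooth_rel n M N pr \<sigma> g"
  unfolding smooth_rel_def
proof (intro ballI, clarify)
  fix U \<phi> s V \<xi> t assume c: "(U, \<phi>, s) \<in> atlas M" and d: "(V, \<xi>, t) \<in> atlas N"
  have U: "is_chart n (mfd.space M) (U, \<phi>, s)"
    using M c by (auto simp: charted_def)
  note U = is_chartD[OF U]
  have "U \<inter> g -` V = U \<inter> f -` V"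
    using fg U(6) by auto
  moreover have "f (inv_into U \<phi> y) = g (inv_into U \<phi> y)" if "y \<in> \<phi> ` U" for y
    using fg inv_into_into[OF that] U(6) by blast
  ultimately show "smooth_with_sign n (\<phi> ` (U \<inter> g -` V)) (\<lambda>y. pr (\<xi> (g (inv_into U \<phi> y)))) (\<sigma> * s * t)"
    by (intro smooth_with_sign_cong[OF smooth_relD[OF f c d]]) (use U(8) in auto)
qed

text \<open>Near each point a chart of \<open>N\<close> around its image is inserted, which factors
  the coordinate expression of the composite. The chart depends on the point, whence the local
  argument.\<close>

lemma smooth_rel_compose:
  assumes M: "charted n M" and N: "charted n N" and cover: "points N \<subseteq> (\<Union>(W, \<eta>, r)\<in>atlas N. W)"
    and f: "smooth_rel n M N (\<lambda>x. x) 1 f" "continuous_map (mfd.space M) (mfd.space N) f"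
    and g: "smooth_rel n N P pr \<sigma> g"
  shows "smooth_rel n M P pr \<sigma> (\<lambda>p. g (f p))"
  unfolding smooth_rel_def
proof (intro ballI, clarify)
  fix U \<phi> s V \<xi> t assume c: "(U, \<phi>, s) \<in> atlas M" and d: "(V, \<xi>, t) \<in> atlas P"
  have c': "is_chart n (mfd.space M) (U, \<phi>, s)"
    using M c by (auto simp: charted_def)
  note U = is_chartD[OF c']
  let ?S = "\<phi> ` (U \<inter> (\<lambda>p. g (f p)) -` V)"
  show "smooth_with_sign n ?S (\<lambda>y. pr (\<xi> (g (f (inv_into U \<phi> y))))) (\<sigma> * s * t)"
  proof (rule smooth_with_sign_local_cong)
    fix x assume "x \<in> ?S"
    then obtain p where p: "x = \<phi> p" "p \<in> U" "g (f p) \<in> V"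
      by auto
    have "f p \<in> points N"
      using f(2) p(2) U(6) by (auto simp: continuous_map_def)
    then obtain W \<eta> r where e: "(W, \<eta>, r) \<in> atlas N" "f p \<in> W"
      using cover by auto
    have e': "is_chart n (mfd.space N) (W, \<eta>, r)"
      using N e by (auto simp: charted_def)
    note W = is_chartD[OF e']
    have "openin (mfd.space M) {q \<in> points M. f q \<in> W}"
      by (rule openin_continuous_map_preimage[OF f(2) W(1)])
    from chart_open_image[OF c' this] obtain B where B: "openin (Euclidean_space n) B"
      "\<phi> ` (U \<inter> {q \<in> points M. f q \<in> W}) = \<phi> ` U \<inter> B"
      by blast
    let ?T = "\<phi> ` (U \<inter> f -` W \<inter> (\<lambda>p. g (f p)) -` V)"
    let ?f = "\<lambda>y. \<eta> (f (inv_into U \<phi> y))" and ?g = "\<lambda>z. pr (\<xi> (g (inv_into W \<eta> z)))"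
    have inv: "inv_into U \<phi> (\<phi> q) = q" if "q \<in> U" for q
      using U(7) that by simp
    have inv': "inv_into W \<eta> (\<eta> q) = q" if "q \<in> W" for q
      using W(7) that by simp
    have "smooth_with_sign n ?T ?f (1 * s * r)"
      by (rule smooth_with_sign_cong[OF smooth_relD[OF f(1) c e(1)]]) (use U(8) in auto)
    moreover have "smooth_with_sign n (\<eta> ` (W \<inter> g -` V)) ?g (\<sigma> * r * t)"
      by (rule smooth_relD[OF g e(1) d])
    moreover have "?f ` ?T \<subseteq> \<eta> ` (W \<inter> g -` V)"
      using inv by auto
    moreover have "\<eta> ` (W \<inter> g -` V) \<subseteq> topspace (Euclidean_space n)"
      using W(8) by auto
    ultimately have "smooth_with_sign n ?T (\<lambda>y. ?g (?f y)) ((1 * s * r) * (\<sigma> * r * t))"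
      by (rule smooth_with_sign_compose)
    \<comment> \<open>The sign of the inserted chart enters twice and squares to 1.\<close>
    moreover have "(1 * s * r) * (\<sigma> * r * t) = \<sigma> * s * t"
      using W(3) by auto
    ultimately have T: "smooth_with_sign n ?T (\<lambda>y. ?g (?f y)) (\<sigma> * s * t)"
      by (simp only:)
    have "x \<in> B"
      using B(2) p e(2) U(6) by blast
    moreover have "?S \<inter> B \<subseteq> ?T"
    proof
      fix y assume y: "y \<in> ?S \<inter> B"
      then obtain q where q: "y = \<phi> q" "q \<in> U" "g (f q) \<in> V"
        by auto
      then have "y \<in> \<phi> ` (U \<inter> {q \<in> points M. f q \<in> W})"
        using B(2) y by auto
      then have "f q \<in> W"
        using q U(7) by (auto dest: inj_onD)
      then show "y \<in> ?T"
        using q by auto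
    qed
    moreover have "?g (?f y) = pr (\<xi> (g (f (inv_into U \<phi> y))))" if "y \<in> ?T" for y
    proof -
      obtain q where "y = \<phi> q" "q \<in> U" "f q \<in> W"
        using \<open>y \<in> ?T\<close> by blast
      then show ?thesis
        using inv inv' by simp
    qed
    ultimately show "\<exists>B T h. openin (Euclidean_space n) B \<and> x \<in> B \<and> ?S \<inter> B \<subseteq> T \<and>
        smooth_with_sign n T h (\<sigma> * s * t) \<and> (\<forall>y\<in>?S \<inter> B. \<forall>j<n. h y j = pr (\<xi> (g (f (inv_into U \<phi> y)))) j)"
      using B(1) T by (intro exI[of _ B] exI[of _ ?T] exI[of _ "\<lambda>y. ?g (?f y)"]) (simp only: subset_iff simp_thms, simp)
  qed
qed

section \<open>Disjoint unions of manifolds\<close>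

lemma space_sum_mfd [simp]: "mfd.space (sum_mfd n M N) = sum_space (mfd.space M) (mfd.space N)"
  by (simp add: sum_mfd_def)

lemma points_side: "points (side b M N) = side b (points M) (points N)"
  by (cases b) auto

lemma space_side: "mfd.space (side b M N) = side b (mfd.space M) (mfd.space N)"
  by (cases b) auto

lemma sum_mfd_atlas:
  "(U, \<phi>, s) \<in> atlas (sum_mfd n M N) \<longleftrightarrow>
    is_chart n (sum_space (mfd.space M) (mfd.space N)) (U, \<phi>, s) \<and>
    (\<forall>b. (Tag b -` U, \<lambda>p\<in>Tag b -` U. \<phi> (Tag b p), s) \<in> atlas (side b M N))"
proof -
  have all: "(\<forall>b. P b) \<longleftrightarrow> P False \<and> P True" for P :: "bool \<Rightarrow> bool"
    by (metis (full_types))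
  show ?thesis
    unfolding all by (simp add: sum_mfd_def)
qed

text \<open>Each summand is open, so near a point a chart of the disjoint union can be replaced by
  its restriction to one summand, which belongs to the atlas there by the definition of
  \<open>sum_mfd\<close>.\<close>

lemma smooth_rel_from_sum:
  assumes f: "\<And>b. smooth_rel n (side b M N) P pr \<sigma> (\<lambda>p. f (Tag b p))"
  shows "smooth_rel n (sum_mfd n M N) P pr \<sigma> f"
  unfolding smooth_rel_def
proof (intro ballI, clarify)
  fix U \<phi> s V \<xi> t assume c: "(U, \<phi>, s) \<in> atlas (sum_mfd n M N)" and d: "(V, \<xi>, t) \<in> atlas P"
  have c': "is_chart n (sum_space (mfd.space M) (mfd.space N)) (U, \<phi>, s)"
    and cb: "\<And>b. (Tag b -` U, \<lambda>p\<in>Tag b -` U. \<phi> (Tag b p), s) \<in> atlas (side b M N)"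
    using c by (auto simp: sum_mfd_atlas)
  note U = is_chartD[OF c']
  let ?S = "\<phi> ` (U \<inter> f -` V)"
  show "smooth_with_sign n ?S (\<lambda>y. pr (\<xi> (f (inv_into U \<phi> y)))) (\<sigma> * s * t)"
  proof (rule smooth_with_sign_local_cong)
    fix x assume "x \<in> ?S"
    then obtain w where w: "x = \<phi> w" "w \<in> U" "f w \<in> V"
      by auto
    then obtain b p where p: "w = Tag b p" "p \<in> points (side b M N)"
      using U(6) by (auto elim!: sum_setE simp: points_side)
    let ?O = "Tag b ` topspace (side b (mfd.space M) (mfd.space N))"
    obtain B where B: "openin (Euclidean_space n) B" "\<phi> ` (U \<inter> ?O) = \<phi> ` U \<inter> B"
      using chart_open_image[OF c' openin_Tag_image[OF openin_topspace]] by blast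
    let ?U = "Tag b -` U"
    let ?\<phi> = "\<lambda>p\<in>?U. \<phi> (Tag b p)"
    let ?T = "?\<phi> ` (?U \<inter> (\<lambda>p. f (Tag b p)) -` V)"
    have inv: "inv_into U \<phi> (\<phi> q) = q" if "q \<in> U" for q
      using U(7) that by simp
    have "inj_on ?\<phi> ?U"
      using U(7) by (auto simp: inj_on_def)
    then have inv': "inv_into ?U ?\<phi> (\<phi> (Tag b q)) = q" if "Tag b q \<in> U" for q
      using inv_into_f_f[of ?\<phi> ?U q] that by simp
    have in_B: "\<exists>q. y = \<phi> (Tag b q) \<and> Tag b q \<in> U \<and> f (Tag b q) \<in> V" if y: "y \<in> ?S" "y \<in> B" for y
    proof -
      obtain v where v: "y = \<phi> v" "v \<in> U" "f v \<in> V"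
        using y by auto
      then have "y \<in> \<phi> ` (U \<inter> ?O)"
        using y B(2) by auto
      then have "v \<in> ?O"
        using v U(7) by (auto dest: inj_onD)
      then show ?thesis
        using v by auto
    qed
    have "?S \<inter> B \<subseteq> ?T"
    proof
      fix y assume "y \<in> ?S \<inter> B"
      then obtain q where q: "y = \<phi> (Tag b q)" "Tag b q \<in> U" "f (Tag b q) \<in> V"
        using in_B by auto
      then show "y \<in> ?T"
        by (intro image_eqI[of _ _ q]) auto
    qed
    moreover have "x \<in> B"
    proof -
      have "w \<in> U \<inter> ?O"
        using w p by (auto simp: points_side topspace_side)
      then show ?thesis
        using B(2) w(1) by blast
    qed
    moreover have "\<forall>y\<in>?S \<inter> B. \<forall>j<n. pr (\<xi> (f (Tag b (inv_into ?U ?\<phi> y)))) j = pr (\<xi> (f (inv_into U \<phi> y))) j"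
    proof (intro ballI allI impI)
      fix y j assume "y \<in> ?S \<inter> B"
      then obtain q where q: "y = \<phi> (Tag b q)" "Tag b q \<in> U" "f (Tag b q) \<in> V"
        using in_B by auto
      show "pr (\<xi> (f (Tag b (inv_into ?U ?\<phi> y)))) j = pr (\<xi> (f (inv_into U \<phi> y))) j"
        unfolding q(1) by (simp only: inv[OF q(2)] inv'[OF q(2)])
    qed
    moreover have "smooth_with_sign n ?T (\<lambda>y. pr (\<xi> (f (Tag b (inv_into ?U ?\<phi> y))))) (\<sigma> * s * t)"
      by (rule smooth_relD[OF f cb d])
    ultimately show "\<exists>B T h. openin (Euclidean_space n) B \<and> x \<in> B \<and> ?S \<inter> B \<subseteq> T \<and>
        smooth_with_sign n T h (\<sigma> * s * t) \<and> (\<forall>y\<in>?S \<inter> B. \<forall>j<n. h y j = pr (\<xi> (f (inv_into U \<phi> y))) j)"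
      using B(1) by blast
  qed
qed

text \<open>A chart of the disjoint union restricts along \<open>Tag b\<close> to a chart of the
  summand. The dimensions \<open>n\<close> and \<open>m\<close> are kept apart because boundary
  embeddings go into manifolds of dimension one higher.\<close>

lemma smooth_rel_Tag:
  assumes M: "charted n M" and f: "smooth_rel n M (side b N N') pr \<sigma> f"
  shows "smooth_rel n M (sum_mfd m N N') pr \<sigma> (\<lambda>p. Tag b (f p))"
  unfolding smooth_rel_def
proof (intro ballI, clarify)
  fix U \<phi> s V \<xi> t assume c: "(U, \<phi>, s) \<in> atlas M" and d: "(V, \<xi>, t) \<in> atlas (sum_mfd m N N')"
  have U: "is_chart n (mfd.space M) (U, \<phi>, s)"
    using M c by (auto simp: charted_def)
  note U = is_chartD[OF U]
  have "(Tag b -` V, \<lambda>p\<in>Tag b -` V. \<xi> (Tag b p), t) \<in> atlas (side b N N')"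
    using d by (simp add: sum_mfd_atlas)
  from smooth_relD[OF f c this]
  show "smooth_with_sign n (\<phi> ` (U \<inter> (\<lambda>p. Tag b (f p)) -` V)) (\<lambda>y. pr (\<xi> (Tag b (f (inv_into U \<phi> y))))) (\<sigma> * s * t)"
    by (rule smooth_with_sign_cong) (use U(7,8) in auto)
qed

lemma smooth_with_sign_empty [simp]: "smooth_with_sign n {} f \<sigma>"
  by (simp add: smooth_with_sign_def)

lemma manifoldD:
  assumes "manifold n M"
  shows "compact_space (mfd.space M)" "Hausdorff_space (mfd.space M)"
    "(\<Union>(U, \<phi>, s)\<in>atlas M. U) = points M"
    "\<forall>c\<in>atlas M. is_chart n (mfd.space M) c"
    "\<forall>c\<in>atlas M. \<forall>d\<in>atlas M. compatible n c d"
    "\<forall>c. is_chart n (mfd.space M) c \<and> (\<forall>d\<in>atlas M. compatible n c d) \<longrightarrow> c \<in> atlas M"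
  using assms unfolding manifold_def by - (elim conjE, assumption)+

lemma manifold_compatible: "manifold n M \<Longrightarrow> c \<in> atlas M \<Longrightarrow> d \<in> atlas M \<Longrightarrow> compatible n c d"
  by (rule bspec[OF bspec[OF manifoldD(5)]])

lemma manifold_maximal:
  "manifold n M \<Longrightarrow> is_chart n (mfd.space M) c \<Longrightarrow> (\<And>d. d \<in> atlas M \<Longrightarrow> compatible n c d) \<Longrightarrow> c \<in> atlas M"
  by (rule mp[OF spec[OF manifoldD(6)]]) blast+

text \<open>Compatibility of charts amounts to smoothness of the identity. In this form it can be
  transferred to a disjoint union with \<open>smooth_rel_from_sum\<close> and
  \<open>smooth_rel_Tag\<close>.\<close>

lemma smooth_rel_id: "manifold n M \<Longrightarrow> smooth_rel n M M (\<lambda>x. x) 1 (\<lambda>p. p)"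
  unfolding smooth_rel_def
proof (intro ballI, clarify)
  fix U \<phi> s V \<xi> t assume "manifold n M" "(U, \<phi>, s) \<in> atlas M" "(V, \<xi>, t) \<in> atlas M"
  then have "compatible n (U, \<phi>, s) (V, \<xi>, t)"
    by (rule manifold_compatible)
  then show "smooth_with_sign n (\<phi> ` (U \<inter> (\<lambda>p. p) -` V)) (\<lambda>y. \<xi> (inv_into U \<phi> y)) (1 * s * t)"
    by (simp add: compatible_def)
qed

lemma manifold_charted: "manifold n M \<Longrightarrow> charted n M"
  using manifoldD(4) by (simp add: charted_def)

lemma manifold_cover: "manifold n M \<Longrightarrow> points M \<subseteq> (\<Union>(W, \<eta>, r)\<in>atlas M. W)"
  by (simp add: manifoldD(3))

lemma manifold_side: "manifold n M \<Longrightarrow> manifold n N \<Longrightarrow> manifold n (side b M N)"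
  by (rule side_cases)

lemma empty_chart: "s \<in> {1, -1} \<Longrightarrow> is_chart n T ({}, \<lambda>_. undefined, s)"
  by (auto simp: is_chart_def homeomorphic_map_def quotient_map_def)

text \<open>A consequence of maximality. Each chart of a disjoint union has to restrict to a chart
  of both summands, and a chart supported on one summand restricts to the empty chart on the
  other.\<close>

lemma empty_chart_in_atlas: "manifold n M \<Longrightarrow> s \<in> {1, -1} \<Longrightarrow> ({}, \<lambda>_. undefined, s) \<in> atlas M"
proof -
  assume M: "manifold n M" and "s \<in> {1, -1}"
  then have "is_chart n (mfd.space M) ({}, \<lambda>_. undefined, s)"
    by (intro empty_chart)
  moreover have "compatible n ({}, \<lambda>_. undefined, s) d" for d :: "'a chart"
    by (cases d) (simp add: compatible_def)
  ultimately show ?thesis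
    by (intro manifold_maximal[OF M])
qed

text \<open>Supplies the charts that cover a disjoint union. It also carries charts of a summand
  over when the maximality of the atlas and the boundary are examined.\<close>

lemma sum_mfd_chart:
  assumes M: "manifold n M" "manifold n N" and c: "(U, \<phi>, s) \<in> atlas (side b M N)"
  shows "(Tag b ` U, \<lambda>w\<in>Tag b ` U. \<phi> (un_tag w), s) \<in> atlas (sum_mfd n M N)"
proof -
  let ?S = "side b (mfd.space M) (mfd.space N)" and ?T = "sum_space (mfd.space M) (mfd.space N)"
  let ?\<phi> = "\<lambda>w\<in>Tag b ` U. \<phi> (un_tag w)"
  have "is_chart n ?S (U, \<phi>, s)"
    using manifold_charted[OF manifold_side[OF M]] c by (auto simp: charted_def space_side)
  note U = is_chartD[OF this]
  have img: "?\<phi> ` Tag b ` U = \<phi> ` U"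
    by (auto simp: image_iff)
  have "homeomorphic_map (subtopology ?T (Tag b ` U)) (subtopology (half_space n) (\<phi> ` U)) (\<phi> \<circ> un_tag)"
    by (rule homeomorphic_map_compose[OF homeomorphic_map_un_tag[OF U(6)] U(5)])
  then have "homeomorphic_map (subtopology ?T (Tag b ` U)) (subtopology (half_space n) (\<phi> ` U)) ?\<phi>"
    by (rule homeomorphic_map_eq) auto
  then have "is_chart n ?T (Tag b ` U, ?\<phi>, s)"
    unfolding is_chart_def prod.case img using U by (auto simp: openin_Tag_image)
  moreover have "(Tag d -` Tag b ` U, \<lambda>p\<in>Tag d -` Tag b ` U. ?\<phi> (Tag d p), s) \<in> atlas (side d M N)" for d
  proof (cases "d = b")
    case True
    have "(\<lambda>p\<in>U. ?\<phi> (Tag b p)) = \<phi>"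
      using U(2) by (auto simp: fun_eq_iff extensional_def)
    then show ?thesis
      using True c by simp
  next
    case False
    then show ?thesis
      using empty_chart_in_atlas[OF manifold_side[OF M], of s] U(3) by (auto simp: restrict_def)
  qed
  ultimately show ?thesis
    by (simp add: sum_mfd_atlas)
qed

text \<open>Maximality of the atlas of a disjoint union concerns charts that are not yet known to
  belong to it. Their restrictions have to be recognised as charts before the maximality of the
  summands applies.\<close>

lemma sum_mfd_restrict_chart:
  assumes c: "is_chart n (sum_space S T) (U, \<phi>, s)"
  shows "is_chart n (side b S T) (Tag b -` U, \<lambda>p\<in>Tag b -` U. \<phi> (Tag b p), s)"
proof -
  note U = is_chartD[OF c]
  let ?U = "Tag b -` U" and ?O = "Tag b ` topspace (side b S T)"
  let ?\<phi> = "\<lambda>p\<in>?U. \<phi> (Tag b p)"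
  have open_U: "openin (side b S T) ?U"
    using U(1) by (simp add: openin_sum_space)
  have UO: "Tag b ` ?U = U \<inter> ?O"
    using openin_subset[OF open_U] by auto
  have img: "?\<phi> ` ?U = \<phi> ` (U \<inter> ?O)"
    unfolding UO[symmetric] by (auto simp: image_iff)
  obtain B where B: "openin (Euclidean_space n) B" "\<phi> ` (U \<inter> ?O) = \<phi> ` U \<inter> B"
    using chart_open_image[OF c openin_Tag_image[OF openin_topspace]] by blast
  have "openin (half_space n) (\<phi> ` U \<inter> B)"
  proof -
    have "openin (half_space n) (B \<inter> {x. x 0 \<le> 0})"
      using B(1) by (auto simp: half_space_def openin_subtopology)
    then have "openin (half_space n) (\<phi> ` U \<inter> (B \<inter> {x. x 0 \<le> 0}))"
      using U(4) by (rule openin_Int[rotated])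
    moreover have "\<phi> ` U \<inter> (B \<inter> {x. x 0 \<le> 0}) = \<phi> ` U \<inter> B"
      using openin_subset[OF U(4)] by (auto simp: half_space_def)
    ultimately show ?thesis
      by simp
  qed
  then have 1: "openin (half_space n) (?\<phi> ` ?U)"
    by (simp only: img B(2))
  have "homeomorphic_map (subtopology (subtopology (sum_space S T) U) ?O)
      (subtopology (subtopology (half_space n) (\<phi> ` U)) (\<phi> ` (U \<inter> ?O))) \<phi>"
    by (rule homeomorphic_map_subtopologies[OF U(5)])
      (use U(6) openin_subset[OF U(4)] in auto)
  moreover have "\<phi> ` U \<inter> \<phi> ` (U \<inter> ?O) = \<phi> ` (U \<inter> ?O)"
    by auto
  ultimately have 2: "homeomorphic_map (subtopology (sum_space S T) (Tag b ` ?U))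
      (subtopology (half_space n) (?\<phi> ` ?U)) \<phi>"
    by (simp only: subtopology_subtopology UO img)
  have "homeomorphic_map (subtopology (side b S T) ?U) (subtopology (half_space n) (?\<phi> ` ?U)) (\<phi> \<circ> Tag b)"
    by (rule homeomorphic_map_compose[OF homeomorphic_map_Tag[OF openin_subset[OF open_U]] 2])
  then have "homeomorphic_map (subtopology (side b S T) ?U) (subtopology (half_space n) (?\<phi> ` ?U)) ?\<phi>"
    by (rule homeomorphic_map_eq) auto
  then show ?thesis
    unfolding is_chart_def prod.case using open_U U(3) 1 by auto
qed

lemma manifold_sum_mfd:
  assumes M: "manifold n M" "manifold n N"
  shows "manifold n (sum_mfd n M N)"
  unfolding manifold_def
proof (intro conjI ballI allI impI)
  let ?S = "sum_mfd n M N" and ?T = "sum_space (mfd.space M) (mfd.space N)"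
  show "compact_space (mfd.space ?S)" "Hausdorff_space (mfd.space ?S)"
    using manifoldD(1,2)[OF M(1)] manifoldD(1,2)[OF M(2)]
    by (simp_all add: compact_space_sum_space Hausdorff_space_sum_space)
  have charts: "is_chart n ?T c" if "c \<in> atlas ?S" for c
    using that by (cases c) (simp add: sum_mfd_atlas)
  then show "is_chart n (mfd.space ?S) c" if "c \<in> atlas ?S" for c
    using that by simp
  show "(\<Union>(U, \<phi>, s)\<in>atlas ?S. U) = points ?S"
  proof
    show "(\<Union>(U, \<phi>, s)\<in>atlas ?S. U) \<subseteq> points ?S"
      using is_chartD(6)[OF charts] by fastforce
    show "points ?S \<subseteq> (\<Union>(U, \<phi>, s)\<in>atlas ?S. U)"
    proof
      fix w assume "w \<in> points ?S"
      then obtain b p where w: "w = Tag b p" "p \<in> points (side b M N)"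
        by (auto elim!: sum_setE simp: points_side)
      then obtain U \<phi> s where "(U, \<phi>, s) \<in> atlas (side b M N)" "p \<in> U"
        using manifold_cover[OF manifold_side[OF M]] by blast
      then show "w \<in> (\<Union>(U, \<phi>, s)\<in>atlas ?S. U)"
        using sum_mfd_chart[OF M] w by blast
    qed
  qed
  \<comment> \<open>Smoothness of the identity, assembled from the two summands, yields the
    compatibility of all pairs of charts.\<close>
  have "smooth_rel n ?S ?S (\<lambda>x. x) 1 (\<lambda>p. p)"
    by (intro smooth_rel_from_sum smooth_rel_Tag smooth_rel_id manifold_charted manifold_side M)
  note id = smooth_relD[OF this]
  show "compatible n c d" if "c \<in> atlas ?S" "d \<in> atlas ?S" for c d
  proof -
    obtain U \<phi> s V \<xi> t where "c = (U, \<phi>, s)" "d = (V, \<xi>, t)"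
      by (cases c, cases d)
    then show ?thesis
      using id[of U \<phi> s V \<xi> t] id[of V \<xi> t U \<phi> s] that
      by (simp add: compatible_def mult.commute Int_commute)
  qed
  fix c assume c: "is_chart n (mfd.space ?S) c \<and> (\<forall>d\<in>atlas ?S. compatible n c d)"
  obtain U \<phi> s where c_eq: "c = (U, \<phi>, s)"
    by (cases c)
  have c': "is_chart n ?T (U, \<phi>, s)"
    using c by (simp add: c_eq)
  note U = is_chartD[OF c']
  have "(Tag b -` U, \<lambda>p\<in>Tag b -` U. \<phi> (Tag b p), s) \<in> atlas (side b M N)" for b
  proof -
    let ?U = "Tag b -` U"
    let ?\<phi> = "\<lambda>p\<in>?U. \<phi> (Tag b p)"
    have chart: "is_chart n (mfd.space (side b M N)) (?U, ?\<phi>, s)"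
      using sum_mfd_restrict_chart[OF c'] by (simp add: space_side)
    have "compatible n (?U, ?\<phi>, s) d" if d: "d \<in> atlas (side b M N)" for d
    proof -
      obtain V \<xi> t where d_eq: "d = (V, \<xi>, t)"
        by (cases d)
      \<comment> \<open>The chart \<open>d\<close> of a summand is carried to the disjoint union,
        where its compatibility with \<open>c\<close> is assumed. Restricting back gives
        compatibility with the restriction of \<open>c\<close>.\<close>
      let ?V = "Tag b ` V"
      let ?\<xi> = "\<lambda>w\<in>?V. \<xi> (un_tag w)"
      have d': "(?V, ?\<xi>, t) \<in> atlas ?S"
        using sum_mfd_chart[OF M] d by (simp add: d_eq)
      have V: "is_chart n (mfd.space (side b M N)) (V, \<xi>, t)"
        using manifold_charted[OF manifold_side[OF M]] d by (auto simp: charted_def d_eq)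
      note V = is_chartD[OF V]
      have "compatible n (U, \<phi>, s) (?V, ?\<xi>, t)"
        using c d' by (simp add: c_eq)
      then have sm: "smooth_with_sign n (\<phi> ` (U \<inter> ?V)) (\<lambda>y. ?\<xi> (inv_into U \<phi> y)) (s * t)"
        "smooth_with_sign n (?\<xi> ` (U \<inter> ?V)) (\<lambda>y. \<phi> (inv_into ?V ?\<xi> y)) (s * t)"
        by (simp_all add: compatible_def)
      have inv: "inv_into U \<phi> (\<phi> q) = q" if "q \<in> U" for q
        using U(7) that by simp
      have inj: "inj_on ?\<phi> ?U" "inj_on ?\<xi> ?V"
        using U(7) V(7) by (auto simp: inj_on_def)
      have inv': "inv_into ?U ?\<phi> (\<phi> (Tag b q)) = q" if "Tag b q \<in> U" for q
        using inv_into_f_f[OF inj(1), of q] that by simp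
      have inv'': "inv_into ?V ?\<xi> (\<xi> q) = Tag b q" if "q \<in> V" for q
        using inv_into_f_f[OF inj(2), of "Tag b q"] that by simp
      have inv''': "inv_into V \<xi> (\<xi> q) = q" if "q \<in> V" for q
        using V(7) that by simp
      show ?thesis
        unfolding d_eq compatible_def prod.case
      proof
        show "smooth_with_sign n (?\<phi> ` (?U \<inter> V)) (\<lambda>y. \<xi> (inv_into ?U ?\<phi> y)) (s * t)"
        proof (rule smooth_with_sign_cong[OF sm(1)])
          show "?\<phi> ` (?U \<inter> V) \<subseteq> \<phi> ` (U \<inter> ?V)" "?\<phi> ` (?U \<inter> V) \<subseteq> topspace (Euclidean_space n)"
            using U(8) by auto
          fix x j assume "x \<in> ?\<phi> ` (?U \<inter> V)"
          then obtain q where q: "Tag b q \<in> U" "q \<in> V" "x = \<phi> (Tag b q)"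
            by auto
          show "?\<xi> (inv_into U \<phi> x) j = \<xi> (inv_into ?U ?\<phi> x) j"
            unfolding q(3) inv[OF q(1)] inv'[OF q(1)] using q(2) by simp
        qed
        show "smooth_with_sign n (\<xi> ` (?U \<inter> V)) (\<lambda>y. ?\<phi> (inv_into V \<xi> y)) (s * t)"
        proof (rule smooth_with_sign_cong[OF sm(2)])
          show "\<xi> ` (?U \<inter> V) \<subseteq> ?\<xi> ` (U \<inter> ?V)" "\<xi> ` (?U \<inter> V) \<subseteq> topspace (Euclidean_space n)"
            using V(8) by (force simp: image_iff)+
          fix x j assume "x \<in> \<xi> ` (?U \<inter> V)"
          then obtain q where q: "Tag b q \<in> U" "q \<in> V" "x = \<xi> q"
            by auto
          show "\<phi> (inv_into ?V ?\<xi> x) j = ?\<phi> (inv_into V \<xi> x) j"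
            unfolding q(3) inv''[OF q(2)] inv'''[OF q(2)] using q(1) by simp
        qed
      qed
    qed
    then show ?thesis
      by (rule manifold_maximal[OF manifold_side[OF M] chart])
  qed
  then show "c \<in> atlas ?S"
    using c' by (simp add: c_eq sum_mfd_atlas)
qed

text \<open>A boundary point is detected by a single chart. Charts pass from the disjoint union to
  the summands by restriction, and back by \<open>sum_mfd_chart\<close>.\<close>

lemma boundary_sum_mfd:
  assumes M: "manifold n M" "manifold n N"
  shows "boundary n (sum_mfd n M N) = sum_set (boundary n M) (boundary n N)"
proof -
  have "Tag b p \<in> boundary n (sum_mfd n M N) \<longleftrightarrow> p \<in> boundary n (side b M N)" for b p
  proof
    assume "Tag b p \<in> boundary n (sum_mfd n M N)"
    then obtain U \<phi> s where "n > 0" "(U, \<phi>, s) \<in> atlas (sum_mfd n M N)" "Tag b p \<in> U" "\<phi> (Tag b p) 0 = 0"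
      by (auto simp: boundary_def)
    moreover from this have "(Tag b -` U, \<lambda>p\<in>Tag b -` U. \<phi> (Tag b p), s) \<in> atlas (side b M N)"
      by (simp add: sum_mfd_atlas)
    ultimately show "p \<in> boundary n (side b M N)"
      unfolding boundary_def by (auto intro!: bexI[of _ "(Tag b -` U, \<lambda>p\<in>Tag b -` U. \<phi> (Tag b p), s)"])
  next
    assume "p \<in> boundary n (side b M N)"
    then obtain U \<phi> s where "n > 0" "(U, \<phi>, s) \<in> atlas (side b M N)" "p \<in> U" "\<phi> p 0 = 0"
      by (auto simp: boundary_def)
    then show "Tag b p \<in> boundary n (sum_mfd n M N)"
      using sum_mfd_chart[OF M, of U \<phi> s b] unfolding boundary_def
      by (auto intro!: bexI[of _ "(Tag b ` U, \<lambda>w\<in>Tag b ` U. \<phi> (un_tag w), s)"])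
  qed
  moreover have sub: "boundary n (sum_mfd n M N) \<subseteq> points (sum_mfd n M N)"
    unfolding manifoldD(3)[OF manifold_sum_mfd[OF M], symmetric] boundary_def by blast
  moreover have "boundary n (side b M N) = side b (boundary n M) (boundary n N)" for b
    by (cases b) auto
  ultimately have b: "Tag b p \<in> boundary n (sum_mfd n M N) \<longleftrightarrow> Tag b p \<in> sum_set (boundary n M) (boundary n N)" for b p
    by simp
  show ?thesis
  proof (intro equalityI subsetI)
    fix w assume w: "w \<in> boundary n (sum_mfd n M N)"
    then have "w \<in> sum_set (points M) (points N)"
      using sub by auto
    then show "w \<in> sum_set (boundary n M) (boundary n N)"
      using w b by (auto elim!: sum_setE)
  next
    fix w assume w: "w \<in> sum_set (boundary n M) (boundary n N)"
    then show "w \<in> boundary n (sum_mfd n M N)"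
      using b by (metis sum_setE)
  qed
qed

section \<open>Smooth maps between disjoint unions\<close>

definition smooth_map :: "nat \<Rightarrow> 'p mfd \<Rightarrow> 'q mfd \<Rightarrow> ('p \<Rightarrow> 'q) \<Rightarrow> bool" where
  "smooth_map n M N f \<longleftrightarrow>
     continuous_map (mfd.space M) (mfd.space N) f \<and> smooth_rel n M N (\<lambda>x. x) 1 f"

lemma smooth_map_points: "smooth_map n M N f \<Longrightarrow> p \<in> points M \<Longrightarrow> f p \<in> points N"
  by (auto simp: smooth_map_def continuous_map_def)

lemma smooth_map_cong:
  "charted n M \<Longrightarrow> smooth_map n M N f \<Longrightarrow> (\<And>p. p \<in> points M \<Longrightarrow> f p = g p) \<Longrightarrow> smooth_map n M N g"
  unfolding smooth_map_def by (auto intro: continuous_map_eq smooth_rel_cong)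

lemma smooth_map_compose:
  assumes M: "manifold n M" "manifold n N" and f: "smooth_map n M N f" and g: "smooth_map n N P g"
  shows "smooth_map n M P (\<lambda>p. g (f p))"
proof -
  have "smooth_rel n M P (\<lambda>x. x) 1 (\<lambda>p. g (f p))"
    by (rule smooth_rel_compose[OF manifold_charted[OF M(1)] manifold_charted[OF M(2)] manifold_cover[OF M(2)]
          conjunct2[OF f[unfolded smooth_map_def]] conjunct1[OF f[unfolded smooth_map_def]]
          conjunct2[OF g[unfolded smooth_map_def]]])
  then show ?thesis
    using f g continuous_map_compose[of "mfd.space M" "mfd.space N" f "mfd.space P" g]
    by (simp add: smooth_map_def o_def)
qed

lemma smooth_map_id: "manifold n M \<Longrightarrow> smooth_map n M M (\<lambda>p. p)"
  by (simp add: smooth_map_def smooth_rel_id)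

lemma smooth_map_Tag:
  assumes M: "charted n M" and f: "smooth_map n M (side b N N') f"
  shows "smooth_map n M (sum_mfd n N N') (\<lambda>p. Tag b (f p))"
proof -
  have "continuous_map (mfd.space M) (side b (mfd.space N) (mfd.space N')) f"
    using f by (simp add: smooth_map_def space_side)
  from continuous_map_compose[OF this continuous_map_Tag]
  have "continuous_map (mfd.space M) (sum_space (mfd.space N) (mfd.space N')) (\<lambda>p. Tag b (f p))"
    by (simp add: o_def)
  then show ?thesis
    using f smooth_rel_Tag[OF M, of b N N' "\<lambda>x. x" 1 f n] by (simp add: smooth_map_def)
qed

lemmas smooth_map_Tag_False = smooth_map_Tag[where b = False, simplified]
lemmas smooth_map_Tag_True = smooth_map_Tag[where b = True, simplified]

lemma smooth_map_case_tag:
  assumes "smooth_map n M P f" "smooth_map n N P g"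
  shows "smooth_map n (sum_mfd n M N) P (case_tag f g)"
proof -
  have s: "smooth_map n (side b M N) P (\<lambda>p. case_tag f g (Tag b p))" for b
    using assms by (cases b) auto
  show ?thesis
    unfolding smooth_map_def space_sum_mfd
    by (intro conjI continuous_map_from_sum_space smooth_rel_from_sum)
      (use s in \<open>auto simp: smooth_map_def space_side\<close>)
qed

lemma smooth_map_empty: "smooth_map n empty_mfd N f"
  by (simp add: smooth_map_def smooth_rel_def empty_mfd_def)

text \<open>Lets a diffeomorphism be given together with an explicit inverse; on \<open>N\<close>
  this inverse coincides with the \<open>inv_into\<close> that occurs in
  \<open>oriented_diffeo\<close>.\<close>

lemma oriented_diffeoI:
  assumes M: "manifold n M" "manifold n N" and f: "smooth_map n M N f" and g: "smooth_map n N M g"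
    and gf: "\<And>p. p \<in> points M \<Longrightarrow> g (f p) = p" and fg: "\<And>q. q \<in> points N \<Longrightarrow> f (g q) = q"
  shows "oriented_diffeo n M N (\<lambda>p\<in>points M. f p)"
proof -
  let ?f = "\<lambda>p\<in>points M. f p"
  have "homeomorphic_maps (mfd.space M) (mfd.space N) f g"
    using f g gf fg by (simp add: homeomorphic_maps_def smooth_map_def)
  then have "homeomorphic_map (mfd.space M) (mfd.space N) f"
    by (simp add: homeomorphic_maps_map)
  then have h: "homeomorphic_map (mfd.space M) (mfd.space N) ?f"
    by (rule homeomorphic_map_eq) simp
  have inv: "g q = inv_into (points M) ?f q" if "q \<in> points N" for q
  proof -
    have "g q \<in> points M" "?f (g q) = q"
      using smooth_map_points[OF g that] fg[OF that] by auto
    moreover have "inj_on ?f (points M)"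
      by (rule homeomorphic_imp_injective_map[OF h])
    ultimately show ?thesis
      using inv_into_f_f[of ?f "points M" "g q"] by simp
  qed
  have "smooth_map n M N ?f"
    by (rule smooth_map_cong[OF manifold_charted[OF M(1)] f]) simp
  moreover have "smooth_map n N M (inv_into (points M) ?f)"
    by (rule smooth_map_cong[OF manifold_charted[OF M(2)] g inv])
  ultimately show ?thesis
    using h by (simp add: oriented_diffeo_def oriented_smooth_conv smooth_map_def)
qed

lemma oriented_diffeoD:
  assumes "oriented_diffeo n M N f"
  shows "smooth_map n M N f" "smooth_map n N M (inv_into (points M) f)"
    "\<And>p. p \<in> points M \<Longrightarrow> inv_into (points M) f (f p) = p"
    "\<And>q. q \<in> points N \<Longrightarrow> f (inv_into (points M) f q) = q" "f ` points M = points N"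
proof -
  let ?g = "inv_into (points M) f"
  have h: "homeomorphic_map (mfd.space M) (mfd.space N) f"
    and s: "smooth_rel n M N (\<lambda>x. x) 1 f" "smooth_rel n N M (\<lambda>x. x) 1 ?g"
    using assms by (simp_all add: oriented_diffeo_def oriented_smooth_conv)
  have inj: "inj_on f (points M)" and surj: "f ` points M = points N"
    using homeomorphic_imp_injective_map[OF h] homeomorphic_imp_surjective_map[OF h] by auto
  show gf: "?g (f p) = p" if "p \<in> points M" for p
    using inj that by simp
  show fg: "f (?g q) = q" if "q \<in> points N" for q
    using that surj by (simp add: f_inv_into_f)
  show "f ` points M = points N"
    by (rule surj)
  obtain g where g: "homeomorphic_maps (mfd.space M) (mfd.space N) f g"
    using h unfolding homeomorphic_map_maps by blast
  have "g q = ?g q" if "q \<in> points N" for q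
    using g that gf surj by (force simp: homeomorphic_maps_def)
  then have "continuous_map (mfd.space N) (mfd.space M) ?g"
    using g by (auto simp: homeomorphic_maps_def intro: continuous_map_eq)
  then show "smooth_map n M N f" "smooth_map n N M ?g"
    using s homeomorphic_imp_continuous_map[OF h] by (auto simp: smooth_map_def)
qed

section \<open>Disjoint unions of \<open>X\<close>-manifolds\<close>

lemma sum_xman_fields [simp]:
  "und (sum_xman n M N) = sum_mfd n (und M) (und N)"
  "base (sum_xman n M N) = sum_set (base M) (base N)"
  "chi (sum_xman n M N) = case_tag (chi M) (chi N)"
  by (simp_all add: sum_xman_def)

lemma case_tag_extensional:
  assumes "f \<in> extensional A" "g \<in> extensional B"
  shows "case_tag f g \<in> extensional (sum_set A B)"
proof -
  have "case_tag f g w = undefined" if "w \<notin> sum_set A B" for w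
    using assms that by (cases w) (auto simp: extensional_def side_def split: if_splits)
  then show ?thesis
    by (auto simp: extensional_def)
qed

lemma x_manifoldD:
  "x_manifold n X x0 M \<Longrightarrow> manifold n (und M)"
  "x_manifold n X x0 M \<Longrightarrow> base M \<subseteq> xpoints M"
  by (simp_all add: x_manifold_def closed_manifold_def)

lemma x_manifold_sum:
  assumes M: "x_manifold n X x0 M" "x_manifold n X x0 N"
  shows "x_manifold n X x0 (sum_xman n M N)"
  unfolding x_manifold_def sum_xman_fields
proof (intro conjI ballI)
  show "closed_manifold n (sum_mfd n (und M) (und N))"
    using M by (simp add: x_manifold_def closed_manifold_def manifold_sum_mfd boundary_sum_mfd sum_set_def)
  show "sum_set (base M) (base N) \<subseteq> points (sum_mfd n (und M) (und N))"
    using M by (auto simp: x_manifold_def sum_set_def)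
  show "case_tag (chi M) (chi N) \<in> extensional (points (sum_mfd n (und M) (und N)))"
    using M by (simp add: x_manifold_def case_tag_extensional)
  show "continuous_map (mfd.space (sum_mfd n (und M) (und N))) X (case_tag (chi M) (chi N))"
    unfolding space_sum_mfd
  proof (rule continuous_map_from_sum_space)
    show "continuous_map (side b (mfd.space (und M)) (mfd.space (und N))) X (\<lambda>p. case_tag (chi M) (chi N) (Tag b p))" for b
      using M by (cases b) (simp_all add: x_manifold_def)
  qed
  show "case_tag (chi M) (chi N) w = x0" if "w \<in> sum_set (base M) (base N)" for w
    using M that by (auto elim!: sum_setE simp: x_manifold_def side_def split: if_splits)
  fix C assume "C \<in> connected_components_of (mfd.space (sum_mfd n (und M) (und N)))"
  then obtain b C' where C: "C = Tag b ` C'" "C' \<in> connected_components_of (side b (mfd.space (und M)) (mfd.space (und N)))"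
    by (auto elim: connected_components_of_sum_space)
  then have "\<exists>!p. p \<in> side b (base M) (base N) \<inter> C'"
    using M by (cases b) (auto simp: x_manifold_def)
  then obtain p where p: "p \<in> side b (base M) (base N)" "p \<in> C'"
    and uniq: "\<And>q. q \<in> side b (base M) (base N) \<Longrightarrow> q \<in> C' \<Longrightarrow> q = p"
    by (auto simp only: Ex1_def Int_iff)
  show "\<exists>!w. w \<in> sum_set (base M) (base N) \<inter> C"
  proof (rule ex1I[of _ "Tag b p"])
    show "Tag b p \<in> sum_set (base M) (base N) \<inter> C"
      using p by (simp add: C(1))
    fix w assume w: "w \<in> sum_set (base M) (base N) \<inter> C"
    then obtain q where "w = Tag b q" "q \<in> C'"
      unfolding C(1) by blast
    then show "w = Tag b p"
      using w uniq[of q] by simp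
  qed
qed

text \<open>The empty space has just the empty chart, with either sign, so its atlas of two elements
  is already maximal.\<close>

lemma manifold_empty: "manifold n empty_mfd"
  unfolding manifold_def
proof (intro conjI allI impI ballI)
  show "compact_space (mfd.space empty_mfd)" "Hausdorff_space (mfd.space empty_mfd)"
    by (simp_all add: empty_mfd_def compact_space_def Hausdorff_space_def)
  show "(\<Union>(U, \<phi>, s)\<in>atlas empty_mfd. U) = points empty_mfd"
    by (auto simp: empty_mfd_def)
  show "is_chart n (mfd.space empty_mfd) c" if "c \<in> atlas empty_mfd" for c :: "'p chart"
    using that empty_chart by (auto simp: empty_mfd_def)
  show "compatible n c d" if "c \<in> atlas empty_mfd" "d \<in> atlas empty_mfd" for c d :: "'p chart"
    using that by (auto simp: empty_mfd_def compatible_def)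
  fix c :: "'p chart"
  assume "is_chart n (mfd.space empty_mfd) c \<and> (\<forall>d\<in>atlas empty_mfd. compatible n c d)"
  moreover obtain U \<phi> s where c: "c = (U, \<phi>, s)"
    by (cases c)
  ultimately have U: "U \<subseteq> {}" "\<phi> \<in> extensional U" "s = 1 \<or> s = -1"
    using is_chartD[of n "mfd.space empty_mfd" U \<phi> s] by (auto simp: empty_mfd_def)
  then have "\<phi> = (\<lambda>_. undefined)"
    by (auto simp: extensional_def)
  then show "c \<in> atlas empty_mfd"
    using U by (auto simp: c empty_mfd_def)
qed

lemma points_empty [simp]: "points empty_mfd = {}"
  by (simp add: empty_mfd_def)

lemma boundary_empty [simp]: "boundary n empty_mfd = {}"
  by (auto simp: boundary_def empty_mfd_def)

lemma x_manifold_empty: "x_manifold n X x0 empty_xman"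
proof -
  have "continuous_map (mfd.space empty_mfd) X (\<lambda>_. undefined)"
    by (simp add: empty_mfd_def)
  then show ?thesis
    unfolding x_manifold_def closed_manifold_def
    by (simp add: manifold_empty empty_xman_def connected_components_of_def)
qed

section \<open>\<open>X\<close>-diffeomorphisms\<close>

lemma Diff_operations:
  "idt (Diff n X x0) M = (M, M, \<lambda>p\<in>xpoints M. p)"
  "(M, N, f) \<cdot>\<^bsub>Diff n X x0\<^esub> (N', P, g) = (M, P, \<lambda>p\<in>xpoints M. g (f p))"
  "tena (Diff n X x0) (M, N, f) (M', N', g) = (sum_xman n M M', sum_xman n N N',
     \<lambda>p\<in>xpoints (sum_xman n M M'). case_tag (\<lambda>q. Tag False (f q)) (\<lambda>q. Tag True (g q)) p)"
  "assoc (Diff n X x0) L M N = (sum_xman n (sum_xman n L M) N, sum_xman n L (sum_xman n M N),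
     \<lambda>p\<in>xpoints (sum_xman n (sum_xman n L M) N).
       case_tag (case_tag (\<lambda>q. Tag False q) (\<lambda>q. Tag True (Tag False q))) (\<lambda>q. Tag True (Tag True q)) p)"
  "lunit (Diff n X x0) M = (sum_xman n empty_xman M, M, \<lambda>p\<in>xpoints (sum_xman n empty_xman M). un_tag p)"
  "runit (Diff n X x0) M = (sum_xman n M empty_xman, M, \<lambda>p\<in>xpoints (sum_xman n M empty_xman). un_tag p)"
  "symm (Diff n X x0) M N = (sum_xman n M N, sum_xman n N M,
     \<lambda>p\<in>xpoints (sum_xman n M N). case_tag (\<lambda>q. Tag True q) (\<lambda>q. Tag False q) p)"
  by (simp_all add: Diff_def un_tag_def)

text \<open>The structural isomorphisms of \<open>Diff\<close> are verified through this rule: a map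
  and its inverse are built from tags and case distinctions, hence smooth, and the equations reduce
  to cases on tags.\<close>

lemma Diff_homI:
  assumes M: "x_manifold n X x0 M" "x_manifold n X x0 N"
    and f: "smooth_map n (und M) (und N) f" and g: "smooth_map n (und N) (und M) g"
    and gf: "\<And>p. p \<in> xpoints M \<Longrightarrow> g (f p) = p" and fg: "\<And>q. q \<in> xpoints N \<Longrightarrow> f (g q) = q"
    and b: "\<And>p. p \<in> base M \<Longrightarrow> f p \<in> base N" and chi: "\<And>p. p \<in> xpoints M \<Longrightarrow> chi N (f p) = chi M p"
  shows "(M, N, \<lambda>p\<in>xpoints M. f p) \<in> hom_arr (Diff n X x0) M N"
proof -
  have "oriented_diffeo n (und M) (und N) (\<lambda>p\<in>xpoints M. f p)"
    by (rule oriented_diffeoI[OF x_manifoldD(1)[OF M(1)] x_manifoldD(1)[OF M(2)] f g gf fg])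
  then show ?thesis
    using M b chi x_manifoldD(2)[OF M(1)] by (auto simp: hom_arr_def Diff_def x_diffeo_def)
qed

lemma Diff_homE:
  assumes "\<psi> \<in> hom_arr (Diff n X x0) M N"
  obtains f g where "\<psi> = (M, N, f)" "x_manifold n X x0 M" "x_manifold n X x0 N"
    "smooth_map n (und M) (und N) f" "smooth_map n (und N) (und M) g"
    "\<And>p. p \<in> xpoints M \<Longrightarrow> g (f p) = p" "\<And>q. q \<in> xpoints N \<Longrightarrow> f (g q) = q"
    "\<And>p. p \<in> base M \<Longrightarrow> f p \<in> base N" "\<And>p. p \<in> xpoints M \<Longrightarrow> chi N (f p) = chi M p"
proof -
  obtain f where f: "\<psi> = (M, N, f)" "x_manifold n X x0 M" "x_manifold n X x0 N" "x_diffeo n M N f"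
    using assms by (auto simp: hom_arr_def Diff_def)
  then have d: "oriented_diffeo n (und M) (und N) f"
    by (simp add: x_diffeo_def)
  show ?thesis
    using f oriented_diffeoD[OF d] by (intro that[of f "inv_into (xpoints M) f"]) (auto simp: x_diffeo_def)
qed

lemma Diff_idt: "x_manifold n X x0 M \<Longrightarrow> idt (Diff n X x0) M \<in> hom_arr (Diff n X x0) M M"
  unfolding Diff_operations
  by (rule Diff_homI[where g = "\<lambda>p. p"]) (simp_all add: smooth_map_id x_manifoldD)

lemma Diff_cmp:
  assumes "\<psi> \<in> hom_arr (Diff n X x0) M N" "\<xi> \<in> hom_arr (Diff n X x0) N P"
  shows "\<psi> \<cdot>\<^bsub>Diff n X x0\<^esub> \<xi> \<in> hom_arr (Diff n X x0) M P"
proof -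
  obtain f f' where f: "\<psi> = (M, N, f)" "x_manifold n X x0 M" "x_manifold n X x0 N"
    "smooth_map n (und M) (und N) f" "smooth_map n (und N) (und M) f'"
    "\<And>p. p \<in> xpoints M \<Longrightarrow> f' (f p) = p" "\<And>q. q \<in> xpoints N \<Longrightarrow> f (f' q) = q"
    "\<And>p. p \<in> base M \<Longrightarrow> f p \<in> base N" "\<And>p. p \<in> xpoints M \<Longrightarrow> chi N (f p) = chi M p"
    using assms(1) by (rule Diff_homE) blast
  obtain g g' where g: "\<xi> = (N, P, g)" "x_manifold n X x0 N" "x_manifold n X x0 P"
    "smooth_map n (und N) (und P) g" "smooth_map n (und P) (und N) g'"
    "\<And>p. p \<in> xpoints N \<Longrightarrow> g' (g p) = p" "\<And>q. q \<in> xpoints P \<Longrightarrow> g (g' q) = q"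
    "\<And>p. p \<in> base N \<Longrightarrow> g p \<in> base P" "\<And>p. p \<in> xpoints N \<Longrightarrow> chi P (g p) = chi N p"
    using assms(2) by (rule Diff_homE) blast
  note m = x_manifoldD(1)[OF f(2)] x_manifoldD(1)[OF f(3)] x_manifoldD(1)[OF g(3)]
  have "(M, P, \<lambda>p\<in>xpoints M. g (f p)) \<in> hom_arr (Diff n X x0) M P"
    by (rule Diff_homI[OF f(2) g(3) smooth_map_compose[OF m(1,2) f(4) g(4)] smooth_map_compose[OF m(3,2) g(5) f(5)]])
      (simp_all add: f g smooth_map_points[OF f(4)] smooth_map_points[OF g(5)])
  then show ?thesis
    by (simp only: f(1) g(1) Diff_operations)
qed

lemma Diff_tena:
  assumes "\<psi> \<in> hom_arr (Diff n X x0) M N" "\<xi> \<in> hom_arr (Diff n X x0) M' N'"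
  shows "tena (Diff n X x0) \<psi> \<xi> \<in> hom_arr (Diff n X x0) (sum_xman n M M') (sum_xman n N N')"
proof -
  obtain f f' where f: "\<psi> = (M, N, f)" "x_manifold n X x0 M" "x_manifold n X x0 N"
    "smooth_map n (und M) (und N) f" "smooth_map n (und N) (und M) f'"
    "\<And>p. p \<in> xpoints M \<Longrightarrow> f' (f p) = p" "\<And>q. q \<in> xpoints N \<Longrightarrow> f (f' q) = q"
    "\<And>p. p \<in> base M \<Longrightarrow> f p \<in> base N" "\<And>p. p \<in> xpoints M \<Longrightarrow> chi N (f p) = chi M p"
    using assms(1) by (rule Diff_homE) blast
  obtain g g' where g: "\<xi> = (M', N', g)" "x_manifold n X x0 M'" "x_manifold n X x0 N'"
    "smooth_map n (und M') (und N') g" "smooth_map n (und N') (und M') g'"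
    "\<And>p. p \<in> xpoints M' \<Longrightarrow> g' (g p) = p" "\<And>q. q \<in> xpoints N' \<Longrightarrow> g (g' q) = q"
    "\<And>p. p \<in> base M' \<Longrightarrow> g p \<in> base N'" "\<And>p. p \<in> xpoints M' \<Longrightarrow> chi N' (g p) = chi M' p"
    using assms(2) by (rule Diff_homE) blast
  note c = manifold_charted[OF x_manifoldD(1)[OF f(2)]] manifold_charted[OF x_manifoldD(1)[OF f(3)]]
    manifold_charted[OF x_manifoldD(1)[OF g(2)]] manifold_charted[OF x_manifoldD(1)[OF g(3)]]
  let ?t = "\<lambda>f g. case_tag (\<lambda>q. Tag False (f q)) (\<lambda>q. Tag True (g q))"
  have "(sum_xman n M M', sum_xman n N N', \<lambda>p\<in>xpoints (sum_xman n M M'). ?t f g p)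
      \<in> hom_arr (Diff n X x0) (sum_xman n M M') (sum_xman n N N')"
  proof (rule Diff_homI[OF x_manifold_sum[OF f(2) g(2)] x_manifold_sum[OF f(3) g(3)]])
    show "smooth_map n (und (sum_xman n M M')) (und (sum_xman n N N')) (?t f g)"
      "smooth_map n (und (sum_xman n N N')) (und (sum_xman n M M')) (?t f' g')"
      unfolding sum_xman_fields
      by (intro smooth_map_case_tag smooth_map_Tag_False smooth_map_Tag_True c f g)+
  qed (auto elim!: sum_setE simp: side_def f g split: if_splits)
  then show ?thesis
    by (simp only: f(1) g(1) Diff_operations)
qed

lemma Diff_assoc:
  assumes L: "x_manifold n X x0 L" and M: "x_manifold n X x0 M" and N: "x_manifold n X x0 N"
  shows "assoc (Diff n X x0) L M N \<in>
    hom_arr (Diff n X x0) (sum_xman n (sum_xman n L M) N) (sum_xman n L (sum_xman n M N))"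
proof -
  note m = x_manifoldD(1)[OF L] x_manifoldD(1)[OF M] x_manifoldD(1)[OF N]
  note s = smooth_map_case_tag smooth_map_Tag_False smooth_map_Tag_True smooth_map_id manifold_charted m
  let ?f = "case_tag (case_tag (\<lambda>q. Tag False q) (\<lambda>q. Tag True (Tag False q))) (\<lambda>q. Tag True (Tag True q))"
  let ?g = "case_tag (\<lambda>q. Tag False (Tag False q)) (case_tag (\<lambda>q. Tag False (Tag True q)) (\<lambda>q. Tag True q))"
  have "(sum_xman n (sum_xman n L M) N, sum_xman n L (sum_xman n M N), \<lambda>p\<in>xpoints (sum_xman n (sum_xman n L M) N). ?f p)
    \<in> hom_arr (Diff n X x0) (sum_xman n (sum_xman n L M) N) (sum_xman n L (sum_xman n M N))"
  proof (rule Diff_homI[where g = ?g])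
    show "smooth_map n (und (sum_xman n (sum_xman n L M) N)) (und (sum_xman n L (sum_xman n M N))) ?f"
      "smooth_map n (und (sum_xman n L (sum_xman n M N))) (und (sum_xman n (sum_xman n L M) N)) ?g"
      unfolding sum_xman_fields by (intro s)+
  qed (auto elim!: sum_setE simp: side_def x_manifold_sum assms split: if_splits)
  then show ?thesis
    by (simp only: Diff_operations)
qed

lemma Diff_lunit:
  assumes M: "x_manifold n X x0 M"
  shows "lunit (Diff n X x0) M \<in> hom_arr (Diff n X x0) (sum_xman n empty_xman M) M"
proof -
  let ?E = "sum_xman n empty_xman M"
  have E: "x_manifold n X x0 ?E"
    by (rule x_manifold_sum[OF x_manifold_empty M])
  have e: "und empty_xman = empty_mfd" "base empty_xman = {}"
    by (simp_all add: empty_xman_def)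
  note m = x_manifoldD(1)[OF M]
  have "(?E, M, \<lambda>p\<in>xpoints ?E. un_tag p) \<in> hom_arr (Diff n X x0) ?E M"
  proof (rule Diff_homI[OF E M, where g = "\<lambda>q. Tag True q"])
    \<comment> \<open>On the disjoint union \<open>un_tag\<close> agrees with this case distinction,
      whose first branch is smooth because its domain is empty.\<close>
    have "smooth_map n (und ?E) (und M) (case_tag (\<lambda>q. q) (\<lambda>q. q))"
      unfolding sum_xman_fields e by (intro smooth_map_case_tag smooth_map_empty smooth_map_id m)
    then show "smooth_map n (und ?E) (und M) un_tag"
      by (rule smooth_map_cong[OF manifold_charted[OF x_manifoldD(1)[OF E]]]) (auto elim!: sum_setE simp: side_def)
    show "smooth_map n (und M) (und ?E) (\<lambda>q. Tag True q)"
      unfolding sum_xman_fields by (intro smooth_map_Tag_True smooth_map_id manifold_charted m)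
  qed (auto elim!: sum_setE simp: e side_def split: if_splits)
  then show ?thesis
    by (simp only: Diff_operations)
qed

lemma Diff_runit:
  assumes M: "x_manifold n X x0 M"
  shows "runit (Diff n X x0) M \<in> hom_arr (Diff n X x0) (sum_xman n M empty_xman) M"
proof -
  let ?E = "sum_xman n M empty_xman"
  have E: "x_manifold n X x0 ?E"
    by (rule x_manifold_sum[OF M x_manifold_empty])
  have e: "und empty_xman = empty_mfd" "base empty_xman = {}"
    by (simp_all add: empty_xman_def)
  note m = x_manifoldD(1)[OF M]
  have "(?E, M, \<lambda>p\<in>xpoints ?E. un_tag p) \<in> hom_arr (Diff n X x0) ?E M"
  proof (rule Diff_homI[OF E M, where g = "\<lambda>q. Tag False q"])
    have "smooth_map n (und ?E) (und M) (case_tag (\<lambda>q. q) (\<lambda>q. q))"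
      unfolding sum_xman_fields e by (intro smooth_map_case_tag smooth_map_empty smooth_map_id m)
    then show "smooth_map n (und ?E) (und M) un_tag"
      by (rule smooth_map_cong[OF manifold_charted[OF x_manifoldD(1)[OF E]]]) (auto elim!: sum_setE simp: side_def)
    show "smooth_map n (und M) (und ?E) (\<lambda>q. Tag False q)"
      unfolding sum_xman_fields by (intro smooth_map_Tag_False smooth_map_id manifold_charted m)
  qed (auto elim!: sum_setE simp: e side_def split: if_splits)
  then show ?thesis
    by (simp only: Diff_operations)
qed

lemma Diff_symm:
  assumes M: "x_manifold n X x0 M" and N: "x_manifold n X x0 N"
  shows "symm (Diff n X x0) M N \<in> hom_arr (Diff n X x0) (sum_xman n M N) (sum_xman n N M)"
proof -
  note m = x_manifoldD(1)[OF M] x_manifoldD(1)[OF N]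
  let ?f = "case_tag (\<lambda>q. Tag True q) (\<lambda>q. Tag False q)"
  have "(sum_xman n M N, sum_xman n N M, \<lambda>p\<in>xpoints (sum_xman n M N). ?f p)
    \<in> hom_arr (Diff n X x0) (sum_xman n M N) (sum_xman n N M)"
  proof (rule Diff_homI[where g = ?f])
    show "smooth_map n (und (sum_xman n M N)) (und (sum_xman n N M)) ?f"
      "smooth_map n (und (sum_xman n N M)) (und (sum_xman n M N)) ?f"
      unfolding sum_xman_fields
      by (intro smooth_map_case_tag smooth_map_Tag_False smooth_map_Tag_True smooth_map_id manifold_charted m)+
  qed (auto elim!: sum_setE simp: side_def x_manifold_sum assms split: if_splits)
  then show ?thesis
    by (simp only: Diff_operations)
qed

section \<open>Disjoint unions of cobordisms\<close>

lemma boundary_embedding_conv: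
  "boundary_embedding n M W i \<sigma> \<longleftrightarrow>
     i \<in> extensional (points M) \<and> embedding_map (mfd.space M) (mfd.space W) i \<and>
     i ` points M \<subseteq> boundary (Suc n) W \<and> smooth_rel n M W (\<lambda>v k. v (Suc k)) \<sigma> i"
  by (simp add: boundary_embedding_def smooth_rel_def)

text \<open>The domain is compact and the target Hausdorff, so a continuous injection is closed and
  therefore an embedding. This avoids the construction of an inverse on the image.\<close>

lemma boundary_embedding_sum:
  assumes M: "manifold n M" "manifold n N" and W: "manifold (Suc n) W" "manifold (Suc n) V"
    and i: "boundary_embedding n M W i \<sigma>" and j: "boundary_embedding n N V j \<sigma>"
  shows "boundary_embedding n (sum_mfd n M N) (sum_mfd (Suc n) W V)
    (\<lambda>p\<in>points (sum_mfd n M N). case_tag (\<lambda>q. Tag False (i q)) (\<lambda>q. Tag True (j q)) p) \<sigma>"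
proof -
  let ?S = "sum_mfd n M N" and ?T = "sum_mfd (Suc n) W V"
  let ?f = "case_tag (\<lambda>q. Tag False (i q)) (\<lambda>q. Tag True (j q))"
  let ?g = "\<lambda>p\<in>points ?S. ?f p"
  have f_Tag: "?f (Tag b p) = Tag b (side b i j p)" for b p
    by (cases b) auto
  have e: "embedding_map (mfd.space (side b M N)) (mfd.space (side b W V)) (side b i j)"
    and sm: "smooth_rel n (side b M N) (side b W V) (\<lambda>v k. v (Suc k)) \<sigma> (side b i j)"
    and bd: "side b i j ` points (side b M N) \<subseteq> boundary (Suc n) (side b W V)" for b
    using i j by (cases b; simp add: boundary_embedding_conv)+
  have inj: "inj_on (side b i j) (points (side b M N))"
    and cont: "continuous_map (mfd.space (side b M N)) (mfd.space (side b W V)) (side b i j)" for b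
    using homeomorphic_imp_injective_map[OF e[of b, unfolded embedding_map_def]]
      continuous_map_into_fulltopology[OF homeomorphic_imp_continuous_map[OF e[of b, unfolded embedding_map_def]]]
    by auto
  have "continuous_map (mfd.space ?S) (mfd.space ?T) ?f"
    unfolding space_sum_mfd
  proof (rule continuous_map_from_sum_space)
    fix b
    have "continuous_map (side b (mfd.space M) (mfd.space N)) (side b (mfd.space W) (mfd.space V)) (side b i j)"
      using cont[of b] by (simp add: space_side)
    from continuous_map_compose[OF this continuous_map_Tag]
    show "continuous_map (side b (mfd.space M) (mfd.space N)) (sum_space (mfd.space W) (mfd.space V)) (\<lambda>p. ?f (Tag b p))"
      unfolding f_Tag by (simp add: o_def)
  qed
  then have cont_g: "continuous_map (mfd.space ?S) (mfd.space ?T) ?g"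
    by (rule continuous_map_eq) simp
  have "inj_on ?f (points ?S)"
  proof (rule inj_onI)
    fix v w assume vw: "v \<in> points ?S" "w \<in> points ?S" "?f v = ?f w"
    then obtain b p c q where "v = Tag b p" "p \<in> points (side b M N)" "w = Tag c q" "q \<in> points (side c M N)"
      by (auto elim!: sum_setE simp: points_side)
    then show "v = w"
      using vw(3) inj[of b] unfolding f_Tag by (simp only: f_Tag) (auto dest: inj_onD)
  qed
  then have inj_g: "inj_on ?g (topspace (mfd.space ?S))"
    by (simp add: inj_on_def)
  have "closed_map (mfd.space ?S) (mfd.space ?T) ?g"
    using cont_g manifoldD(1)[OF manifold_sum_mfd[OF M]] manifoldD(2)[OF manifold_sum_mfd[OF W]]
    by (intro continuous_imp_closed_map)
  then have emb: "embedding_map (mfd.space ?S) (mfd.space ?T) ?g"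
    using cont_g inj_g by (intro injective_closed_imp_embedding_map)
  have "smooth_rel n ?S ?T (\<lambda>v k. v (Suc k)) \<sigma> ?f"
    by (rule smooth_rel_from_sum) (simp only: f_Tag smooth_rel_Tag[OF manifold_charted[OF manifold_side[OF M]] sm])
  then have "smooth_rel n ?S ?T (\<lambda>v k. v (Suc k)) \<sigma> ?g"
    by (rule smooth_rel_cong[OF manifold_charted[OF manifold_sum_mfd[OF M]]]) simp
  moreover have "?g ` points ?S \<subseteq> boundary (Suc n) ?T"
    unfolding boundary_sum_mfd[OF W]
  proof (clarify)
    fix w assume w: "w \<in> points ?S"
    then obtain b p where p: "w = Tag b p" "p \<in> points (side b M N)"
      by (auto elim!: sum_setE simp: points_side)
    then have "side b i j p \<in> side b (boundary (Suc n) W) (boundary (Suc n) V)"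
      using bd[of b] by (cases b) auto
    then have "?f w \<in> sum_set (boundary (Suc n) W) (boundary (Suc n) V)"
      unfolding p(1) f_Tag by simp
    then show "?g w \<in> sum_set (boundary (Suc n) W) (boundary (Suc n) V)"
      using w by simp
  qed
  ultimately show ?thesis
    using emb by (simp only: boundary_embedding_conv restrict_extensional simp_thms)
qed

section \<open>Relative homotopy classes on a disjoint union\<close>

text \<open>Since \<open>B\<close> lies in the space, the condition on the intermediate maps depends
  only on their values there; this is the side condition of \<open>homotopic_with\<close>.\<close>

lemma homotopic_rel_iff:
  assumes "B \<subseteq> topspace T"
  shows "homotopic_with (\<lambda>l. \<forall>p\<in>B. l p = f p) T X f k \<longleftrightarrow>
    (\<exists>h. continuous_map (prod_topology (top_of_set {0..1::real}) T) X h \<and>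
       (\<forall>x\<in>topspace T. h (0, x) = f x) \<and> (\<forall>x\<in>topspace T. h (1, x) = k x) \<and>
       (\<forall>t\<in>{0..1}. \<forall>p\<in>B. h (t, p) = f p))"
  using assms by (intro homotopic_with) (metis subsetD)

text \<open>A homotopy on a disjoint union is a pair of homotopies: one direction restricts along
  \<open>Tag b\<close>, the other joins by \<open>continuous_map_prod_sum_space\<close>.\<close>

lemma homotopic_rel_sum:
  assumes B: "B \<subseteq> topspace S" "B' \<subseteq> topspace T"
  shows "homotopic_with (\<lambda>l. \<forall>p\<in>sum_set B B'. l p = case_tag f g p) (sum_space S T) X (case_tag f g) k \<longleftrightarrow>
    homotopic_with (\<lambda>l. \<forall>p\<in>B. l p = f p) S X f (\<lambda>p. k (Tag False p)) \<and>
    homotopic_with (\<lambda>l. \<forall>p\<in>B'. l p = g p) T X g (\<lambda>p. k (Tag True p))" (is "?L \<longleftrightarrow> ?R")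
proof -
  let ?I = "top_of_set {0..1::real}"
  have BB: "sum_set B B' \<subseteq> topspace (sum_space S T)"
    using B by (auto simp: sum_set_def)
  have Bb: "side b B B' \<subseteq> topspace (side b S T)" for b
    using B by (cases b) auto
  have R: "?R \<longleftrightarrow> (\<forall>b. homotopic_with (\<lambda>l. \<forall>p\<in>side b B B'. l p = side b f g p) (side b S T) X (side b f g) (\<lambda>p. k (Tag b p)))"
    by (simp add: all_bool_eq conj_commute)
  show ?thesis
    unfolding R homotopic_rel_iff[OF BB] homotopic_rel_iff[OF Bb]
  proof (intro iffI allI)
    fix b
    assume "\<exists>h. continuous_map (prod_topology ?I (sum_space S T)) X h \<and>
       (\<forall>x\<in>topspace (sum_space S T). h (0, x) = case_tag f g x) \<and> (\<forall>x\<in>topspace (sum_space S T). h (1, x) = k x) \<and>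
       (\<forall>t\<in>{0..1}. \<forall>p\<in>sum_set B B'. h (t, p) = case_tag f g p)"
    then obtain h where h: "continuous_map (prod_topology ?I (sum_space S T)) X h"
       "\<And>x. x\<in>sum_set (topspace S) (topspace T) \<Longrightarrow> h (0, x) = case_tag f g x"
       "\<And>x. x\<in>sum_set (topspace S) (topspace T) \<Longrightarrow> h (1, x) = k x"
       "\<And>t p. t\<in>{0..1} \<Longrightarrow> p\<in>sum_set B B' \<Longrightarrow> h (t, p) = case_tag f g p"
      by auto
    have "continuous_map (prod_topology ?I (side b S T)) (sum_space S T) (\<lambda>z. Tag b (snd z))"
      using continuous_map_compose[OF continuous_map_snd continuous_map_Tag] by (simp add: o_def)
    then have "continuous_map (prod_topology ?I (side b S T)) (prod_topology ?I (sum_space S T)) (\<lambda>z. (fst z, Tag b (snd z)))"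
      by (intro continuous_map_pairedI continuous_map_fst)
    from continuous_map_compose[OF this h(1)]
    have "continuous_map (prod_topology ?I (side b S T)) X (\<lambda>z. h (fst z, Tag b (snd z)))"
      by (simp add: o_def)
    then show "\<exists>h. continuous_map (prod_topology ?I (side b S T)) X h \<and>
       (\<forall>x\<in>topspace (side b S T). h (0, x) = side b f g x) \<and> (\<forall>x\<in>topspace (side b S T). h (1, x) = k (Tag b x)) \<and>
       (\<forall>t\<in>{0..1}. \<forall>p\<in>side b B B'. h (t, p) = side b f g p)"
      by (intro exI[of _ "\<lambda>z. h (fst z, Tag b (snd z))"]) (simp add: h topspace_side)
  next
    assume "\<forall>b. \<exists>h. continuous_map (prod_topology ?I (side b S T)) X h \<and>
       (\<forall>x\<in>topspace (side b S T). h (0, x) = side b f g x) \<and> (\<forall>x\<in>topspace (side b S T). h (1, x) = k (Tag b x)) \<and>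
       (\<forall>t\<in>{0..1}. \<forall>p\<in>side b B B'. h (t, p) = side b f g p)"
    then obtain h where h: "\<And>b. continuous_map (prod_topology ?I (side b S T)) X (h b)"
       "\<And>b x. x\<in>topspace (side b S T) \<Longrightarrow> h b (0, x) = side b f g x"
       "\<And>b x. x\<in>topspace (side b S T) \<Longrightarrow> h b (1, x) = k (Tag b x)"
       "\<And>b t p. t\<in>{0..1} \<Longrightarrow> p\<in>side b B B' \<Longrightarrow> h b (t, p) = side b f g p"
      by metis
    let ?h = "\<lambda>(t, w). h (fst (untag w)) (t, un_tag w)"
    have "continuous_map (prod_topology ?I (sum_space S T)) X ?h"
      by (rule continuous_map_prod_sum_space) (simp add: h(1))
    then show "\<exists>h. continuous_map (prod_topology ?I (sum_space S T)) X h \<and>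
       (\<forall>x\<in>topspace (sum_space S T). h (0, x) = case_tag f g x) \<and> (\<forall>x\<in>topspace (sum_space S T). h (1, x) = k x) \<and>
       (\<forall>t\<in>{0..1}. \<forall>p\<in>sum_set B B'. h (t, p) = case_tag f g p)"
      by (intro exI[of _ ?h]) (auto elim!: sum_setE simp: h topspace_side)
  qed
qed

text \<open>Shows that the field \<open>hcl\<close> of \<open>sum_xcob\<close>, formed from pairs of
  maps, is again one homotopy class relative to the boundary.\<close>

lemma rel_homotopy_class_sum:
  assumes B: "B \<subseteq> topspace S" "B' \<subseteq> topspace T"
  shows "rel_homotopy_class (sum_space S T) (sum_set B B') X (case_tag f g) =
    {case_tag h k | h k. h \<in> rel_homotopy_class S B X f \<and> k \<in> rel_homotopy_class T B' X g}" (is "?L = ?R")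
proof (intro equalityI subsetI)
  fix l assume l: "l \<in> ?L"
  let ?h = "\<lambda>b p. l (Tag b p)"
  have ext: "l \<in> extensional (sum_set (topspace S) (topspace T))"
    using l by (simp add: rel_homotopy_class_def)
  then have "?h False \<in> extensional (topspace S)" "?h True \<in> extensional (topspace T)"
    by (auto simp: extensional_def)
  moreover have "l = case_tag (?h False) (?h True)"
  proof
    fix w show "l w = case_tag (?h False) (?h True) w"
    proof (cases w)
      case (Tag b p)
      then show ?thesis by (cases b) auto
    qed (use ext in \<open>auto simp: extensional_def sum_set_def image_iff\<close>)
  qed
  ultimately show "l \<in> ?R"
    using l by (auto simp: rel_homotopy_class_def homotopic_rel_sum[OF B])
next
  fix l assume "l \<in> ?R"
  then show "l \<in> ?L"
    by (auto simp: rel_homotopy_class_def homotopic_rel_sum[OF B] case_tag_extensional)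
qed

lemma sum_set_Int: "sum_set A B \<inter> sum_set A' B' = sum_set (A \<inter> A') (B \<inter> B')"
  by (auto simp: sum_set_def)

lemma sum_set_Un: "sum_set A B \<union> sum_set A' B' = sum_set (A \<union> A') (B \<union> B')"
  by (auto simp: sum_set_def)

text \<open>Makes the right-hand side of the relation \<open>ten_cob\<close> a well-typed
  term.\<close>

lemma x_cobordism_sum:
  fixes W V :: "('u, 'x) xcob"
  assumes W: "x_cobordism n X x0 W" and V: "x_cobordism n X x0 V"
  shows "x_cobordism n X x0 (sum_xcob n W V)"
proof -
  let ?S = "sum_xcob n W V"
  let ?t = "\<lambda>f g. case_tag (\<lambda>q. Tag False (f q)) (\<lambda>q. Tag True (g q))"
  have fields: "src ?S = sum_xman n (src W) (src V)" "tgt ?S = sum_xman n (tgt W) (tgt V)"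
    "body ?S = sum_mfd (Suc n) (body W) (body V)"
    "inc ?S = (\<lambda>p\<in>xpoints (sum_xman n (src W) (src V)). ?t (inc W) (inc V) p)"
    "out ?S = (\<lambda>p\<in>xpoints (sum_xman n (tgt W) (tgt V)). ?t (out W) (out V) p)"
    "hcl ?S = {case_tag f g | f g. f \<in> hcl W \<and> g \<in> hcl V}"
    by (simp_all add: sum_xcob_def)
  have x: "x_manifold n X x0 (src W)" "x_manifold n X x0 (src V)" "x_manifold n X x0 (tgt W)" "x_manifold n X x0 (tgt V)"
    and m: "manifold (Suc n) (body W)" "manifold (Suc n) (body V)"
    using W V by (simp_all add: x_cobordism_def)
  have bdW: "inc W ` xpoints (src W) \<inter> out W ` xpoints (tgt W) = {}"
      "inc W ` xpoints (src W) \<union> out W ` xpoints (tgt W) = boundary (Suc n) (body W)"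
    and bdV: "inc V ` xpoints (src V) \<inter> out V ` xpoints (tgt V) = {}"
      "inc V ` xpoints (src V) \<union> out V ` xpoints (tgt V) = boundary (Suc n) (body V)"
    using W V by (simp_all add: x_cobordism_def)
  note bs = boundary_embedding_sum[OF _ _ m]
  have img: "(\<lambda>p\<in>sum_set A B. ?t f g p) ` sum_set A B = sum_set (f ` A) (g ` B)" for A B and f g :: "'u pt \<Rightarrow> 'u pt"
  proof -
    have "(\<lambda>p\<in>sum_set A B. ?t f g p) ` sum_set A B = ?t f g ` sum_set A B"
      by (rule image_cong) simp_all
    then show ?thesis
      by (simp add: sum_set_def image_Un image_image)
  qed
  have cls: "\<exists>f. f \<in> extensional (wpoints Z) \<and> continuous_map (mfd.space (body Z)) X f \<and>
      (\<forall>q\<in>xpoints (src Z). f (inc Z q) = chi (src Z) q) \<and> (\<forall>q\<in>xpoints (tgt Z). f (out Z q) = chi (tgt Z) q) \<and>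
      hcl Z = rel_homotopy_class (mfd.space (body Z)) (boundary (Suc n) (body Z)) X f"
    if "x_cobordism n X x0 Z" for Z :: "('u, 'x) xcob"
    using that unfolding x_cobordism_def by (elim conjE)
  obtain f where f: "f \<in> extensional (wpoints W)" "continuous_map (mfd.space (body W)) X f"
    "\<And>q. q\<in>xpoints (src W) \<Longrightarrow> f (inc W q) = chi (src W) q" "\<And>q. q\<in>xpoints (tgt W) \<Longrightarrow> f (out W q) = chi (tgt W) q"
    "hcl W = rel_homotopy_class (mfd.space (body W)) (boundary (Suc n) (body W)) X f"
    using cls[OF W] by blast
  obtain g where g: "g \<in> extensional (wpoints V)" "continuous_map (mfd.space (body V)) X g"
    "\<And>q. q\<in>xpoints (src V) \<Longrightarrow> g (inc V q) = chi (src V) q" "\<And>q. q\<in>xpoints (tgt V) \<Longrightarrow> g (out V q) = chi (tgt V) q"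
    "hcl V = rel_homotopy_class (mfd.space (body V)) (boundary (Suc n) (body V)) X g"
    using cls[OF V] by blast
  have bd: "boundary (Suc n) (body W) \<subseteq> wpoints W" "boundary (Suc n) (body V) \<subseteq> wpoints V"
    using manifoldD(3)[OF m(1)] manifoldD(3)[OF m(2)] by (auto simp: boundary_def)
  show ?thesis
    unfolding x_cobordism_def
  proof (intro conjI)
    show "x_manifold n X x0 (src ?S)" "x_manifold n X x0 (tgt ?S)"
      by (simp_all add: fields x_manifold_sum x)
    show "manifold (Suc n) (body ?S)"
      by (simp add: fields manifold_sum_mfd m)
    show "boundary_embedding n (und (src ?S)) (body ?S) (inc ?S) (- 1)"
      "boundary_embedding n (und (tgt ?S)) (body ?S) (out ?S) 1"
      unfolding fields sum_xman_fields
      by (intro bs x_manifoldD(1)[OF x(1)] x_manifoldD(1)[OF x(2)] x_manifoldD(1)[OF x(3)] x_manifoldD(1)[OF x(4)];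
          use W V in \<open>simp add: x_cobordism_def\<close>)+
    show "inc ?S ` xpoints (src ?S) \<inter> out ?S ` xpoints (tgt ?S) = {}"
      "inc ?S ` xpoints (src ?S) \<union> out ?S ` xpoints (tgt ?S) = boundary (Suc n) (body ?S)"
      using bdW bdV unfolding fields sum_xman_fields space_sum_mfd topspace_sum_space img boundary_sum_mfd[OF m]
        sum_set_Int sum_set_Un by (simp_all add: sum_set_def)
    show "\<exists>h. h \<in> extensional (wpoints ?S) \<and> continuous_map (mfd.space (body ?S)) X h \<and>
          (\<forall>q\<in>xpoints (src ?S). h (inc ?S q) = chi (src ?S) q) \<and>
          (\<forall>q\<in>xpoints (tgt ?S). h (out ?S q) = chi (tgt ?S) q) \<and>
          hcl ?S = rel_homotopy_class (mfd.space (body ?S)) (boundary (Suc n) (body ?S)) X h"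
    proof (intro exI[of _ "case_tag f g"] conjI)
      show "case_tag f g \<in> extensional (wpoints ?S)"
        using f g by (simp add: fields case_tag_extensional)
      show "continuous_map (mfd.space (body ?S)) X (case_tag f g)"
        unfolding fields space_sum_mfd
      proof (rule continuous_map_from_sum_space)
        show "continuous_map (side b (mfd.space (body W)) (mfd.space (body V))) X (\<lambda>p. case_tag f g (Tag b p))" for b
          using f g by (cases b) simp_all
      qed
      show "\<forall>q\<in>xpoints (src ?S). case_tag f g (inc ?S q) = chi (src ?S) q"
        "\<forall>q\<in>xpoints (tgt ?S). case_tag f g (out ?S q) = chi (tgt ?S) q"
        using f g by (auto elim!: sum_setE simp: fields side_def split: if_splits)
      show "hcl ?S = rel_homotopy_class (mfd.space (body ?S)) (boundary (Suc n) (body ?S)) X (case_tag f g)"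
        unfolding fields space_sum_mfd boundary_sum_mfd[OF m] rel_homotopy_class_sum[OF bd] f(5) g(5) ..
    qed
  qed
qed

lemma boundary_embedding_empty: "boundary_embedding n empty_mfd empty_mfd (\<lambda>_. undefined) \<sigma>"
proof -
  have "smooth_rel n empty_mfd empty_mfd (\<lambda>v k. v (Suc k)) \<sigma> (\<lambda>_. undefined)"
    by (simp add: smooth_rel_def empty_mfd_def)
  moreover have "embedding_map (mfd.space empty_mfd) (mfd.space empty_mfd) (\<lambda>_. undefined)"
    by (simp add: empty_mfd_def embedding_map_def homeomorphic_map_def quotient_map_def)
  ultimately show ?thesis
    by (simp add: boundary_embedding_conv)
qed

text \<open>The empty set carries one topology and one extensional map. So the pullback topology of
  the cylinder is the discrete one, and the homotopy class has a single element, as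
  \<open>empty_xcob\<close> prescribes.\<close>

lemma empty_xcob_is_cylinder:
  fixes X :: "'x topology"
  shows "is_cylinder n X x0 (empty_xman :: ('u, 'x) xman) empty_xcob"
proof -
  have fields: "src empty_xcob = empty_xman" "tgt empty_xcob = empty_xman" "body empty_xcob = empty_mfd"
    "inc empty_xcob = (\<lambda>_. undefined)" "out empty_xcob = (\<lambda>_. undefined)" "hcl empty_xcob = {\<lambda>_. undefined}"
    "und empty_xman = empty_mfd"
    by (simp_all add: empty_xcob_def empty_xman_def)
  have sp: "mfd.space empty_mfd = discrete_topology {}"
    by (simp add: empty_mfd_def)
  have "rel_homotopy_class (discrete_topology {} :: 'u pt topology) {} X (\<lambda>_. undefined) = {\<lambda>_. undefined}"
    by (auto simp: rel_homotopy_class_def extensional_def)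
  then have "x_cobordism n X x0 (empty_xcob :: ('u, 'x) xcob)"
    unfolding x_cobordism_def fields
    by (simp add: x_manifold_empty manifold_empty boundary_embedding_empty sp)
  moreover have "discrete_topology {} = pullback_topology {} unat T" for T :: "(real \<times> 'u pt) topology"
    by (auto simp: topology_eq openin_pullback_topology)
  moreover have "(\<lambda>w\<in>{}. f w) = (\<lambda>_. undefined)" for f :: "'c \<Rightarrow> 'd"
    by (simp add: restrict_def)
  ultimately show ?thesis
    unfolding is_cylinder_def fields by (auto simp: sp) (auto simp: empty_mfd_def)
qed

section \<open>Tensor products of modules\<close>

definition pure_tensor :: "'r ring \<Rightarrow> ('r, 'm) rmod \<Rightarrow> ('r, 'm) rmod \<Rightarrow> ('r, 'm) elt \<Rightarrow> ('r, 'm) elt \<Rightarrow> ('r, 'm) elt"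
  where "pure_tensor R M N m y = tensor_sum R M N [(m, y)]"

definition bilinear_map :: "'r ring \<Rightarrow> ('r, 'e) module \<Rightarrow> ('r, 'e) module \<Rightarrow> ('r, 'e) module \<Rightarrow> ('e \<Rightarrow> 'e \<Rightarrow> 'e) \<Rightarrow> bool"
  where "bilinear_map R M N P \<beta> \<longleftrightarrow>
    (\<forall>m\<in>carrier M. \<forall>y\<in>carrier N. \<beta> m y \<in> carrier P) \<and>
    (\<forall>m\<in>carrier M. \<forall>m'\<in>carrier M. \<forall>y\<in>carrier N. \<beta> (m \<oplus>\<^bsub>M\<^esub> m') y = \<beta> m y \<oplus>\<^bsub>P\<^esub> \<beta> m' y) \<and>
    (\<forall>m\<in>carrier M. \<forall>y\<in>carrier N. \<forall>y'\<in>carrier N. \<beta> m (y \<oplus>\<^bsub>N\<^esub> y') = \<beta> m y \<oplus>\<^bsub>P\<^esub> \<beta> m y') \<and>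
    (\<forall>r\<in>carrier R. \<forall>m\<in>carrier M. \<forall>y\<in>carrier N. \<beta> (r \<odot>\<^bsub>M\<^esub> m) y = r \<odot>\<^bsub>P\<^esub> \<beta> m y) \<and>
    (\<forall>r\<in>carrier R. \<forall>m\<in>carrier M. \<forall>y\<in>carrier N. \<beta> m (r \<odot>\<^bsub>N\<^esub> y) = r \<odot>\<^bsub>P\<^esub> \<beta> m y)"

definition bilinear_sum :: "('r, 'e) module \<Rightarrow> ('e \<Rightarrow> 'e \<Rightarrow> 'e) \<Rightarrow> ('e \<times> 'e) list \<Rightarrow> 'e" where
  "bilinear_sum P \<beta> xs = foldr (\<lambda>(m, y) a. \<beta> m y \<oplus>\<^bsub>P\<^esub> a) xs \<zero>\<^bsub>P\<^esub>"

text \<open>The common shape of the structure maps of \<open>FMod\<close>: evaluation on the chosen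
  representative of an element. For bilinear \<open>\<beta>\<close> it is the linear map given by
  the universal property of the tensor product.\<close>

definition tensor_lift :: "'r ring \<Rightarrow> ('r, 'm) rmod \<Rightarrow> ('r, 'm) rmod \<Rightarrow> ('r, 'm) rmod \<Rightarrow>
    (('r, 'm) elt \<Rightarrow> ('r, 'm) elt \<Rightarrow> ('r, 'm) elt) \<Rightarrow> ('r, 'm) elt \<Rightarrow> ('r, 'm) elt" where
  "tensor_lift R M N P \<beta> = (\<lambda>x\<in>carrier (tensor_module R M N). bilinear_sum P \<beta> (ten x))"

lemma linear_mapsD:
  assumes "f \<in> linear_maps R M N"
  shows "x \<in> carrier M \<Longrightarrow> f x \<in> carrier N"
    and "x \<in> carrier M \<Longrightarrow> y \<in> carrier M \<Longrightarrow> f (x \<oplus>\<^bsub>M\<^esub> y) = f x \<oplus>\<^bsub>N\<^esub> f y"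
    and "r \<in> carrier R \<Longrightarrow> x \<in> carrier M \<Longrightarrow> f (r \<odot>\<^bsub>M\<^esub> x) = r \<odot>\<^bsub>N\<^esub> f x"
    and "f \<in> extensional (carrier M)"
  using assms by (auto simp: linear_maps_def PiE_def)

lemma linear_mapsI:
  assumes "\<And>x. x \<in> carrier M \<Longrightarrow> f x \<in> carrier N"
    and "\<And>x y. x \<in> carrier M \<Longrightarrow> y \<in> carrier M \<Longrightarrow> f (x \<oplus>\<^bsub>M\<^esub> y) = f x \<oplus>\<^bsub>N\<^esub> f y"
    and "\<And>r x. r \<in> carrier R \<Longrightarrow> x \<in> carrier M \<Longrightarrow> f (r \<odot>\<^bsub>M\<^esub> x) = r \<odot>\<^bsub>N\<^esub> f x"
    and "f \<in> extensional (carrier M)"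
  shows "f \<in> linear_maps R M N"
  using assms by (auto simp: linear_maps_def PiE_def)

lemma additive_zero:
  assumes M: "module R M" and P: "module R P"
    and f: "\<And>x. x \<in> carrier M \<Longrightarrow> f x \<in> carrier P"
      "\<And>x y. x \<in> carrier M \<Longrightarrow> y \<in> carrier M \<Longrightarrow> f (x \<oplus>\<^bsub>M\<^esub> y) = f x \<oplus>\<^bsub>P\<^esub> f y"
  shows "f \<zero>\<^bsub>M\<^esub> = \<zero>\<^bsub>P\<^esub>"
proof -
  interpret M: module R M by fact
  interpret P: module R P by fact
  let ?z = "f \<zero>\<^bsub>M\<^esub>"
  have z: "?z \<in> carrier P" "?z \<oplus>\<^bsub>P\<^esub> ?z = ?z"
    using f(1) f(2)[of "\<zero>\<^bsub>M\<^esub>" "\<zero>\<^bsub>M\<^esub>"] by simp_all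
  have "?z = ?z \<oplus>\<^bsub>P\<^esub> (?z \<oplus>\<^bsub>P\<^esub> \<ominus>\<^bsub>P\<^esub> ?z)"
    using z(1) by (simp add: P.r_neg)
  also have "\<dots> = (?z \<oplus>\<^bsub>P\<^esub> ?z) \<oplus>\<^bsub>P\<^esub> \<ominus>\<^bsub>P\<^esub> ?z"
    using z(1) by (simp add: P.a_assoc)
  also have "\<dots> = \<zero>\<^bsub>P\<^esub>"
    using z by (simp add: P.r_neg)
  finally show ?thesis .
qed

lemma linear_maps_zero:
  "module R M \<Longrightarrow> module R N \<Longrightarrow> f \<in> linear_maps R M N \<Longrightarrow> f \<zero>\<^bsub>M\<^esub> = \<zero>\<^bsub>N\<^esub>"
  by (rule additive_zero) (auto dest: linear_mapsD)

locale tensor_product =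
  fixes R :: "'r ring" and M N :: "('r, 'm) rmod"
  assumes module_left: "module R M" and module_right: "module R N"
begin

declare in_listsD [rule del] \<comment> \<open>otherwise \<open>auto\<close> destroys the premises \<open>xs \<in> terms\<close>\<close>

sublocale M: module R M by (rule module_left)
sublocale N: module R N by (rule module_right)

abbreviation terms where "terms \<equiv> lists (carrier M \<times> carrier N)"
abbreviation T where "T \<equiv> tensor_module R M N"
abbreviation tsum where "tsum \<equiv> tensor_sum R M N"

lemma tensor_eq_terms: "tensor_eq R M N xs ys \<Longrightarrow> xs \<in> terms \<and> ys \<in> terms"
  by (induction rule: tensor_eq.induct) auto

lemma ten_tensor_sum: "xs \<in> terms \<Longrightarrow> tensor_eq R M N (ten (tsum xs)) xs"
  unfolding tensor_sum_def by (simp, rule someI) (rule tensor_eq.refl)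

text \<open>Equivalent lists define the same predicate on representatives, so the choice operator
  picks the same one.\<close>

lemma tensor_sum_cong: "tensor_eq R M N xs ys \<Longrightarrow> tsum xs = tsum ys"
proof -
  assume "tensor_eq R M N xs ys"
  then have "tensor_eq R M N zs xs = tensor_eq R M N zs ys" for zs
    by (blast intro: tensor_eq.trans tensor_eq.sym)
  then show ?thesis
    by (simp add: tensor_sum_def)
qed

lemma tensor_carrier: "carrier T = tsum ` terms"
  by (simp add: tensor_module_def)

lemma tensor_sum_closed: "xs \<in> terms \<Longrightarrow> tsum xs \<in> carrier T"
  by (simp add: tensor_carrier)

lemma tensor_zero: "\<zero>\<^bsub>T\<^esub> = tsum []"
  by (simp add: tensor_module_def)

lemma tensor_add:
  assumes "xs \<in> terms" "ys \<in> terms"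
  shows "tsum xs \<oplus>\<^bsub>T\<^esub> tsum ys = tsum (xs @ ys)"
  unfolding tensor_module_def
  by simp (rule tensor_sum_cong, intro tensor_eq.append ten_tensor_sum assms)

lemma tensor_eq_smult:
  assumes "r \<in> carrier R" "tensor_eq R M N xs ys"
  shows "tensor_eq R M N (map (\<lambda>(m, y). (r \<odot>\<^bsub>M\<^esub> m, y)) xs) (map (\<lambda>(m, y). (r \<odot>\<^bsub>M\<^esub> m, y)) ys)"
  using assms(2)
proof (induction rule: tensor_eq.induct)
  case (refl xs)
  then show ?case
    using assms(1) by (intro tensor_eq.refl) (auto simp: in_lists_conv_set)
next
  case (comm xs ys)
  then show ?case
    using assms(1) by (simp, intro tensor_eq.comm) (auto simp: in_lists_conv_set)
next
  case (scalar s m y)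
  \<comment> \<open>Commutativity of \<open>R\<close> is what makes this action compatible with
    moving scalars across the tensor sign.\<close>
  have "r \<odot>\<^bsub>M\<^esub> (s \<odot>\<^bsub>M\<^esub> m) = s \<odot>\<^bsub>M\<^esub> (r \<odot>\<^bsub>M\<^esub> m)"
    using scalar assms(1) by (simp add: M.smult_assoc1[symmetric] M.R.m_comm)
  then show ?case
    using scalar assms(1) by (simp add: tensor_eq.scalar)
qed (use assms(1) in \<open>auto intro: tensor_eq.intros simp: M.smult_r_distr\<close>)

lemma tensor_smult:
  assumes "r \<in> carrier R" "xs \<in> terms"
  shows "r \<odot>\<^bsub>T\<^esub> tsum xs = tsum (map (\<lambda>(m, y). (r \<odot>\<^bsub>M\<^esub> m, y)) xs)"
  unfolding tensor_module_def
  by simp (rule tensor_sum_cong, rule tensor_eq_smult[OF assms(1)], rule ten_tensor_sum, rule assms(2))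

lemma ten_terms: "x \<in> carrier T \<Longrightarrow> ten x \<in> terms"
  using tensor_eq_terms[OF ten_tensor_sum] by (simp add: tensor_carrier) (erule imageE, simp)

lemma pure_closed [simp]: "m \<in> carrier M \<Longrightarrow> y \<in> carrier N \<Longrightarrow> pure_tensor R M N m y \<in> carrier T"
  by (auto simp: tensor_carrier pure_tensor_def)

lemma smult_pure:
  "r \<in> carrier R \<Longrightarrow> m \<in> carrier M \<Longrightarrow> y \<in> carrier N \<Longrightarrow>
     r \<odot>\<^bsub>T\<^esub> pure_tensor R M N m y = pure_tensor R M N (r \<odot>\<^bsub>M\<^esub> m) y"
  by (simp add: pure_tensor_def tensor_smult)

lemma tensor_sum_Cons:
  "m \<in> carrier M \<Longrightarrow> y \<in> carrier N \<Longrightarrow> xs \<in> terms \<Longrightarrow>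
     tsum ((m, y) # xs) = pure_tensor R M N m y \<oplus>\<^bsub>T\<^esub> tsum xs"
  by (simp add: pure_tensor_def tensor_add)

lemma tensor_induct [consumes 1, case_names zero pure add]:
  assumes x: "x \<in> carrier T" and "P \<zero>\<^bsub>T\<^esub>"
    and "\<And>m y. m \<in> carrier M \<Longrightarrow> y \<in> carrier N \<Longrightarrow> P (pure_tensor R M N m y)"
    and "\<And>x y. x \<in> carrier T \<Longrightarrow> y \<in> carrier T \<Longrightarrow> P x \<Longrightarrow> P y \<Longrightarrow> P (x \<oplus>\<^bsub>T\<^esub> y)"
  shows "P x"
proof -
  have "P (tsum xs)" if "xs \<in> terms" for xs
    using that
  proof (induction xs)
    case (Cons a xs)
    then show ?case
      using assms(3,4) by (cases a) (auto simp: tensor_sum_Cons tensor_sum_closed)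
  qed (use assms(2) tensor_zero in simp)
  then show ?thesis
    using x unfolding tensor_carrier by blast
qed

lemma abelian_group_tensor: "abelian_group T"
proof (rule abelian_groupI)
  have terms_app: "xs \<in> terms \<Longrightarrow> ys \<in> terms \<Longrightarrow> xs @ ys \<in> terms" for xs ys
    by simp
  show "\<zero>\<^bsub>T\<^esub> \<in> carrier T"
    by (auto simp: tensor_carrier tensor_zero)
  fix x y z assume x: "x \<in> carrier T" and y: "y \<in> carrier T" and z: "z \<in> carrier T"
  then obtain xs ys zs where xs: "xs \<in> terms" "ys \<in> terms" "zs \<in> terms"
    and eq: "x = tsum xs" "y = tsum ys" "z = tsum zs"
    unfolding tensor_carrier by blast
  show "x \<oplus>\<^bsub>T\<^esub> y \<in> carrier T"
    using xs terms_app by (auto simp: eq tensor_add tensor_carrier simp del: append_in_lists_conv)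
  show "x \<oplus>\<^bsub>T\<^esub> y \<oplus>\<^bsub>T\<^esub> z = x \<oplus>\<^bsub>T\<^esub> (y \<oplus>\<^bsub>T\<^esub> z)"
    using xs by (simp add: eq tensor_add)
  show "x \<oplus>\<^bsub>T\<^esub> y = y \<oplus>\<^bsub>T\<^esub> x"
    using xs by (simp add: eq tensor_add tensor_sum_cong tensor_eq.comm)
  show "\<zero>\<^bsub>T\<^esub> \<oplus>\<^bsub>T\<^esub> x = x"
    using xs by (simp add: eq tensor_zero tensor_add)
  \<comment> \<open>Negation acts on left factors. In the induction the new pair and its negative
    are brought together by \<open>comm\<close> and cancelled through \<open>add_left\<close> and
    \<open>zero\<close>.\<close>
  let ?n = "map (\<lambda>(m, y). (\<ominus>\<^bsub>M\<^esub> m, y))"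
  have "?n xs \<in> terms \<and> tensor_eq R M N (?n xs @ xs) []"
    using xs(1)
  proof (induction xs)
    case Nil
    show ?case by (simp add: tensor_eq.refl)
  next
    case (Cons a xs)
    obtain m y where a: "a = (m, y)" "m \<in> carrier M" "y \<in> carrier N"
      using Cons by (cases a) auto
    have n: "?n xs \<in> terms" and IH: "tensor_eq R M N (?n xs @ xs) []"
      using Cons by auto
    have "tensor_eq R M N [(\<ominus>\<^bsub>M\<^esub> m \<oplus>\<^bsub>M\<^esub> m, y)] [(\<ominus>\<^bsub>M\<^esub> m, y), (m, y)]"
      using a by (intro tensor_eq.add_left) auto
    then have cancel: "tensor_eq R M N [(\<ominus>\<^bsub>M\<^esub> m, y), (m, y)] []"
      using a tensor_eq.zero[of y N R M] by (simp add: M.l_neg) (blast intro: tensor_eq.trans tensor_eq.sym)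
    have "tensor_eq R M N (?n xs @ ([(m, y)] @ xs)) (([(m, y)] @ xs) @ ?n xs)"
      using n Cons a by (intro tensor_eq.comm) auto
    then have "tensor_eq R M N ([(\<ominus>\<^bsub>M\<^esub> m, y)] @ (?n xs @ ([(m, y)] @ xs))) ([(\<ominus>\<^bsub>M\<^esub> m, y)] @ (([(m, y)] @ xs) @ ?n xs))"
      using a by (intro tensor_eq.append[OF tensor_eq.refl]) auto
    moreover have "tensor_eq R M N ([(\<ominus>\<^bsub>M\<^esub> m, y), (m, y)] @ (xs @ ?n xs)) ([] @ [])"
    proof (intro tensor_eq.append cancel)
      show "tensor_eq R M N (xs @ ?n xs) []"
        using n Cons by (intro tensor_eq.trans[OF tensor_eq.comm IH]) auto
    qed
    ultimately have "tensor_eq R M N (?n (a # xs) @ (a # xs)) []"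
      using tensor_eq.trans[of R M N _ _ "[]"] by (simp add: a)
    with n a show ?case
      by simp
  qed
  then have "tsum (?n xs) \<in> carrier T" "tsum (?n xs) \<oplus>\<^bsub>T\<^esub> x = \<zero>\<^bsub>T\<^esub>"
    using xs(1) by (auto simp: eq tensor_carrier tensor_add tensor_zero tensor_sum_cong)
  then show "\<exists>y\<in>carrier T. y \<oplus>\<^bsub>T\<^esub> x = \<zero>\<^bsub>T\<^esub>"
    by blast
qed

sublocale T: abelian_group T by (rule abelian_group_tensor)

lemma pure_add_left:
  "m \<in> carrier M \<Longrightarrow> m' \<in> carrier M \<Longrightarrow> y \<in> carrier N \<Longrightarrow>
    pure_tensor R M N (m \<oplus>\<^bsub>M\<^esub> m') y = pure_tensor R M N m y \<oplus>\<^bsub>T\<^esub> pure_tensor R M N m' y"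
  by (simp add: pure_tensor_def tensor_add) (intro tensor_sum_cong tensor_eq.add_left)

lemma pure_add_right:
  "m \<in> carrier M \<Longrightarrow> y \<in> carrier N \<Longrightarrow> y' \<in> carrier N \<Longrightarrow>
    pure_tensor R M N m (y \<oplus>\<^bsub>N\<^esub> y') = pure_tensor R M N m y \<oplus>\<^bsub>T\<^esub> pure_tensor R M N m y'"
  by (simp add: pure_tensor_def tensor_add) (intro tensor_sum_cong tensor_eq.add_right)

lemma pure_smult_right:
  "r \<in> carrier R \<Longrightarrow> m \<in> carrier M \<Longrightarrow> y \<in> carrier N \<Longrightarrow>
    pure_tensor R M N m (r \<odot>\<^bsub>N\<^esub> y) = r \<odot>\<^bsub>T\<^esub> pure_tensor R M N m y"
  by (simp add: smult_pure) (simp add: pure_tensor_def tensor_sum_cong tensor_eq.sym tensor_eq.scalar)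

lemma tensor_smult_closed: "r \<in> carrier R \<Longrightarrow> x \<in> carrier T \<Longrightarrow> r \<odot>\<^bsub>T\<^esub> x \<in> carrier T"
proof -
  assume r: "r \<in> carrier R" and "x \<in> carrier T"
  then obtain xs where xs: "xs \<in> terms" "x = tsum xs"
    unfolding tensor_carrier by blast
  then have "map (\<lambda>(m, y). (r \<odot>\<^bsub>M\<^esub> m, y)) xs \<in> terms"
    using r by (auto simp: in_lists_conv_set)
  with xs r show ?thesis
    by (simp add: tensor_carrier tensor_smult)
qed

lemma tensor_smult_add:
  "r \<in> carrier R \<Longrightarrow> x \<in> carrier T \<Longrightarrow> y \<in> carrier T \<Longrightarrow> r \<odot>\<^bsub>T\<^esub> (x \<oplus>\<^bsub>T\<^esub> y) = r \<odot>\<^bsub>T\<^esub> x \<oplus>\<^bsub>T\<^esub> r \<odot>\<^bsub>T\<^esub> y"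
proof -
  assume r: "r \<in> carrier R" and "x \<in> carrier T" "y \<in> carrier T"
  then obtain xs ys where xs: "xs \<in> terms" "ys \<in> terms" "x = tsum xs" "y = tsum ys"
    unfolding tensor_carrier by blast
  moreover have "map (\<lambda>(m, y). (r \<odot>\<^bsub>M\<^esub> m, y)) zs \<in> terms" if "zs \<in> terms" for zs
    using that r by (auto simp: in_lists_conv_set)
  ultimately show ?thesis
    using r by (simp add: tensor_add tensor_smult)
qed

lemma tensor_smult_zero: "r \<in> carrier R \<Longrightarrow> r \<odot>\<^bsub>T\<^esub> \<zero>\<^bsub>T\<^esub> = \<zero>\<^bsub>T\<^esub>"
  by (simp add: tensor_zero tensor_smult)

lemma module_tensor: "module R T"
proof (rule moduleI)
  fix a b x assume a: "a \<in> carrier R" and b: "b \<in> carrier R" and x: "x \<in> carrier T"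
  show "(a \<oplus>\<^bsub>R\<^esub> b) \<odot>\<^bsub>T\<^esub> x = a \<odot>\<^bsub>T\<^esub> x \<oplus>\<^bsub>T\<^esub> b \<odot>\<^bsub>T\<^esub> x"
    using x
  proof (induction rule: tensor_induct)
    case (add x y)
    then show ?case
      using a b by (simp add: tensor_smult_add tensor_smult_closed T.a_ac)
  qed (use a b in \<open>simp_all add: tensor_smult_zero smult_pure M.smult_l_distr pure_add_left\<close>)
  show "(a \<otimes>\<^bsub>R\<^esub> b) \<odot>\<^bsub>T\<^esub> x = a \<odot>\<^bsub>T\<^esub> (b \<odot>\<^bsub>T\<^esub> x)"
    using x
  proof (induction rule: tensor_induct)
    case (add x y)
    then show ?case
      using a b by (simp add: tensor_smult_add tensor_smult_closed)
  qed (use a b in \<open>simp_all add: tensor_smult_zero smult_pure M.smult_assoc1\<close>)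
next
  fix x assume x: "x \<in> carrier T"
  show "\<one>\<^bsub>R\<^esub> \<odot>\<^bsub>T\<^esub> x = x"
    using x
  proof (induction rule: tensor_induct)
    case (add x y)
    then show ?case
      by (simp add: tensor_smult_add)
  qed (simp_all add: tensor_smult_zero smult_pure)
qed (auto simp: tensor_smult_closed tensor_smult_add M.is_cring abelian_group_tensor)

lemma linear_maps_tensor_eqI:
  assumes P: "module R P" and f: "f \<in> linear_maps R T P" and g: "g \<in> linear_maps R T P"
    and "\<And>m y. m \<in> carrier M \<Longrightarrow> y \<in> carrier N \<Longrightarrow> f (pure_tensor R M N m y) = g (pure_tensor R M N m y)"
  shows "f = g"
proof (rule extensionalityI[of _ "carrier T"])
  fix x assume "x \<in> carrier T"
  then show "f x = g x"
    by (induction rule: tensor_induct)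
      (auto simp: assms linear_maps_zero[OF module_tensor P f] linear_maps_zero[OF module_tensor P g]
        linear_mapsD(2)[OF f] linear_mapsD(2)[OF g])
qed (use f g in \<open>auto dest: linear_mapsD\<close>)

context
  fixes P :: "('r, 'm) rmod" and \<beta>
  assumes P: "module R P" and \<beta>: "bilinear_map R M N P \<beta>"
begin

interpretation P: module R P by (rule P)

lemma bilinear_sum_closed: "xs \<in> terms \<Longrightarrow> bilinear_sum P \<beta> xs \<in> carrier P"
  using \<beta> by (induction xs) (auto simp: bilinear_sum_def bilinear_map_def)

lemma bilinear_sum_append:
  "xs \<in> terms \<Longrightarrow> ys \<in> terms \<Longrightarrow> bilinear_sum P \<beta> (xs @ ys) = bilinear_sum P \<beta> xs \<oplus>\<^bsub>P\<^esub> bilinear_sum P \<beta> ys"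
proof (induction xs)
  case Nil
  then show ?case
    using bilinear_sum_closed by (simp add: bilinear_sum_def)
next
  case (Cons a xs)
  then have "bilinear_sum P \<beta> xs \<in> carrier P" "bilinear_sum P \<beta> ys \<in> carrier P" "\<beta> (fst a) (snd a) \<in> carrier P"
    using bilinear_sum_closed \<beta> by (auto simp: bilinear_map_def)
  with Cons show ?case
    by (auto simp: bilinear_sum_def P.a_assoc split: prod.split)
qed

text \<open>Bilinearity has no clause for zero, but the relation \<open>zero\<close> of
  \<open>tensor_eq\<close> demands this value. It follows from additivity in the left
  argument.\<close>

lemma bilinear_zero: "y \<in> carrier N \<Longrightarrow> \<beta> \<zero>\<^bsub>M\<^esub> y = \<zero>\<^bsub>P\<^esub>"
  by (rule additive_zero[OF module_left P, of "\<lambda>m. \<beta> m y"]) (use \<beta> in \<open>auto simp: bilinear_map_def\<close>)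

text \<open>The generators of \<open>tensor_eq\<close> express bilinearity and the irrelevance of
  the order of summands, both of which the sum of the values of \<open>\<beta>\<close> respects.
  This is the existence half of the universal property.\<close>

lemma bilinear_sum_cong: "tensor_eq R M N xs ys \<Longrightarrow> bilinear_sum P \<beta> xs = bilinear_sum P \<beta> ys"
proof (induction rule: tensor_eq.induct)
  case (append xs xs' ys ys')
  then show ?case
    using tensor_eq_terms by (simp add: bilinear_sum_append)
next
  case (comm xs ys)
  then show ?case
    by (simp add: bilinear_sum_append bilinear_sum_closed P.a_comm)
qed (use \<beta> in \<open>auto simp: bilinear_sum_def bilinear_map_def bilinear_zero\<close>)

lemma tensor_lift_tensor_sum: "xs \<in> terms \<Longrightarrow> tensor_lift R M N P \<beta> (tsum xs) = bilinear_sum P \<beta> xs"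
  using bilinear_sum_cong[OF ten_tensor_sum] by (auto simp: tensor_lift_def tensor_carrier)

lemma tensor_lift_pure [simp]:
  "m \<in> carrier M \<Longrightarrow> y \<in> carrier N \<Longrightarrow> tensor_lift R M N P \<beta> (pure_tensor R M N m y) = \<beta> m y"
  using \<beta> by (simp add: pure_tensor_def tensor_lift_tensor_sum) (simp add: bilinear_sum_def bilinear_map_def)

lemma bilinear_sum_smult:
  assumes "r \<in> carrier R"
  shows "xs \<in> terms \<Longrightarrow> bilinear_sum P \<beta> (map (\<lambda>(m, y). (r \<odot>\<^bsub>M\<^esub> m, y)) xs) = r \<odot>\<^bsub>P\<^esub> bilinear_sum P \<beta> xs"
proof (induction xs)
  case Nil
  then show ?case
    using assms by (simp add: bilinear_sum_def)
next
  case (Cons a xs)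
  then have "bilinear_sum P \<beta> xs \<in> carrier P" "\<beta> (fst a) (snd a) \<in> carrier P"
    using bilinear_sum_closed \<beta> by (auto simp: bilinear_map_def)
  with Cons show ?case
    using assms \<beta> by (auto simp: bilinear_sum_def bilinear_map_def P.smult_r_distr split: prod.split)
qed

lemma tensor_lift_linear: "tensor_lift R M N P \<beta> \<in> linear_maps R T P"
proof (rule linear_mapsI)
  fix x assume x: "x \<in> carrier T"
  then obtain xs where xs: "xs \<in> terms" "x = tsum xs"
    unfolding tensor_carrier by blast
  show "tensor_lift R M N P \<beta> x \<in> carrier P"
    using xs bilinear_sum_closed tensor_lift_tensor_sum by simp
  show "tensor_lift R M N P \<beta> (r \<odot>\<^bsub>T\<^esub> x) = r \<odot>\<^bsub>P\<^esub> tensor_lift R M N P \<beta> x"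
    if r: "r \<in> carrier R" for r
  proof -
    have "map (\<lambda>(m, y). (r \<odot>\<^bsub>M\<^esub> m, y)) xs \<in> terms"
      using xs r by (auto simp: in_lists_conv_set)
    then show ?thesis
      using xs r by (simp add: tensor_smult tensor_lift_tensor_sum bilinear_sum_smult)
  qed
  fix y assume "y \<in> carrier T"
  then obtain ys where "ys \<in> terms" "y = tsum ys"
    unfolding tensor_carrier by blast
  with xs show "tensor_lift R M N P \<beta> (x \<oplus>\<^bsub>T\<^esub> y) = tensor_lift R M N P \<beta> x \<oplus>\<^bsub>P\<^esub> tensor_lift R M N P \<beta> y"
    by (simp add: tensor_add tensor_lift_tensor_sum bilinear_sum_append)
qed (simp add: tensor_lift_def)

end

end

lemma tensor_productI: "module R M \<Longrightarrow> module R N \<Longrightarrow> tensor_product R M N"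
  by (simp add: tensor_product_def)

lemmas module_tensor_module = tensor_product.module_tensor[OF tensor_productI]
lemmas pure_tensor_closed = tensor_product.pure_closed[OF tensor_productI]
lemmas tensor_lift_in_linear_maps = tensor_product.tensor_lift_linear[OF tensor_productI]
lemmas tensor_lift_pure_tensor = tensor_product.tensor_lift_pure[OF tensor_productI]

lemma module_scalar_module: "cring R \<Longrightarrow> module R (scalar_module R)"
proof -
  assume "cring R"
  then interpret R: cring R .
  have "abelian_group (scalar_module R)"
  proof (rule abelian_groupI)
    fix x assume "x \<in> carrier (scalar_module R)"
    then obtain r where r: "r \<in> carrier R" "x = Sca r"
      by (auto simp: scalar_module_def)
    show "\<exists>y\<in>carrier (scalar_module R). y \<oplus>\<^bsub>scalar_module R\<^esub> x = \<zero>\<^bsub>scalar_module R\<^esub>"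
      by (rule bexI[of _ "Sca (\<ominus>\<^bsub>R\<^esub> r)"]) (use r in \<open>auto simp: scalar_module_def R.l_neg\<close>)
  qed (auto simp: scalar_module_def R.a_ac)
  then show ?thesis
    by (intro moduleI) (auto simp: scalar_module_def R.is_cring R.l_distr R.r_distr R.m_assoc)
qed


section \<open>Symmetric monoidal structure beyond the objects of a category\<close>

text \<open>It is not needed that finitely generated free modules are closed under tensor products:
  the values of a symmetric monoidal functor are objects anyway. The calculus of arrows takes place
  in the larger category of all modules, of which \<open>D\<close> is a full subcategory.\<close>

locale large_monoidal =
  fixes D :: "('p, 'b) smcat" (structure) and Ob :: "'p set" and hom :: "'p \<Rightarrow> 'p \<Rightarrow> 'b set"
  assumes hom_arr_eq: "hom_arr D x y = (if x \<in> obj D \<and> y \<in> obj D then hom x y else {})"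
    and obj_large: "x \<in> obj D \<Longrightarrow> x \<in> Ob"
    and arr_obj: "f \<in> arr D \<Longrightarrow> source D f \<in> obj D \<and> target D f \<in> obj D"
    and hom_large: "f \<in> hom x y \<Longrightarrow> x \<in> Ob \<and> y \<in> Ob"
    and hom_endpoints: "f \<in> hom x y \<Longrightarrow> source D f = x \<and> target D f = y"
    and idt_hom: "x \<in> Ob \<Longrightarrow> idt D x \<in> hom x x"
    and cmp_hom: "f \<in> hom x y \<Longrightarrow> g \<in> hom y z \<Longrightarrow> f \<cdot> g \<in> hom x z"
    and idt_left: "f \<in> hom x y \<Longrightarrow> idt D x \<cdot> f = f"
    and idt_right: "f \<in> hom x y \<Longrightarrow> f \<cdot> idt D y = f"
    and cmp_assoc: "f \<in> hom x y \<Longrightarrow> g \<in> hom y z \<Longrightarrow> h \<in> hom z w \<Longrightarrow>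
      f \<cdot> g \<cdot> h = f \<cdot> (g \<cdot> h)"
    and unt_large: "unt D \<in> Ob"
    and teno_large: "x \<in> Ob \<Longrightarrow> y \<in> Ob \<Longrightarrow> teno D x y \<in> Ob"
    and tena_hom: "f \<in> hom x y \<Longrightarrow> g \<in> hom x' y' \<Longrightarrow> tena D f g \<in> hom (teno D x x') (teno D y y')"
    and tena_idt: "x \<in> Ob \<Longrightarrow> y \<in> Ob \<Longrightarrow> tena D (idt D x) (idt D y) = idt D (teno D x y)"
    and interchange: "f \<in> hom x y \<Longrightarrow> g \<in> hom y z \<Longrightarrow> f' \<in> hom x' y' \<Longrightarrow> g' \<in> hom y' z' \<Longrightarrow>
      tena D (f \<cdot> g) (f' \<cdot> g') = tena D f f' \<cdot> tena D g g'"
    and assoc_hom: "x \<in> Ob \<Longrightarrow> y \<in> Ob \<Longrightarrow> z \<in> Ob \<Longrightarrow>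
      assoc D x y z \<in> hom (teno D (teno D x y) z) (teno D x (teno D y z))"
    and assoc_natural: "f \<in> hom x x' \<Longrightarrow> g \<in> hom y y' \<Longrightarrow> h \<in> hom z z' \<Longrightarrow>
      tena D (tena D f g) h \<cdot> assoc D x' y' z' = assoc D x y z \<cdot> tena D f (tena D g h)"
    and lunit_hom: "x \<in> Ob \<Longrightarrow> lunit D x \<in> hom (teno D (unt D) x) x"
    and lunit_natural: "f \<in> hom x y \<Longrightarrow>
      tena D (idt D (unt D)) f \<cdot> lunit D y = lunit D x \<cdot> f"
    and runit_hom: "x \<in> Ob \<Longrightarrow> runit D x \<in> hom (teno D x (unt D)) x"
    and runit_natural: "f \<in> hom x y \<Longrightarrow>
      tena D f (idt D (unt D)) \<cdot> runit D y = runit D x \<cdot> f"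
    and symm_hom: "x \<in> Ob \<Longrightarrow> y \<in> Ob \<Longrightarrow> symm D x y \<in> hom (teno D x y) (teno D y x)"
    and symm_natural: "f \<in> hom x x' \<Longrightarrow> g \<in> hom y y' \<Longrightarrow>
      tena D f g \<cdot> symm D x' y' = symm D x y \<cdot> tena D g f"

section \<open>Structure maps of modules through the universal property\<close>

definition module_hom :: "'r ring \<Rightarrow> ('r, 'm) rmod \<Rightarrow> ('r, 'm) rmod \<Rightarrow> ('r, 'm) rmap set" where
  "module_hom R M N = {(M, N, f) | f. module R M \<and> module R N \<and> f \<in> linear_maps R M N}"

lemma module_homE:
  assumes "F \<in> module_hom R M N"
  obtains f where "F = (M, N, f)" "module R M" "module R N" "f \<in> linear_maps R M N"
  using assms by (auto simp: module_hom_def)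

lemma linear_maps_cmp:
  "f \<in> linear_maps R M N \<Longrightarrow> g \<in> linear_maps R N P \<Longrightarrow>
    module R M \<Longrightarrow> (\<lambda>x\<in>carrier M. g (f x)) \<in> linear_maps R M P"
  by (rule linear_mapsI)
    (simp_all add: linear_mapsD abelian_monoid.a_closed abelian_group.axioms(1) module.axioms(2) module.smult_closed)

lemma linear_maps_id: "module R M \<Longrightarrow> (\<lambda>x\<in>carrier M. x) \<in> linear_maps R M M"
  by (rule linear_mapsI)
    (simp_all add: abelian_monoid.a_closed abelian_group.axioms(1) module.axioms(2) module.smult_closed)

text \<open>\<open>FMod\<close> describes its maps by rewriting representatives entry by entry. This
  puts them into the form of a bilinear sum, to which the universal property applies.\<close>

lemma map_tensor_sum_conv_bilinear_sum:
  assumes "module R M'" "module R N'" "xs \<in> lists A" "\<And>p. p \<in> A \<Longrightarrow> h p \<in> carrier M' \<times> carrier N'"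
  shows "tensor_sum R M' N' (map h xs) =
    bilinear_sum (tensor_module R M' N') (\<lambda>m y. tensor_sum R M' N' [h (m, y)]) xs"
proof -
  interpret tensor_product R M' N'
    using assms by (simp add: tensor_product_def)
  show ?thesis
    using assms(3)
  proof (induction xs)
    case Nil
    then show ?case
      by (simp add: bilinear_sum_def tensor_zero)
  next
    case (Cons a xs)
    obtain m y where a: "h a = (m, y)" "m \<in> carrier M'" "y \<in> carrier N'"
      using Cons assms(4)[of a] by auto
    have "map h xs \<in> terms"
      using Cons assms(4) by (auto simp: in_lists_conv_set)
    then have "tensor_sum R M' N' (map h (a # xs)) = pure_tensor R M' N' m y \<oplus>\<^bsub>T\<^esub> tensor_sum R M' N' (map h xs)"
      using a by (simp only: list.map tensor_sum_Cons)
    moreover have "tensor_sum R M' N' [h (fst a, snd a)] = pure_tensor R M' N' m y"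
      using a by (simp add: pure_tensor_def)
    ultimately show ?case
      using Cons.IH by (simp add: bilinear_sum_def case_prod_unfold)
  qed
qed

lemma bilinear_tensor_map:
  assumes M: "module R M" "module R M'" "module R N" "module R N'"
    and f: "f \<in> linear_maps R M M'" and g: "g \<in> linear_maps R N N'"
  shows "bilinear_map R M N (tensor_module R M' N') (\<lambda>m y. pure_tensor R M' N' (f m) (g y))"
proof -
  interpret tensor_product R M' N'
    using M by (simp add: tensor_product_def)
  show ?thesis
    by (simp add: bilinear_map_def linear_mapsD[OF f] linear_mapsD[OF g] pure_add_left pure_add_right
        pure_smult_right smult_pure)
qed

lemma tensor_map_eq:
  assumes M: "module R M" "module R M'" "module R N" "module R N'"
    and f: "f \<in> linear_maps R M M'" and g: "g \<in> linear_maps R N N'"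
  shows "tensor_map R (M, M', f) (N, N', g) =
    (tensor_module R M N, tensor_module R M' N',
     tensor_lift R M N (tensor_module R M' N') (\<lambda>m y. pure_tensor R M' N' (f m) (g y)))"
proof -
  interpret tensor_product R M N
    using M by (simp add: tensor_product_def)
  show ?thesis
    unfolding tensor_map_def tensor_lift_def prod.case pure_tensor_def
    by (rule arg_cong2[where f = Pair, OF HOL.refl], rule arg_cong2[where f = Pair, OF HOL.refl],
        rule restrict_ext, subst map_tensor_sum_conv_bilinear_sum[OF M(2,4) ten_terms])
      (auto simp: linear_mapsD[OF f] linear_mapsD[OF g])
qed

text \<open>The associator is lifted in two stages: for fixed \<open>y\<close> the assignment is
  bilinear in \<open>l\<close> and \<open>m\<close> and is extended to \<open>t\<close>; the result
  is bilinear in \<open>t\<close> and \<open>y\<close> and can be lifted once more.\<close>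

definition assoc_map :: "'r ring \<Rightarrow> ('r, 'm) rmod \<Rightarrow> ('r, 'm) rmod \<Rightarrow> ('r, 'm) rmod \<Rightarrow>
    ('r, 'm) elt \<Rightarrow> ('r, 'm) elt \<Rightarrow> ('r, 'm) elt" where
  "assoc_map R L M N t y = tensor_lift R L M (tensor_module R L (tensor_module R M N))
     (\<lambda>l m. pure_tensor R L (tensor_module R M N) l (pure_tensor R M N m y)) t"

context
  fixes R :: "'r ring" and L M N :: "('r, 'm) rmod"
  assumes L: "module R L" and M: "module R M" and N: "module R N"
begin

interpretation LM: tensor_product R L M
  using L M by (simp add: tensor_product_def)

interpretation MN: tensor_product R M N
  using M N by (simp add: tensor_product_def)

interpretation LMN: tensor_product R L MN.T
  using L MN.module_tensor by (simp add: tensor_product_def)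

interpretation LMN': tensor_product R LM.T N
  using N LM.module_tensor by (simp add: tensor_product_def)

lemma bilinear_assoc_inner:
  "y \<in> carrier N \<Longrightarrow> bilinear_map R L M LMN.T (\<lambda>l m. pure_tensor R L MN.T l (pure_tensor R M N m y))"
  by (simp add: bilinear_map_def LMN.pure_add_left LMN.pure_add_right MN.pure_add_left
      LMN.smult_pure MN.smult_pure[symmetric] LMN.pure_smult_right)

lemma assoc_map_linear: "y \<in> carrier N \<Longrightarrow> (\<lambda>t. assoc_map R L M N t y) \<in> linear_maps R LM.T LMN.T"
  unfolding assoc_map_def
  using LM.tensor_lift_linear[OF LMN.module_tensor bilinear_assoc_inner] by simp

lemma assoc_map_pure:
  "l \<in> carrier L \<Longrightarrow> m \<in> carrier M \<Longrightarrow> y \<in> carrier N \<Longrightarrow>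
    assoc_map R L M N (pure_tensor R L M l m) y = pure_tensor R L MN.T l (pure_tensor R M N m y)"
  unfolding assoc_map_def by (simp add: LM.tensor_lift_pure LMN.module_tensor bilinear_assoc_inner)

text \<open>Linearity in \<open>t\<close> is built in by the lift. Linearity in \<open>y\<close> is
  proved by induction on \<open>t\<close>, the formula being explicit on pure tensors.\<close>

lemma bilinear_assoc_map: "bilinear_map R LM.T N LMN.T (assoc_map R L M N)"
proof -
  interpret T: module R LMN.T by (rule LMN.module_tensor)
  interpret S: module R LM.T by (rule LM.module_tensor)
  note lin = linear_mapsD[OF assoc_map_linear]
  have "assoc_map R L M N t (y \<oplus>\<^bsub>N\<^esub> y') = assoc_map R L M N t y \<oplus>\<^bsub>LMN.T\<^esub> assoc_map R L M N t y'"
    if y: "y \<in> carrier N" "y' \<in> carrier N" and t: "t \<in> carrier LM.T" for t y y'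
    using t
  proof (induction rule: LM.tensor_induct)
    case zero
    show ?case
      using y linear_maps_zero[OF LM.module_tensor LMN.module_tensor assoc_map_linear] by simp
  next
    case (pure l m)
    then show ?case
      using y by (simp add: assoc_map_pure MN.pure_add_right LMN.pure_add_right)
  next
    case (add t u)
    then show ?case
      using y by (simp add: lin LMN.T.a_ac)
  qed
  moreover have "assoc_map R L M N t (r \<odot>\<^bsub>N\<^esub> y) = r \<odot>\<^bsub>LMN.T\<^esub> assoc_map R L M N t y"
    if y: "y \<in> carrier N" "r \<in> carrier R" and t: "t \<in> carrier LM.T" for t y r
    using t
  proof (induction rule: LM.tensor_induct)
    case zero
    show ?case
      using y linear_maps_zero[OF LM.module_tensor LMN.module_tensor assoc_map_linear]
      by (simp add: LMN.tensor_smult_zero)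
  next
    case (pure l m)
    then show ?case
      using y by (simp add: assoc_map_pure MN.pure_smult_right LMN.pure_smult_right)
  next
    case (add t u)
    then show ?case
      using y by (simp add: lin T.smult_r_distr)
  qed
  ultimately show ?thesis
    using lin by (simp add: bilinear_map_def)
qed

text \<open>The list comprehension concatenates one list for each entry of the representative, and
  the class of each of these lists is a value of \<open>assoc_map\<close>.\<close>

lemma assoc_FMod_eq:
  "assoc (FMod R) L M N = (LMN'.T, LMN.T, tensor_lift R LM.T N LMN.T (assoc_map R L M N))"
proof -
  have inner: "tensor_sum R L MN.T (map (\<lambda>(l, m). (l, tensor_sum R M N [(m, y)])) (ten t)) = assoc_map R L M N t y"
    if "t \<in> carrier LM.T" "y \<in> carrier N" for t y
    unfolding assoc_map_def tensor_lift_def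
    using that MN.pure_closed LM.ten_terms[OF that(1)]
    by (subst map_tensor_sum_conv_bilinear_sum[OF L MN.module_tensor])
      (auto simp: pure_tensor_def)
  have "tensor_sum R L MN.T (concat (map (\<lambda>(t, y). map (\<lambda>(l, m). (l, tensor_sum R M N [(m, y)])) (ten t)) xs))
      = bilinear_sum LMN.T (assoc_map R L M N) xs"
    if "xs \<in> LMN'.terms" for xs
    using that
  proof (induction xs)
    case Nil
    then show ?case
      by (simp add: bilinear_sum_def LMN.tensor_zero)
  next
    case (Cons a xs)
    let ?h = "\<lambda>(t, y). map (\<lambda>(l, m). (l, tensor_sum R M N [(m, y)])) (ten t)"
    have h: "?h b \<in> LMN.terms" if "b \<in> carrier LM.T \<times> carrier N" for b
      using that LM.ten_terms[of "fst b"] MN.pure_closed[unfolded pure_tensor_def]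
      by (fastforce simp: in_lists_conv_set)
    then have "concat (map ?h xs) \<in> LMN.terms"
    proof -
      assume h: "\<And>b. b \<in> carrier LM.T \<times> carrier N \<Longrightarrow> ?h b \<in> LMN.terms"
      have "\<forall>b\<in>set xs. b \<in> carrier LM.T \<times> carrier N"
        using Cons.hyps unfolding in_lists_conv_set by blast
      then have "\<forall>b\<in>set xs. set (?h b) \<subseteq> carrier L \<times> carrier MN.T"
        using h unfolding in_lists_conv_set by blast
      then show ?thesis
        unfolding in_lists_conv_set set_concat set_map by blast
    qed
    moreover obtain t y where "a = (t, y)" "t \<in> carrier LM.T" "y \<in> carrier N"
      using Cons by (cases a) auto
    ultimately show ?case
      using Cons h[of a] by (simp add: LMN.tensor_add[symmetric] inner bilinear_sum_def)
  qed
  then show ?thesis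
    unfolding FMod_def tensor_lift_def
    by (auto intro!: restrict_ext simp: LMN'.ten_terms)
qed

end

section \<open>Modules form a monoidal category\<close>

abbreviation ap :: "'a \<times> 'b \<times> 'c \<Rightarrow> 'c" where "ap F \<equiv> snd (snd F)"

lemma FMod_simps [simp]:
  "source (FMod R) (M, N, f) = M" "target (FMod R) (M, N, f) = N"
  "idt (FMod R) M = (M, M, \<lambda>x\<in>carrier M. x)"
  "cmp (FMod R) (M, N, f) (N', P, g) = (M, P, \<lambda>x\<in>carrier M. g (f x))"
  "unt (FMod R) = scalar_module R" "teno (FMod R) = tensor_module R" "tena (FMod R) = tensor_map R"
  by (simp_all add: FMod_def)

lemma hom_arr_FMod:
  "hom_arr (FMod R) M N = (if M \<in> obj (FMod R) \<and> N \<in> obj (FMod R) then module_hom R M N else {})"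
  by (auto simp: FMod_def hom_arr_def module_hom_def fg_free_def)

lemma module_hom_module: "F \<in> module_hom R M N \<Longrightarrow> module R M \<and> module R N"
  by (auto simp: module_hom_def)

lemma ap_closed: "F \<in> module_hom R M N \<Longrightarrow> x \<in> carrier M \<Longrightarrow> ap F x \<in> carrier N"
  by (auto simp: module_hom_def linear_mapsD)

lemma cmp_module_hom:
  "F \<in> module_hom R M N \<Longrightarrow> G \<in> module_hom R N P \<Longrightarrow> F \<cdot>\<^bsub>FMod R\<^esub> G \<in> module_hom R M P"
  by (auto simp: module_hom_def linear_maps_cmp)

lemma ap_cmp:
  "F \<in> module_hom R M N \<Longrightarrow> G \<in> module_hom R N P \<Longrightarrow> x \<in> carrier M \<Longrightarrow> ap (F \<cdot>\<^bsub>FMod R\<^esub> G) x = ap G (ap F x)"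
  by (auto simp: module_hom_def)

lemma idt_module_hom: "module R M \<Longrightarrow> idt (FMod R) M \<in> module_hom R M M"
  by (auto simp: module_hom_def linear_maps_id)

lemma ap_idt: "x \<in> carrier M \<Longrightarrow> ap (idt (FMod R) M) x = x"
  by simp

lemma module_hom_eqI:
  "F \<in> module_hom R M N \<Longrightarrow> G \<in> module_hom R M N \<Longrightarrow> (\<And>x. x \<in> carrier M \<Longrightarrow> ap F x = ap G x) \<Longrightarrow> F = G"
  by (auto elim!: module_homE intro: extensionalityI dest: linear_mapsD(4))

lemma module_hom_tensor_eqI:
  assumes F: "F \<in> module_hom R (tensor_module R M N) P" and G: "G \<in> module_hom R (tensor_module R M N) P"
    and M: "module R M" "module R N"
    and eq: "\<And>m y. m \<in> carrier M \<Longrightarrow> y \<in> carrier N \<Longrightarrow> ap F (pure_tensor R M N m y) = ap G (pure_tensor R M N m y)"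
  shows "F = G"
proof -
  interpret tensor_product R M N
    using M by (simp add: tensor_product_def)
  obtain f g where "F = (T, P, f)" "G = (T, P, g)" "module R P" "f \<in> linear_maps R T P" "g \<in> linear_maps R T P"
    using F G by (auto simp: module_hom_def)
  then show ?thesis
    using linear_maps_tensor_eqI[of P f g] eq by simp
qed

text \<open>Pure tensors of the outer product have arbitrary elements of the inner product as left
  entries, so an induction on these entries is needed before triple pure tensors suffice.\<close>

lemma module_hom_tensor_tensor_eqI:
  assumes F: "F \<in> module_hom R (tensor_module R (tensor_module R L M) N) P"
    and G: "G \<in> module_hom R (tensor_module R (tensor_module R L M) N) P"
    and L: "module R L" and M: "module R M" and N: "module R N"
    and eq: "\<And>l m y. l \<in> carrier L \<Longrightarrow> m \<in> carrier M \<Longrightarrow> y \<in> carrier N \<Longrightarrow>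
      ap F (pure_tensor R (tensor_module R L M) N (pure_tensor R L M l m) y) =
      ap G (pure_tensor R (tensor_module R L M) N (pure_tensor R L M l m) y)"
  shows "F = G"
proof -
  interpret LM: tensor_product R L M
    using L M by (simp add: tensor_product_def)
  interpret LMN: tensor_product R LM.T N
    using LM.module_tensor N by (simp add: tensor_product_def)
  obtain f g where fg: "F = (LMN.T, P, f)" "G = (LMN.T, P, g)" "module R P"
    "f \<in> linear_maps R LMN.T P" "g \<in> linear_maps R LMN.T P"
    using F G by (auto simp: module_hom_def)
  note f = linear_mapsD[OF fg(4)] and g = linear_mapsD[OF fg(5)]
  have pure_zero: "pure_tensor R LM.T N \<zero>\<^bsub>LM.T\<^esub> y = \<zero>\<^bsub>LMN.T\<^esub>" if "y \<in> carrier N" for y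
    by (rule additive_zero[OF LM.module_tensor LMN.module_tensor]) (use that in \<open>auto simp: LMN.pure_add_left\<close>)
  have "f (pure_tensor R LM.T N t y) = g (pure_tensor R LM.T N t y)" if "t \<in> carrier LM.T" "y \<in> carrier N" for t y
    using that(1)
  proof (induction rule: LM.tensor_induct)
    case zero
    then show ?case
      using that(2) linear_maps_zero[OF LMN.module_tensor fg(3) fg(4)]
        linear_maps_zero[OF LMN.module_tensor fg(3) fg(5)] pure_zero by simp
  next
    case (pure l m)
    then show ?case
      using eq[of l m y] fg(1,2) that(2) by simp
  next
    case (add t u)
    then show ?case
      using that(2) by (simp add: LMN.pure_add_left f g)
  qed
  then show ?thesis
    using LMN.linear_maps_tensor_eqI[OF fg(3-5)] fg(1,2) by simp
qed

lemma tena_module_hom: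
  assumes "F \<in> module_hom R M M'" "G \<in> module_hom R N N'"
  shows "tensor_map R F G \<in> module_hom R (tensor_module R M N) (tensor_module R M' N')"
    and "m \<in> carrier M \<Longrightarrow> y \<in> carrier N \<Longrightarrow>
      ap (tensor_map R F G) (pure_tensor R M N m y) = pure_tensor R M' N' (ap F m) (ap G y)"
proof -
  obtain f g where fg: "F = (M, M', f)" "G = (N, N', g)" "module R M" "module R M'" "module R N" "module R N'"
    "f \<in> linear_maps R M M'" "g \<in> linear_maps R N N'"
    using assms by (auto simp: module_hom_def)
  note b = bilinear_tensor_map[OF fg(3-8)]
  interpret tensor_product R M N
    using fg by (simp add: tensor_product_def)
  have T': "module R (tensor_module R M' N')"
    using fg by (simp add: module_tensor_module)
  show "tensor_map R F G \<in> module_hom R (tensor_module R M N) (tensor_module R M' N')"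
    using fg tensor_lift_linear[OF T' b] by (simp add: tensor_map_eq module_hom_def module_tensor T')
  show "ap (tensor_map R F G) (pure_tensor R M N m y) = pure_tensor R M' N' (ap F m) (ap G y)"
    if "m \<in> carrier M" "y \<in> carrier N"
    using fg tensor_lift_pure[OF T' b] that by (simp add: tensor_map_eq)
qed

lemma assoc_module_hom:
  assumes "module R L" "module R M" "module R N"
  shows "assoc (FMod R) L M N \<in>
      module_hom R (tensor_module R (tensor_module R L M) N) (tensor_module R L (tensor_module R M N))"
    and "l \<in> carrier L \<Longrightarrow> m \<in> carrier M \<Longrightarrow> y \<in> carrier N \<Longrightarrow>
      ap (assoc (FMod R) L M N) (pure_tensor R (tensor_module R L M) N (pure_tensor R L M l m) y) =
      pure_tensor R L (tensor_module R M N) l (pure_tensor R M N m y)"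
  using assms
  by (simp_all add: assoc_FMod_eq module_hom_def module_tensor_module bilinear_assoc_map
      tensor_lift_in_linear_maps tensor_lift_pure_tensor pure_tensor_closed assoc_map_pure)

lemma bilinear_scalar_left:
  assumes "module R M"
  shows "bilinear_map R (scalar_module R) M M (\<lambda>r m. sca r \<odot>\<^bsub>M\<^esub> m)"
proof -
  interpret module R M by fact
  show ?thesis
    by (auto simp: bilinear_map_def scalar_module_def smult_l_distr smult_r_distr smult_assoc1[symmetric] m_comm)
qed

lemma bilinear_scalar_right:
  assumes "module R M"
  shows "bilinear_map R M (scalar_module R) M (\<lambda>m r. sca r \<odot>\<^bsub>M\<^esub> m)"
proof -
  interpret module R M by fact
  show ?thesis
    by (auto simp: bilinear_map_def scalar_module_def smult_l_distr smult_r_distr smult_assoc1[symmetric] m_comm)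
qed

lemma lunit_FMod_eq:
  "lunit (FMod R) M = (tensor_module R (scalar_module R) M, M,
     tensor_lift R (scalar_module R) M M (\<lambda>r m. sca r \<odot>\<^bsub>M\<^esub> m))"
  by (simp add: FMod_def tensor_lift_def bilinear_sum_def)

lemma runit_FMod_eq:
  "runit (FMod R) M = (tensor_module R M (scalar_module R), M,
     tensor_lift R M (scalar_module R) M (\<lambda>m r. sca r \<odot>\<^bsub>M\<^esub> m))"
  by (simp add: FMod_def tensor_lift_def bilinear_sum_def)

lemma lunit_module_hom:
  assumes "module R M"
  shows "lunit (FMod R) M \<in> module_hom R (tensor_module R (scalar_module R) M) M"
    and "r \<in> carrier (scalar_module R) \<Longrightarrow> m \<in> carrier M \<Longrightarrow>
      ap (lunit (FMod R) M) (pure_tensor R (scalar_module R) M r m) = sca r \<odot>\<^bsub>M\<^esub> m"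
  using assms module.axioms(1)[OF assms]
  by (simp_all add: module_scalar_module lunit_FMod_eq module_hom_def module_tensor_module tensor_lift_in_linear_maps
      bilinear_scalar_left tensor_lift_pure_tensor)

lemma runit_module_hom:
  assumes "module R M"
  shows "runit (FMod R) M \<in> module_hom R (tensor_module R M (scalar_module R)) M"
    and "r \<in> carrier (scalar_module R) \<Longrightarrow> m \<in> carrier M \<Longrightarrow>
      ap (runit (FMod R) M) (pure_tensor R M (scalar_module R) m r) = sca r \<odot>\<^bsub>M\<^esub> m"
  using assms module.axioms(1)[OF assms]
  by (simp_all add: module_scalar_module runit_FMod_eq module_hom_def module_tensor_module tensor_lift_in_linear_maps
      bilinear_scalar_right tensor_lift_pure_tensor)

lemma symm_FMod_eq:
  assumes "module R M" "module R N"
  shows "symm (FMod R) M N = (tensor_module R M N, tensor_module R N M,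
    tensor_lift R M N (tensor_module R N M) (\<lambda>m y. pure_tensor R N M y m))"
proof -
  interpret tensor_product R M N
    using assms by (simp add: tensor_product_def)
  have "tensor_sum R N M (map (\<lambda>(m, y). (y, m)) (ten x)) =
      bilinear_sum (tensor_module R N M) (\<lambda>m y. pure_tensor R N M y m) (ten x)"
    if "x \<in> carrier T" for x
    by (subst map_tensor_sum_conv_bilinear_sum[OF assms(2,1) ten_terms[OF that]])
      (auto simp: pure_tensor_def)
  then show ?thesis
    unfolding FMod_def tensor_lift_def by (auto intro!: restrict_ext)
qed

lemma symm_module_hom:
  assumes "module R M" "module R N"
  shows "symm (FMod R) M N \<in> module_hom R (tensor_module R M N) (tensor_module R N M)"
    and "m \<in> carrier M \<Longrightarrow> y \<in> carrier N \<Longrightarrow>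
      ap (symm (FMod R) M N) (pure_tensor R M N m y) = pure_tensor R N M y m"
proof -
  interpret tensor_product R N M
    using assms by (simp add: tensor_product_def)
  have "bilinear_map R M N (tensor_module R N M) (\<lambda>m y. pure_tensor R N M y m)"
    by (simp add: bilinear_map_def pure_add_left pure_add_right pure_smult_right smult_pure)
  then show "symm (FMod R) M N \<in> module_hom R (tensor_module R M N) (tensor_module R N M)"
    and "m \<in> carrier M \<Longrightarrow> y \<in> carrier N \<Longrightarrow>
      ap (symm (FMod R) M N) (pure_tensor R M N m y) = pure_tensor R N M y m"
    using assms
    by (simp_all add: symm_FMod_eq module_hom_def module_tensor_module tensor_lift_in_linear_maps
      tensor_lift_pure_tensor)
qed

text \<open>Equations between maps out of a tensor product are checked on pure tensors, where all
  structure maps have explicit values.\<close>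

lemma large_monoidal_FMod:
  fixes R :: "'r ring"
  assumes R: "cring R"
  shows "large_monoidal (FMod R :: (('r, 'm) rmod, ('r, 'm) rmap) smcat) {M. module R M} (module_hom R)"
proof
  \<comment> \<open>Keeps \<open>idt\<close> and \<open>cmp\<close> folded, so that identities and
    composites are evaluated with \<open>ap_idt\<close> and \<open>ap_cmp\<close>.\<close>
  note [simp del] = FMod_simps(3,4)
  note S = module_scalar_module[OF R]
  fix x y z w x' y' z' :: "('r, 'm) rmod" and f g h f' g' :: "('r, 'm) rmap"
  show "hom_arr (FMod R) x y = (if x \<in> obj (FMod R) \<and> y \<in> obj (FMod R) then module_hom R x y else {})"
    by (rule hom_arr_FMod)
  show "x \<in> obj (FMod R) \<Longrightarrow> x \<in> {M. module R M}"
    by (simp add: FMod_def fg_free_def)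
  show "f \<in> arr (FMod R) \<Longrightarrow> source (FMod R) f \<in> obj (FMod R) \<and> target (FMod R) f \<in> obj (FMod R)"
    by (auto simp: FMod_def)
  show "f \<in> module_hom R x y \<Longrightarrow> x \<in> {M. module R M} \<and> y \<in> {M. module R M}"
    by (simp add: module_hom_module)
  show "f \<in> module_hom R x y \<Longrightarrow> source (FMod R) f = x \<and> target (FMod R) f = y"
    by (auto simp: module_hom_def)
  show "x \<in> {M. module R M} \<Longrightarrow> idt (FMod R) x \<in> module_hom R x x"
    by (simp add: idt_module_hom)
  show "f \<in> module_hom R x y \<Longrightarrow> g \<in> module_hom R y z \<Longrightarrow> f \<cdot>\<^bsub>FMod R\<^esub> g \<in> module_hom R x z"
    by (rule cmp_module_hom)
  show "idt (FMod R) x \<cdot>\<^bsub>FMod R\<^esub> f = f" if f: "f \<in> module_hom R x y"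
    using module_hom_module[OF f] idt_module_hom[of R x]
    by (intro module_hom_eqI[OF cmp_module_hom f]) (auto simp: ap_cmp[OF _ f] ap_idt f)
  show "f \<cdot>\<^bsub>FMod R\<^esub> idt (FMod R) y = f" if f: "f \<in> module_hom R x y"
    using module_hom_module[OF f] idt_module_hom[of R y]
    by (intro module_hom_eqI[OF cmp_module_hom f]) (auto simp: ap_cmp[OF f] ap_idt f ap_closed[OF f])
  show "f \<cdot>\<^bsub>FMod R\<^esub> g \<cdot>\<^bsub>FMod R\<^esub> h = f \<cdot>\<^bsub>FMod R\<^esub> (g \<cdot>\<^bsub>FMod R\<^esub> h)"
    if f: "f \<in> module_hom R x y" and g: "g \<in> module_hom R y z" and h: "h \<in> module_hom R z w"
    using cmp_module_hom[OF f g] cmp_module_hom[OF g h] f g h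
    by (intro module_hom_eqI[OF cmp_module_hom cmp_module_hom])
      (auto simp: ap_cmp[OF _ h] ap_cmp[OF f] ap_cmp[OF g] ap_closed[OF f])
  show "unt (FMod R) \<in> {M. module R M}"
    by (simp add: S)
  show "x \<in> {M. module R M} \<Longrightarrow> y \<in> {M. module R M} \<Longrightarrow> teno (FMod R) x y \<in> {M. module R M}"
    by (simp add: module_tensor_module)
  show "tena (FMod R) f g \<in> module_hom R (teno (FMod R) x x') (teno (FMod R) y y')"
    if "f \<in> module_hom R x y" "g \<in> module_hom R x' y'"
    using tena_module_hom(1)[OF that] by simp
  show "tena (FMod R) (idt (FMod R) x) (idt (FMod R) y) = idt (FMod R) (teno (FMod R) x y)"
    if "x \<in> {M. module R M}" "y \<in> {M. module R M}"
  proof -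
    have x: "module R x" "module R y" "module R (tensor_module R x y)"
      using that by (auto simp: module_tensor_module)
    note t = tena_module_hom[OF idt_module_hom idt_module_hom, OF x(1,2)]
    show ?thesis
      by (rule module_hom_tensor_eqI[OF _ _ x(1,2)])
        (use t x in \<open>auto simp: idt_module_hom ap_idt pure_tensor_closed\<close>)
  qed
  show "tena (FMod R) (f \<cdot>\<^bsub>FMod R\<^esub> g) (f' \<cdot>\<^bsub>FMod R\<^esub> g') = tena (FMod R) f f' \<cdot>\<^bsub>FMod R\<^esub> tena (FMod R) g g'"
    if f: "f \<in> module_hom R x y" "g \<in> module_hom R y z" "f' \<in> module_hom R x' y'" "g' \<in> module_hom R y' z'"
  proof -
    note t = tena_module_hom[OF f(1,3)] and u = tena_module_hom[OF f(2,4)]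
      and c = cmp_module_hom[OF f(1,2)] cmp_module_hom[OF f(3,4)]
    note v = tena_module_hom[OF c]
    note m = module_hom_module[OF f(1)] module_hom_module[OF f(3)]
    show ?thesis
      unfolding FMod_simps(5-7)
      by (rule module_hom_tensor_eqI[OF v(1) cmp_module_hom[OF t(1) u(1)]])
        (use m in \<open>auto simp: v(2) ap_cmp[OF t(1) u(1)] t(2) u(2) ap_cmp[OF f(1,2)] ap_cmp[OF f(3,4)]
          ap_closed[OF f(1)] ap_closed[OF f(3)] pure_tensor_closed\<close>)
  qed
  show "x \<in> {M. module R M} \<Longrightarrow> y \<in> {M. module R M} \<Longrightarrow> z \<in> {M. module R M} \<Longrightarrow> assoc (FMod R) x y z \<in>
      module_hom R (teno (FMod R) (teno (FMod R) x y) z) (teno (FMod R) x (teno (FMod R) y z))"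
    by (simp add: assoc_module_hom)
  show "tena (FMod R) (tena (FMod R) f g) h \<cdot>\<^bsub>FMod R\<^esub> assoc (FMod R) x' y' z' =
      assoc (FMod R) x y z \<cdot>\<^bsub>FMod R\<^esub> tena (FMod R) f (tena (FMod R) g h)"
    if f: "f \<in> module_hom R x x'" and g: "g \<in> module_hom R y y'" and h: "h \<in> module_hom R z z'"
  proof -
    note m = module_hom_module[OF f] module_hom_module[OF g] module_hom_module[OF h]
    note fg = tena_module_hom[OF f g] note gh = tena_module_hom[OF g h]
    note l = tena_module_hom[OF fg(1) h] and r = tena_module_hom[OF f gh(1)]
    have a: "module R x" "module R y" "module R z" "module R x'" "module R y'" "module R z'"
      using m by auto
    note a1 = assoc_module_hom[OF a(1-3)] and a2 = assoc_module_hom[OF a(4-6)]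
    show ?thesis
      unfolding FMod_simps(5-7)
      by (rule module_hom_tensor_tensor_eqI[OF cmp_module_hom[OF l(1) a2(1)] cmp_module_hom[OF a1(1) r(1)]])
        (use a in \<open>auto simp: ap_cmp[OF l(1) a2(1)] ap_cmp[OF a1(1) r(1)] l(2) r(2) a1(2) a2(2) fg(2) gh(2)
          pure_tensor_closed module_tensor_module ap_closed[OF f] ap_closed[OF g] ap_closed[OF h]\<close>)
  qed
  show "x \<in> {M. module R M} \<Longrightarrow> lunit (FMod R) x \<in> module_hom R (teno (FMod R) (unt (FMod R)) x) x"
    by (simp add: lunit_module_hom)
  show "x \<in> {M. module R M} \<Longrightarrow> runit (FMod R) x \<in> module_hom R (teno (FMod R) x (unt (FMod R))) x"
    by (simp add: runit_module_hom)
  show "tena (FMod R) (idt (FMod R) (unt (FMod R))) f \<cdot>\<^bsub>FMod R\<^esub> lunit (FMod R) y = lunit (FMod R) x \<cdot>\<^bsub>FMod R\<^esub> f"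
    if f: "f \<in> module_hom R x y"
  proof -
    have m: "module R x" "module R y"
      using module_hom_module[OF f] by auto
    note t = tena_module_hom[OF idt_module_hom[OF S] f] and l1 = lunit_module_hom[OF m(1)] and l2 = lunit_module_hom[OF m(2)]
    have lin: "ap f (sca r \<odot>\<^bsub>x\<^esub> a) = sca r \<odot>\<^bsub>y\<^esub> ap f a" if "r \<in> carrier (scalar_module R)" "a \<in> carrier x" for r a
      using f that by (auto simp: module_hom_def scalar_module_def linear_mapsD)
    show ?thesis
      unfolding FMod_simps(5-7)
      by (rule module_hom_tensor_eqI[OF cmp_module_hom[OF t(1) l2(1)] cmp_module_hom[OF l1(1) f]])
        (use m in \<open>auto simp: S ap_cmp[OF t(1) l2(1)] ap_cmp[OF l1(1) f] t(2) l1(2) l2(2) lin ap_idt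
          pure_tensor_closed ap_closed[OF f]\<close>)
  qed
  show "tena (FMod R) f (idt (FMod R) (unt (FMod R))) \<cdot>\<^bsub>FMod R\<^esub> runit (FMod R) y = runit (FMod R) x \<cdot>\<^bsub>FMod R\<^esub> f"
    if f: "f \<in> module_hom R x y"
  proof -
    have m: "module R x" "module R y"
      using module_hom_module[OF f] by auto
    note t = tena_module_hom[OF f idt_module_hom[OF S]] and l1 = runit_module_hom[OF m(1)] and l2 = runit_module_hom[OF m(2)]
    have lin: "ap f (sca r \<odot>\<^bsub>x\<^esub> a) = sca r \<odot>\<^bsub>y\<^esub> ap f a" if "r \<in> carrier (scalar_module R)" "a \<in> carrier x" for r a
      using f that by (auto simp: module_hom_def scalar_module_def linear_mapsD)
    show ?thesis
      unfolding FMod_simps(5-7)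
      by (rule module_hom_tensor_eqI[OF cmp_module_hom[OF t(1) l2(1)] cmp_module_hom[OF l1(1) f]])
        (use m in \<open>auto simp: S ap_cmp[OF t(1) l2(1)] ap_cmp[OF l1(1) f] t(2) l1(2) l2(2) lin ap_idt
          pure_tensor_closed ap_closed[OF f]\<close>)
  qed
  show "x \<in> {M. module R M} \<Longrightarrow> y \<in> {M. module R M} \<Longrightarrow> symm (FMod R) x y \<in> module_hom R (teno (FMod R) x y) (teno (FMod R) y x)"
    by (simp add: symm_module_hom)
  show "tena (FMod R) f g \<cdot>\<^bsub>FMod R\<^esub> symm (FMod R) x' y' = symm (FMod R) x y \<cdot>\<^bsub>FMod R\<^esub> tena (FMod R) g f"
    if f: "f \<in> module_hom R x x'" and g: "g \<in> module_hom R y y'"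
  proof -
    have m: "module R x" "module R y" "module R x'" "module R y'"
      using module_hom_module[OF f] module_hom_module[OF g] by auto
    note t = tena_module_hom[OF f g] and u = tena_module_hom[OF g f]
      and s = symm_module_hom[OF m(1,2)] and s' = symm_module_hom[OF m(3,4)]
    show ?thesis
      unfolding FMod_simps(5-7)
      by (rule module_hom_tensor_eqI[OF cmp_module_hom[OF t(1) s'(1)] cmp_module_hom[OF s(1) u(1)]])
        (use m in \<open>auto simp: ap_cmp[OF t(1) s'(1)] ap_cmp[OF s(1) u(1)] t(2) u(2) s(2) s'(2)
          pure_tensor_closed ap_closed[OF f] ap_closed[OF g]\<close>)
  qed
qed

section \<open>Calculus of arrows\<close>

context large_monoidal
begin

text \<open>Endpoints are read off by \<open>source\<close> and \<open>target\<close> instead of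
  being parameters of \<open>hom\<close>, so that the well-formedness of a composite becomes a side
  condition for the simplifier.\<close>

definition large :: "'b \<Rightarrow> bool" where
  "large f \<longleftrightarrow> f \<in> hom (source D f) (target D f)"

lemma homD: "f \<in> hom x y \<Longrightarrow> large f \<and> source D f = x \<and> target D f = y"
  using hom_endpoints[of f x y] by (simp add: large_def)

lemma homI: "large f \<Longrightarrow> source D f = x \<Longrightarrow> target D f = y \<Longrightarrow> f \<in> hom x y"
  by (auto simp: large_def)

lemma hom_arrD:
  "f \<in> hom_arr D x y \<Longrightarrow> large f \<and> source D f = x \<and> target D f = y \<and> x \<in> obj D \<and> y \<in> obj D"
  using homD[of f x y] by (auto simp: hom_arr_eq split: if_splits)

lemma hom_arrI:
  "large f \<Longrightarrow> source D f = x \<Longrightarrow> target D f = y \<Longrightarrow> x \<in> obj D \<Longrightarrow> y \<in> obj D \<Longrightarrow> f \<in> hom_arr D x y"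
  by (simp add: hom_arr_eq homI)

lemma arr_iff: "f \<in> arr D \<longleftrightarrow> large f \<and> source D f \<in> obj D \<and> target D f \<in> obj D"
  using hom_arrD[of f "source D f" "target D f"] hom_arrI[of f "source D f" "target D f"]
  by (auto simp: hom_arr_def)

lemma large_obj [simp]: "large f \<Longrightarrow> source D f \<in> Ob" "large f \<Longrightarrow> target D f \<in> Ob"
  using hom_large by (auto simp: large_def)

lemma large_cmp:
  assumes "large f" "large g" "target D f = source D g"
  shows "large (f \<cdot> g)" "source D (f \<cdot> g) = source D f" "target D (f \<cdot> g) = target D g"
  using homD[OF cmp_hom[of f "source D f" "target D f" g "target D g"]] assms by (auto simp: large_def)

lemma large_idt: 
  assumes "x \<in> Ob"
  shows "large (idt D x)" "source D (idt D x) = x" "target D (idt D x) = x"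
  using homD[OF idt_hom[OF assms]] by auto

lemma large_tena:
  assumes "large f" "large g"
  shows "large (tena D f g)" "source D (tena D f g) = teno D (source D f) (source D g)"
    "target D (tena D f g) = teno D (target D f) (target D g)"
  using homD[OF tena_hom[OF assms[unfolded large_def]]] by auto

lemma large_assoc:
  assumes "x \<in> Ob" "y \<in> Ob" "z \<in> Ob"
  shows "large (assoc D x y z)" "source D (assoc D x y z) = teno D (teno D x y) z"
    "target D (assoc D x y z) = teno D x (teno D y z)"
  using homD[OF assoc_hom[OF assms]] by auto

lemma large_lunit:
  assumes "x \<in> Ob"
  shows "large (lunit D x)" "source D (lunit D x) = teno D (unt D) x" "target D (lunit D x) = x"
  using homD[OF lunit_hom[OF assms]] by auto

lemma large_runit:
  assumes "x \<in> Ob"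
  shows "large (runit D x)" "source D (runit D x) = teno D x (unt D)" "target D (runit D x) = x"
  using homD[OF runit_hom[OF assms]] by auto

lemma large_symm:
  assumes "x \<in> Ob" "y \<in> Ob"
  shows "large (symm D x y)" "source D (symm D x y) = teno D x y" "target D (symm D x y) = teno D y x"
  using homD[OF symm_hom[OF assms]] by auto

lemma cmp_assoc_large:
  "large f \<Longrightarrow> large g \<Longrightarrow> large h \<Longrightarrow> target D f = source D g \<Longrightarrow> target D g = source D h \<Longrightarrow>
    f \<cdot> g \<cdot> h = f \<cdot> (g \<cdot> h)"
  by (rule cmp_assoc) (auto simp: large_def)

lemma idt_left_large: "large f \<Longrightarrow> source D f = x \<Longrightarrow> idt D x \<cdot> f = f"
  using idt_left by (auto simp: large_def)

lemma idt_right_large: "large f \<Longrightarrow> target D f = x \<Longrightarrow> f \<cdot> idt D x = f"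
  using idt_right by (auto simp: large_def)

lemma interchange_large:
  "large f \<Longrightarrow> large g \<Longrightarrow> large f' \<Longrightarrow> large g' \<Longrightarrow> target D f = source D g \<Longrightarrow> target D f' = source D g' \<Longrightarrow>
    tena D f f' \<cdot> tena D g g' = tena D (f \<cdot> g) (f' \<cdot> g')"
  by (rule interchange[symmetric]) (auto simp: large_def)

lemmas large_simps = large_cmp large_idt large_tena large_assoc large_lunit large_runit large_symm
  idt_left_large idt_right_large teno_large unt_large obj_large

lemma assoc_natural_large:
  "large f \<Longrightarrow> large g \<Longrightarrow> large h \<Longrightarrow>
    tena D (tena D f g) h \<cdot> assoc D (target D f) (target D g) (target D h) =
    assoc D (source D f) (source D g) (source D h) \<cdot> tena D f (tena D g h)"
  by (rule assoc_natural) (auto simp: large_def)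

lemma lunit_natural_large:
  "large f \<Longrightarrow> tena D (idt D (unt D)) f \<cdot> lunit D (target D f) = lunit D (source D f) \<cdot> f"
  by (rule lunit_natural) (auto simp: large_def)

lemma runit_natural_large:
  "large f \<Longrightarrow> tena D f (idt D (unt D)) \<cdot> runit D (target D f) = runit D (source D f) \<cdot> f"
  by (rule runit_natural) (auto simp: large_def)

lemma symm_natural_large:
  "large f \<Longrightarrow> large g \<Longrightarrow>
    tena D f g \<cdot> symm D (target D f) (target D g) = symm D (source D f) (source D g) \<cdot> tena D g f"
  by (rule symm_natural) (auto simp: large_def)

subsection \<open>Isomorphisms\<close>

definition inverse_arr :: "'b \<Rightarrow> 'b" where
  "inverse_arr f = (SOME g. g \<in> hom_arr D (target D f) (source D f) \<and>
     f \<cdot> g = idt D (source D f) \<and> g \<cdot> f = idt D (target D f))"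

lemma inverse_arr:
  assumes "iso_arr D f"
  shows "large f" "large (inverse_arr f)" "source D (inverse_arr f) = target D f"
    "target D (inverse_arr f) = source D f"
    "f \<cdot> inverse_arr f = idt D (source D f)" "inverse_arr f \<cdot> f = idt D (target D f)"
proof -
  have "inverse_arr f \<in> hom_arr D (target D f) (source D f) \<and>
     f \<cdot> inverse_arr f = idt D (source D f) \<and> inverse_arr f \<cdot> f = idt D (target D f)"
    using assms unfolding inverse_arr_def iso_arr_def by - (rule someI_ex, blast)
  then show "large (inverse_arr f)" "source D (inverse_arr f) = target D f"
    "target D (inverse_arr f) = source D f"
    "f \<cdot> inverse_arr f = idt D (source D f)" "inverse_arr f \<cdot> f = idt D (target D f)"
    by (auto dest: hom_arrD)
  show "large f"
    using assms by (simp add: iso_arr_def arr_iff)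
qed

text \<open>A right inverse is enough for cancellation on the right, and it may be any large arrow.
  Hence the property passes to tensor products, whose endpoints need not be objects of
  \<open>D\<close>, whereas \<open>iso_arr D\<close> speaks of arrows of \<open>D\<close>.\<close>

definition has_right_inverse :: "'b \<Rightarrow> bool" where
  "has_right_inverse f \<longleftrightarrow> large f \<and>
     (\<exists>g. large g \<and> source D g = target D f \<and> target D g = source D f \<and> f \<cdot> g = idt D (source D f))"

lemma iso_has_right_inverse: "iso_arr D f \<Longrightarrow> has_right_inverse f"
  unfolding has_right_inverse_def using inverse_arr[of f] by blast

lemma idt_has_right_inverse: "x \<in> Ob \<Longrightarrow> has_right_inverse (idt D x)"
  unfolding has_right_inverse_def by (rule conjI, simp add: large_simps, rule exI[of _ "idt D x"]) (simp add: large_simps)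

lemma tena_has_right_inverse:
  assumes "has_right_inverse f" "has_right_inverse g"
  shows "has_right_inverse (tena D f g)"
proof -
  obtain f' g' where i: "large f" "large f'" "source D f' = target D f" "target D f' = source D f" "f \<cdot> f' = idt D (source D f)"
    "large g" "large g'" "source D g' = target D g" "target D g' = source D g" "g \<cdot> g' = idt D (source D g)"
    using assms unfolding has_right_inverse_def by blast
  then have "tena D f g \<cdot> tena D f' g' = idt D (source D (tena D f g))"
    by (simp add: large_simps interchange_large tena_idt)
  with i show ?thesis
    unfolding has_right_inverse_def by (intro conjI exI[of _ "tena D f' g'"]) (simp_all add: large_simps)
qed

lemma cancel_right:
  assumes f: "has_right_inverse f" and g: "large g" "target D g = source D f"
    and h: "large h" "target D h = source D f" and eq: "g \<cdot> f = h \<cdot> f"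
  shows "g = h"
proof -
  obtain f' where i: "large f" "large f'" "source D f' = target D f" "target D f' = source D f" "f \<cdot> f' = idt D (source D f)"
    using f unfolding has_right_inverse_def by blast
  have "g = g \<cdot> (f \<cdot> f')"
    using i g by (simp add: large_simps)
  also have "\<dots> = (g \<cdot> f) \<cdot> f'"
    using i g by (simp only: cmp_assoc_large)
  also have "\<dots> = (h \<cdot> f) \<cdot> f'"
    by (simp only: eq)
  also have "\<dots> = h"
    using i h by (simp add: large_simps cmp_assoc_large)
  finally show ?thesis .
qed

end

subsection \<open>Symmetric monoidal functors\<close>

locale monoidal_signature =
  fixes C :: "('o, 'a) smcat"
  assumes source_obj: "f \<in> arr C \<Longrightarrow> source C f \<in> obj C"
    and target_obj: "f \<in> arr C \<Longrightarrow> target C f \<in> obj C"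
    and teno_obj: "x \<in> obj C \<Longrightarrow> y \<in> obj C \<Longrightarrow> teno C x y \<in> obj C"
    and unt_obj: "unt C \<in> obj C"

locale strong_functor = large_monoidal D Ob hom + monoidal_signature C
  for D :: "('p, 'b) smcat" (structure) and Ob hom and C :: "('o, 'a) smcat" +
  fixes F :: "('o, 'a, 'p, 'b) smfun"
  assumes F: "sm_functor C D F"
begin

lemma FO_obj: "x \<in> obj C \<Longrightarrow> FO F x \<in> obj D"
  using F by (simp add: sm_functor_def is_functor_def)

lemma FA_large:
  assumes "f \<in> arr C"
  shows "large (FA F f)" "source D (FA F f) = FO F (source C f)" "target D (FA F f) = FO F (target C f)"
  using F assms hom_arrD[of "FA F f"] by (auto simp: sm_functor_def is_functor_def)

lemma FA_idt: "x \<in> obj C \<Longrightarrow> FA F (idt C x) = idt D (FO F x)"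
  using F by (simp add: sm_functor_def is_functor_def)

lemma FA_cmp:
  "f \<in> arr C \<Longrightarrow> g \<in> arr C \<Longrightarrow> target C f = source C g \<Longrightarrow> FA F (f \<cdot>\<^bsub>C\<^esub> g) = FA F f \<cdot> FA F g"
  using F by (simp add: sm_functor_def is_functor_def)

lemma FC_iso: "x \<in> obj C \<Longrightarrow> y \<in> obj C \<Longrightarrow> iso_arr D (FC F (x, y))"
  using F by (simp add: sm_functor_def)

lemma FC_large:
  assumes "x \<in> obj C" "y \<in> obj C"
  shows "large (FC F (x, y))" "source D (FC F (x, y)) = FO F (teno C x y)"
    "target D (FC F (x, y)) = teno D (FO F x) (FO F y)" "teno D (FO F x) (FO F y) \<in> obj D"
  using F assms hom_arrD[of "FC F (x, y)"] by (auto simp: sm_functor_def)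

lemma FU_large: "large (FU F)" "source D (FU F) = FO F (unt C)" "target D (FU F) = unt D"
  using F hom_arrD[of "FU F"] by (auto simp: sm_functor_def)

lemma FC_natural:
  "f \<in> arr C \<Longrightarrow> g \<in> arr C \<Longrightarrow> FA F (tena C f g) \<cdot> FC F (target C f, target C g) =
    FC F (source C f, source C g) \<cdot> tena D (FA F f) (FA F g)"
  using F by (simp add: sm_functor_def)

lemma FC_assoc:
  "x \<in> obj C \<Longrightarrow> y \<in> obj C \<Longrightarrow> z \<in> obj C \<Longrightarrow>
    FA F (assoc C x y z) \<cdot> FC F (x, teno C y z) \<cdot> tena D (idt D (FO F x)) (FC F (y, z)) =
    FC F (teno C x y, z) \<cdot> tena D (FC F (x, y)) (idt D (FO F z)) \<cdot> assoc D (FO F x) (FO F y) (FO F z)"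
  using F by (simp add: sm_functor_def)

lemma FC_lunit:
  "x \<in> obj C \<Longrightarrow> FA F (lunit C x) =
    FC F (unt C, x) \<cdot> tena D (FU F) (idt D (FO F x)) \<cdot> lunit D (FO F x)"
  using F by (simp add: sm_functor_def)

lemma FC_runit:
  "x \<in> obj C \<Longrightarrow> FA F (runit C x) =
    FC F (x, unt C) \<cdot> tena D (idt D (FO F x)) (FU F) \<cdot> runit D (FO F x)"
  using F by (simp add: sm_functor_def)

lemma FC_symm:
  "x \<in> obj C \<Longrightarrow> y \<in> obj C \<Longrightarrow>
    FA F (symm C x y) \<cdot> FC F (y, x) = FC F (x, y) \<cdot> symm D (FO F x) (FO F y)"
  using F by (simp add: sm_functor_def)

lemmas functor_simps = FO_obj FA_large FC_large FU_large teno_obj unt_obj source_obj target_obj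

lemma identity_transformation: "sm_transformation C D F F (\<lambda>x\<in>obj C. idt D (FO F x))"
  unfolding sm_transformation_def
  by (auto simp: functor_simps large_simps tena_idt intro!: hom_arrI)

end

text \<open>Serves both passages between \<open>Diff n X x0\<close> and
  \<open>HCobord n X x0\<close>. These share objects, unit and products of objects, and the
  coherence axioms involve arrows of the domain only through the structural isomorphisms.\<close>

lemma sm_functor_transfer:
  assumes F: "sm_functor C D F"
    and eq: "obj C' = obj C" "unt C' = unt C" "teno C' = teno C" "FO F' = FO F" "FC F' = FC F" "FU F' = FU F"
    and "FA F' \<in> extensional (arr C')" "is_functor C' D (FO F) (FA F')"
    and "\<And>f g. f \<in> arr C' \<Longrightarrow> g \<in> arr C' \<Longrightarrow>
      FA F' (tena C' f g) \<cdot>\<^bsub>D\<^esub> FC F (target C' f, target C' g) =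
      FC F (source C' f, source C' g) \<cdot>\<^bsub>D\<^esub> tena D (FA F' f) (FA F' g)"
    and "\<And>x y z. x \<in> obj C \<Longrightarrow> y \<in> obj C \<Longrightarrow> z \<in> obj C \<Longrightarrow> FA F' (assoc C' x y z) = FA F (assoc C x y z)"
    and "\<And>x. x \<in> obj C \<Longrightarrow> FA F' (lunit C' x) = FA F (lunit C x)"
    and "\<And>x. x \<in> obj C \<Longrightarrow> FA F' (runit C' x) = FA F (runit C x)"
    and "\<And>x y. x \<in> obj C \<Longrightarrow> y \<in> obj C \<Longrightarrow> FA F' (symm C' x y) = FA F (symm C x y)"
  shows "sm_functor C' D F'"
  using assms unfolding sm_functor_def eq by simp

lemma (in large_monoidal) transformation_cmp:
  assumes C: "monoidal_signature C" and F: "sm_functor C D F" and G: "sm_functor C D G" and H: "sm_functor C D H"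
    and \<theta>: "sm_transformation C D F G \<theta>" and \<eta>: "sm_transformation C D G H \<eta>"
  shows "sm_transformation C D F H (\<lambda>x\<in>obj C. \<theta> x \<cdot> \<eta> x)"
proof -
  interpret monoidal_signature C by (rule C)
  interpret F: strong_functor D Ob hom C F by unfold_locales (rule F)
  interpret G: strong_functor D Ob hom C G by unfold_locales (rule G)
  interpret H: strong_functor D Ob hom C H by unfold_locales (rule H)
  have t: "large (\<theta> x)" "source D (\<theta> x) = FO F x" "target D (\<theta> x) = FO G x" if "x \<in> obj C" for x
    using \<theta> that hom_arrD[of "\<theta> x"] by (auto simp: sm_transformation_def)
  have e: "large (\<eta> x)" "source D (\<eta> x) = FO G x" "target D (\<eta> x) = FO H x" if "x \<in> obj C" for x
    using \<eta> that hom_arrD[of "\<eta> x"] by (auto simp: sm_transformation_def)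
  note simps = t e F.functor_simps G.functor_simps H.functor_simps large_simps
  show ?thesis
    unfolding sm_transformation_def
  proof (intro conjI ballI)
    fix x assume "x \<in> obj C"
    then show "(\<lambda>x\<in>obj C. \<theta> x \<cdot> \<eta> x) x \<in> hom_arr D (FO F x) (FO H x)"
      by (auto simp: simps intro!: hom_arrI)
  next
    fix f assume f: "f \<in> arr C"
    have "FA F f \<cdot> (\<theta> (target C f) \<cdot> \<eta> (target C f)) = FA F f \<cdot> \<theta> (target C f) \<cdot> \<eta> (target C f)"
      using f by (simp add: simps cmp_assoc_large)
    also have "\<dots> = \<theta> (source C f) \<cdot> FA G f \<cdot> \<eta> (target C f)"
      using \<theta> f by (simp add: sm_transformation_def)
    also have "\<dots> = \<theta> (source C f) \<cdot> (FA G f \<cdot> \<eta> (target C f))"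
      using f by (simp add: simps cmp_assoc_large)
    also have "\<dots> = \<theta> (source C f) \<cdot> (\<eta> (source C f) \<cdot> FA H f)"
      using \<eta> f by (simp add: sm_transformation_def)
    also have "\<dots> = \<theta> (source C f) \<cdot> \<eta> (source C f) \<cdot> FA H f"
      using f by (simp add: simps cmp_assoc_large)
    finally show "FA F f \<cdot> (\<lambda>x\<in>obj C. \<theta> x \<cdot> \<eta> x) (target C f) = (\<lambda>x\<in>obj C. \<theta> x \<cdot> \<eta> x) (source C f) \<cdot> FA H f"
      using f by (simp add: source_obj target_obj)
  next
    fix x y assume xy: "x \<in> obj C" "y \<in> obj C"
    let ?z = "teno C x y"
    have "\<theta> ?z \<cdot> \<eta> ?z \<cdot> FC H (x, y) = \<theta> ?z \<cdot> (\<eta> ?z \<cdot> FC H (x, y))"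
      using xy by (simp add: simps cmp_assoc_large)
    also have "\<dots> = \<theta> ?z \<cdot> (FC G (x, y) \<cdot> tena D (\<eta> x) (\<eta> y))"
      using \<eta> xy by (simp add: sm_transformation_def)
    also have "\<dots> = (\<theta> ?z \<cdot> FC G (x, y)) \<cdot> tena D (\<eta> x) (\<eta> y)"
      using xy by (simp add: simps cmp_assoc_large)
    also have "\<dots> = FC F (x, y) \<cdot> tena D (\<theta> x) (\<theta> y) \<cdot> tena D (\<eta> x) (\<eta> y)"
      using \<theta> xy by (simp add: sm_transformation_def)
    also have "\<dots> = FC F (x, y) \<cdot> tena D (\<theta> x \<cdot> \<eta> x) (\<theta> y \<cdot> \<eta> y)"
      using xy by (simp add: simps cmp_assoc_large interchange_large)
    finally show "(\<lambda>x\<in>obj C. \<theta> x \<cdot> \<eta> x) ?z \<cdot> FC H (x, y) =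
        FC F (x, y) \<cdot> tena D ((\<lambda>x\<in>obj C. \<theta> x \<cdot> \<eta> x) x) ((\<lambda>x\<in>obj C. \<theta> x \<cdot> \<eta> x) y)"
      using xy by (simp add: teno_obj)
  next
    have "\<theta> (unt C) \<cdot> \<eta> (unt C) \<cdot> FU H = \<theta> (unt C) \<cdot> (\<eta> (unt C) \<cdot> FU H)"
      by (simp add: simps cmp_assoc_large)
    then show "(\<lambda>x\<in>obj C. \<theta> x \<cdot> \<eta> x) (unt C) \<cdot> FU H = FU F"
      using \<theta> \<eta> by (simp add: sm_transformation_def unt_obj)
  qed auto
qed

text \<open>Covers both categories of the theorem: for HQFTs, \<open>P\<close> is naturality with respect to cobordisms.\<close>

lemma (in large_monoidal) transformation_category:
  assumes C: "monoidal_signature C"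
    and F: "\<And>\<tau>. \<tau> \<in> T \<Longrightarrow> sm_functor C D (U \<tau>)"
    and P_idt: "\<And>\<tau>. \<tau> \<in> T \<Longrightarrow> P \<tau> \<tau> (\<lambda>x\<in>obj C. idt D (FO (U \<tau>) x))"
    and P_cmp: "\<And>\<tau> \<rho> \<kappa> \<theta> \<eta>. \<tau> \<in> T \<Longrightarrow> \<rho> \<in> T \<Longrightarrow> \<kappa> \<in> T \<Longrightarrow>
      sm_transformation C D (U \<tau>) (U \<rho>) \<theta> \<Longrightarrow> sm_transformation C D (U \<rho>) (U \<kappa>) \<eta> \<Longrightarrow>
      P \<tau> \<rho> \<theta> \<Longrightarrow> P \<rho> \<kappa> \<eta> \<Longrightarrow> P \<tau> \<kappa> (\<lambda>x\<in>obj C. \<theta> x \<cdot> \<eta> x)"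
  shows "category \<lparr> obj = T,
    arr = {(\<tau>, \<rho>, \<theta>). \<tau> \<in> T \<and> \<rho> \<in> T \<and> sm_transformation C D (U \<tau>) (U \<rho>) \<theta> \<and> P \<tau> \<rho> \<theta>},
    source = (\<lambda>(\<tau>, \<rho>, \<theta>). \<tau>), target = (\<lambda>(\<tau>, \<rho>, \<theta>). \<rho>),
    idt = (\<lambda>\<tau>. (\<tau>, \<tau>, \<lambda>x\<in>obj C. idt D (FO (U \<tau>) x))),
    cmp = (\<lambda>(\<tau>, \<rho>, \<theta>) (\<rho>', \<kappa>, \<eta>). (\<tau>, \<kappa>, \<lambda>x\<in>obj C. \<theta> x \<cdot> \<eta> x)) \<rparr>"
proof -
  interpret monoidal_signature C by (rule C)
  have strong: "strong_functor D Ob hom C (U \<tau>)" if "\<tau> \<in> T" for \<tau>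
    by unfold_locales (rule F[OF that])
  note obj = strong_functor.FO_obj[OF strong]
  note id_trans = strong_functor.identity_transformation[OF strong]
  have t: "large (\<theta> x) \<and> source D (\<theta> x) = FO (U \<tau>) x \<and> target D (\<theta> x) = FO (U \<rho>) x"
    if "sm_transformation C D (U \<tau>) (U \<rho>) \<theta>" "x \<in> obj C" for \<tau> \<rho> \<theta> x
    using that hom_arrD[of "\<theta> x"] by (auto simp: sm_transformation_def)
  have ext: "\<theta> \<in> extensional (obj C)" if "sm_transformation C D (U \<tau>) (U \<rho>) \<theta>" for \<tau> \<rho> \<theta>
    using that by (simp add: sm_transformation_def)
  have left: "(\<lambda>x\<in>obj C. (\<lambda>x\<in>obj C. idt D (FO (U \<tau>) x)) x \<cdot> \<theta> x) = \<theta>"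
    and right: "(\<lambda>x\<in>obj C. \<theta> x \<cdot> (\<lambda>x\<in>obj C. idt D (FO (U \<rho>) x)) x) = \<theta>"
    if "sm_transformation C D (U \<tau>) (U \<rho>) \<theta>" for \<tau> \<rho> \<theta>
    by (rule extensionalityI[OF restrict_extensional ext[OF that]],
        use t[OF that] in \<open>simp add: idt_left_large idt_right_large\<close>)+
  have asc: "(\<lambda>x\<in>obj C. (\<lambda>x\<in>obj C. \<theta> x \<cdot> \<eta> x) x \<cdot> \<zeta> x) = (\<lambda>x\<in>obj C. \<theta> x \<cdot> (\<lambda>x\<in>obj C. \<eta> x \<cdot> \<zeta> x) x)"
    if "sm_transformation C D (U \<tau>) (U \<rho>) \<theta>" "sm_transformation C D (U \<rho>) (U \<kappa>) \<eta>" "sm_transformation C D (U \<kappa>) (U \<mu>) \<zeta>"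
    for \<tau> \<rho> \<kappa> \<mu> \<theta> \<eta> \<zeta>
    by (rule restrict_ext) (use t[OF that(1)] t[OF that(2)] t[OF that(3)] in \<open>simp add: cmp_assoc_large\<close>)
  show ?thesis
    unfolding category_def hom_arr_def
    using id_trans P_idt transformation_cmp[OF C F F F] P_cmp left right asc by auto
qed

section \<open>Evaluation of terms\<close>

lemma Diff_simps [simp]:
  "obj (Diff n X x0) = {M. x_manifold n X x0 M}"
  "source (Diff n X x0) (M, N, f) = M" "target (Diff n X x0) (M, N, f) = N"
  "unt (Diff n X x0) = empty_xman" "teno (Diff n X x0) = sum_xman n"
  by (simp_all add: Diff_def)

lemma monoidal_signature_Diff: "monoidal_signature (Diff n X x0)"
  by unfold_locales (auto simp: x_manifold_sum x_manifold_empty, auto simp: Diff_def)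

lemma hom_arr_source_target: "f \<in> arr C \<Longrightarrow> f \<in> hom_arr C (source C f) (target C f)"
  by (simp add: hom_arr_def)

lemma hom_arrE: "f \<in> hom_arr C x y \<Longrightarrow> f \<in> arr C \<and> source C f = x \<and> target C f = y"
  by (simp add: hom_arr_def)

lemma Diff_hom_obj: "\<psi> \<in> hom_arr (Diff n X x0) M N \<Longrightarrow> x_manifold n X x0 M \<and> x_manifold n X x0 N"
  by (auto simp: hom_arr_def Diff_def)

section \<open>Endpoints and values of terms\<close>

text \<open>The value of a product needs the objects at which c is taken, and
  \<open>eval_term\<close> has no typing derivation to read them from. They are therefore computed
  from the term itself.\<close>

primrec term_source :: "nat \<Rightarrow> ('u, 'x) hterm \<Rightarrow> ('u, 'x) xman" where
  "term_source n (TDiff \<psi>) = fst \<psi>"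
| "term_source n (TCob W) = src W"
| "term_source n (TComp s t) = term_source n s"
| "term_source n (TTen s t) = sum_xman n (term_source n s) (term_source n t)"

primrec term_target :: "nat \<Rightarrow> ('u, 'x) hterm \<Rightarrow> ('u, 'x) xman" where
  "term_target n (TDiff \<psi>) = fst (snd \<psi>)"
| "term_target n (TCob W) = tgt W"
| "term_target n (TComp s t) = term_target n t"
| "term_target n (TTen s t) = sum_xman n (term_target n s) (term_target n t)"

lemma htyped_endpoints: "htyped n X x0 s M N \<Longrightarrow> M = term_source n s \<and> N = term_target n s"
  by (induction rule: htyped.induct) (auto simp: hom_arr_def Diff_def)

lemma htyped_unique: "htyped n X x0 s M N \<Longrightarrow> htyped n X x0 s M' N' \<Longrightarrow> M' = M \<and> N' = N"
  using htyped_endpoints by metis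

lemma htyped_obj: "htyped n X x0 s M N \<Longrightarrow> x_manifold n X x0 M \<and> x_manifold n X x0 N"
  by (induction rule: htyped.induct) (auto simp: x_manifold_sum x_cobordism_def dest: Diff_hom_obj)

primrec (in large_monoidal) eval_term ::
  "nat \<Rightarrow> (('u, 'x) xman, ('u, 'x) xdiff, 'p, 'b) smfun \<Rightarrow> (('u, 'x) xcob \<Rightarrow> 'b) \<Rightarrow> ('u, 'x) hterm \<Rightarrow> 'b" where
  "eval_term n G K (TDiff \<psi>) = FA G \<psi>"
| "eval_term n G K (TCob W) = K W"
| "eval_term n G K (TComp s t) = eval_term n G K s \<cdot> eval_term n G K t"
| "eval_term n G K (TTen s t) =
     FC G (term_source n s, term_source n t) \<cdot> tena D (eval_term n G K s) (eval_term n G K t) \<cdot>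
     inverse_arr (FC G (term_target n s, term_target n t))"

text \<open>By \<open>is_hqft_iff\<close> these conditions, with extensionality of
  \<open>CF\<close>, characterise HQFTs. The compatibility of the empty cobordism with u is
  recovered from \<open>K_cylinder\<close>.\<close>

locale cobordism_theory = strong_functor D Ob hom "Diff n X x0" G
  for D :: "('p, 'b) smcat" (structure) and Ob hom and n and X :: "'x topology" and x0
    and G :: "(('u, 'x) xman, ('u, 'x) xdiff, 'p, 'b) smfun" +
  fixes K :: "('u, 'x) xcob \<Rightarrow> 'b"
  assumes K_hom: "x_cobordism n X x0 W \<Longrightarrow> K W \<in> hom_arr D (FO G (src W)) (FO G (tgt W))"
    and K_gluing: "gluing n X x0 W \<psi> V U \<Longrightarrow> K U = K W \<cdot> FA G \<psi> \<cdot> K V"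
    and K_cylinder: "is_cylinder n X x0 M W \<Longrightarrow> K W = idt D (FO G M)"
    and K_sum: "x_cobordism n X x0 W \<Longrightarrow> x_cobordism n X x0 V \<Longrightarrow>
      K (sum_xcob n W V) \<cdot> FC G (tgt W, tgt V) = FC G (src W, src V) \<cdot> tena D (K W) (K V)"
    and K_diffeo: "cob_diffeo n X x0 W V \<Psi> \<Longrightarrow>
      K W \<cdot> FA G (restr_out W V \<Psi>) = FA G (restr_in W V \<Psi>) \<cdot> K V"
begin

abbreviation ev where "ev \<equiv> eval_term n G K"
abbreviation typed where "typed \<equiv> htyped n X x0"

lemma FC_man:
  assumes "x_manifold n X x0 M" "x_manifold n X x0 N"
  shows "large (FC G (M, N))" "source D (FC G (M, N)) = FO G (sum_xman n M N)"
    "target D (FC G (M, N)) = teno D (FO G M) (FO G N)" "has_right_inverse (FC G (M, N))"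
  using assms FC_large[of M N] FC_iso[of M N] by (simp_all add: iso_has_right_inverse)

lemma FO_large: "x_manifold n X x0 M \<Longrightarrow> FO G M \<in> Ob"
  using FO_obj[of M] by (simp add: obj_large)

lemma FA_diff:
  assumes "\<psi> \<in> hom_arr (Diff n X x0) M N"
  shows "large (FA G \<psi>)" "source D (FA G \<psi>) = FO G M" "target D (FA G \<psi>) = FO G N"
  using FA_large[of \<psi>] hom_arrE[OF assms] by auto

lemma ev_hom: "typed s M N \<Longrightarrow> ev s \<in> hom_arr D (FO G M) (FO G N)"
proof (induction rule: htyped.induct)
  case (diff \<psi> M N)
  then show ?case
    using FA_diff[OF diff] FO_obj Diff_hom_obj[OF diff] by (auto intro: hom_arrI)
next
  case (cob W)
  then show ?case
    by (simp add: K_hom)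
next
  case (comp s M N t P)
  then show ?case
    using hom_arrD[OF comp(3)] hom_arrD[OF comp(4)] by (auto intro!: hom_arrI simp: large_cmp)
next
  case (ten s M N t M' N')
  have o: "x_manifold n X x0 M" "x_manifold n X x0 N" "x_manifold n X x0 M'" "x_manifold n X x0 N'"
    using htyped_obj[OF ten(1)] htyped_obj[OF ten(2)] by auto
  have e: "term_source n s = M" "term_target n s = N" "term_source n t = M'" "term_target n t = N'"
    using htyped_endpoints[OF ten(1)] htyped_endpoints[OF ten(2)] by auto
  note i = inverse_arr[OF FC_iso[of N N']]
  show ?case
    using hom_arrD[OF ten(3)] hom_arrD[OF ten(4)] o i FO_obj
    by (auto intro!: hom_arrI simp: large_simps e FC_man x_manifold_sum)
qed

lemma ev_large:
  assumes "typed s M N"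
  shows "large (ev s)" "source D (ev s) = FO G M" "target D (ev s) = FO G N"
  using hom_arrD[OF ev_hom[OF assms]] by auto

text \<open>The defining formula with the inverse of c moved to the other side, so that the value of
  a product is handled through a naturality square.\<close>

lemma ev_ten:
  assumes s: "typed s M N" and t: "typed t M' N'"
  shows "ev (TTen s t) \<cdot> FC G (N, N') = FC G (M, M') \<cdot> tena D (ev s) (ev t)"
proof -
  have o: "x_manifold n X x0 M" "x_manifold n X x0 N" "x_manifold n X x0 M'" "x_manifold n X x0 N'"
    using htyped_obj[OF s] htyped_obj[OF t] by auto
  have e: "term_source n s = M" "term_target n s = N" "term_source n t = M'" "term_target n t = N'"
    using htyped_endpoints[OF s] htyped_endpoints[OF t] by auto
  note i = inverse_arr[OF FC_iso[of N N']]
  show ?thesis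
    using i o by (simp add: e FC_man ev_large[OF s] ev_large[OF t] cmp_assoc_large large_simps)
qed

text \<open>Since c can be cancelled, the naturality square determines the value of a product.
  Relations with a product of terms on one side are checked in this form.\<close>

lemma ev_ten_eqI:
  assumes s: "typed s M N" and t: "typed t M' N'"
    and f: "f \<in> hom_arr D (FO G (sum_xman n M M')) (FO G (sum_xman n N N'))"
    and eq: "f \<cdot> FC G (N, N') = FC G (M, M') \<cdot> tena D (ev s) (ev t)"
  shows "ev (TTen s t) = f"
proof (rule cancel_right)
  have o: "x_manifold n X x0 N" "x_manifold n X x0 N'"
    using htyped_obj[OF s] htyped_obj[OF t] by auto
  show "has_right_inverse (FC G (N, N'))"
    using FC_man[OF o] by simp
  show "large (ev (TTen s t))" "target D (ev (TTen s t)) = source D (FC G (N, N'))"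
    "large f" "target D f = source D (FC G (N, N'))"
    using ev_large[OF htyped.ten[OF s t]] hom_arrD[OF f] FC_man[OF o] by auto
  show "ev (TTen s t) \<cdot> FC G (N, N') = f \<cdot> FC G (N, N')"
    by (simp only: ev_ten[OF s t] eq)
qed

text \<open>Both sides are compared after composing with the iterated isomorphism
  \<open>?\<delta>\<close> at the targets. There naturality of c in both bracketings and
  \<open>FC_assoc\<close> reduce the claim to naturality of the associator of
  \<open>D\<close>.\<close>

lemma ev_assoc_natural:
  assumes r: "typed r L L'" and s: "typed s M M'" and t: "typed t N N'"
  shows "ev (TComp (TTen (TTen r s) t) (TDiff (assoc (Diff n X x0) L' M' N'))) =
    ev (TComp (TDiff (assoc (Diff n X x0) L M N)) (TTen r (TTen s t)))"
proof -
  let ?a = "assoc (Diff n X x0)" and ?S = "sum_xman n"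
  \<comment> \<open>the two iterated comparison isomorphisms, related by the associators through \<open>FC_assoc\<close>\<close>
  let ?\<gamma> = "\<lambda>L M N. FC G (?S L M, N) \<cdot> tena D (FC G (L, M)) (idt D (FO G N))"
  let ?\<delta> = "\<lambda>L M N. FC G (L, ?S M N) \<cdot> tena D (idt D (FO G L)) (FC G (M, N))"
  let ?c = "tena D (ev r) (tena D (ev s) (ev t))" and ?b = "tena D (tena D (ev r) (ev s)) (ev t)"
  let ?aD = "assoc D (FO G L) (FO G M) (FO G N)" and ?aD' = "assoc D (FO G L') (FO G M') (FO G N')"
  have o: "x_manifold n X x0 L" "x_manifold n X x0 M" "x_manifold n X x0 N"
    "x_manifold n X x0 L'" "x_manifold n X x0 M'" "x_manifold n X x0 N'"
    using htyped_obj[OF r] htyped_obj[OF s] htyped_obj[OF t] by auto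
  note rs = htyped.ten[OF r s] and st = htyped.ten[OF s t]
  note rst = htyped.ten[OF rs t] and rst' = htyped.ten[OF r st]
  note l = ev_large[OF r] ev_large[OF s] ev_large[OF t] ev_large[OF rs] ev_large[OF st]
    ev_large[OF rst] ev_large[OF rst']
  note a = FA_diff[OF Diff_assoc[OF o(1-3)]] and a' = FA_diff[OF Diff_assoc[OF o(4-6)]]
  note simps = l a a' large_simps FC_man FO_large o x_manifold_sum
  have "ev (TTen (TTen r s) t) \<cdot> ?\<gamma> L' M' N' =
      (ev (TTen (TTen r s) t) \<cdot> FC G (?S L' M', N')) \<cdot> tena D (FC G (L', M')) (idt D (FO G N'))"
    by (simp add: simps cmp_assoc_large del: eval_term.simps)
  also have "\<dots> = FC G (?S L M, N) \<cdot> (tena D (ev (TTen r s)) (ev t) \<cdot> tena D (FC G (L', M')) (idt D (FO G N')))"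
    unfolding ev_ten[OF rs t] by (simp add: simps cmp_assoc_large del: eval_term.simps)
  also have "\<dots> = FC G (?S L M, N) \<cdot> tena D (ev (TTen r s) \<cdot> FC G (L', M')) (ev t)"
    by (simp add: simps interchange_large del: eval_term.simps)
  also have "\<dots> = FC G (?S L M, N) \<cdot> (tena D (FC G (L, M)) (idt D (FO G N)) \<cdot> ?b)"
    unfolding ev_ten[OF r s] by (simp add: simps interchange_large del: eval_term.simps)
  finally have 1: "ev (TTen (TTen r s) t) \<cdot> ?\<gamma> L' M' N' = ?\<gamma> L M N \<cdot> ?b"
    by (simp add: simps cmp_assoc_large del: eval_term.simps)
  have "ev (TTen r (TTen s t)) \<cdot> ?\<delta> L' M' N' =
      (ev (TTen r (TTen s t)) \<cdot> FC G (L', ?S M' N')) \<cdot> tena D (idt D (FO G L')) (FC G (M', N'))"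
    by (simp add: simps cmp_assoc_large del: eval_term.simps)
  also have "\<dots> = FC G (L, ?S M N) \<cdot> (tena D (ev r) (ev (TTen s t)) \<cdot> tena D (idt D (FO G L')) (FC G (M', N')))"
    unfolding ev_ten[OF r st] by (simp add: simps cmp_assoc_large del: eval_term.simps)
  also have "\<dots> = FC G (L, ?S M N) \<cdot> tena D (ev r) (ev (TTen s t) \<cdot> FC G (M', N'))"
    by (simp add: simps interchange_large del: eval_term.simps)
  also have "\<dots> = FC G (L, ?S M N) \<cdot> (tena D (idt D (FO G L)) (FC G (M, N)) \<cdot> ?c)"
    unfolding ev_ten[OF s t] by (simp add: simps interchange_large del: eval_term.simps)
  finally have 2: "ev (TTen r (TTen s t)) \<cdot> ?\<delta> L' M' N' = ?\<delta> L M N \<cdot> ?c"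
    by (simp add: simps cmp_assoc_large del: eval_term.simps)
  have 3: "FA G (?a L M N) \<cdot> ?\<delta> L M N = ?\<gamma> L M N \<cdot> ?aD"
    using FC_assoc[of L M N] o by (simp add: simps cmp_assoc_large)
  have q: "FA G (?a L' M' N') \<cdot> ?\<delta> L' M' N' = ?\<gamma> L' M' N' \<cdot> ?aD'"
    using FC_assoc[of L' M' N'] o by (simp add: simps cmp_assoc_large)
  have 4: "?b \<cdot> ?aD' = ?aD \<cdot> ?c"
    using assoc_natural_large[of "ev r" "ev s" "ev t"] l by simp
  let ?f = "ev (TTen (TTen r s) t) \<cdot> FA G (?a L' M' N')"
  let ?g = "FA G (?a L M N) \<cdot> ev (TTen r (TTen s t))"
  have "?f \<cdot> ?\<delta> L' M' N' = ev (TTen (TTen r s) t) \<cdot> (FA G (?a L' M' N') \<cdot> ?\<delta> L' M' N')"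
    by (simp add: simps cmp_assoc_large del: eval_term.simps)
  also have "\<dots> = ev (TTen (TTen r s) t) \<cdot> ?\<gamma> L' M' N' \<cdot> ?aD'"
    unfolding q by (simp add: simps cmp_assoc_large del: eval_term.simps)
  also have "\<dots> = ?\<gamma> L M N \<cdot> (?b \<cdot> ?aD')"
    unfolding 1 by (simp add: simps cmp_assoc_large del: eval_term.simps)
  also have "\<dots> = ?\<gamma> L M N \<cdot> ?aD \<cdot> ?c"
    unfolding 4 by (simp add: simps cmp_assoc_large del: eval_term.simps)
  also have "\<dots> = FA G (?a L M N) \<cdot> (?\<delta> L M N \<cdot> ?c)"
    unfolding 3[symmetric] by (simp add: simps cmp_assoc_large del: eval_term.simps)
  also have "\<dots> = ?g \<cdot> ?\<delta> L' M' N'"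
    unfolding 2[symmetric] by (simp add: simps cmp_assoc_large del: eval_term.simps)
  finally have eq: "?f \<cdot> FC G (L', ?S M' N') \<cdot> tena D (idt D (FO G L')) (FC G (M', N')) =
      ?g \<cdot> FC G (L', ?S M' N') \<cdot> tena D (idt D (FO G L')) (FC G (M', N'))"
    by (simp add: simps cmp_assoc_large del: eval_term.simps)
  \<comment> \<open>The two factors of \<open>?\<delta>\<close> are cancelled one at a time. The
    first to go is a tensor product with an identity, for which a right inverse exists in the large
    category.\<close>
  have "?f \<cdot> FC G (L', ?S M' N') = ?g \<cdot> FC G (L', ?S M' N')"
    by (rule cancel_right[OF _ _ _ _ _ eq])
      (simp_all add: simps tena_has_right_inverse idt_has_right_inverse del: eval_term.simps)
  then have "?f = ?g"
    by (rule cancel_right[rotated -1]) (simp_all add: simps del: eval_term.simps)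
  then show ?thesis
    by simp
qed

lemma ev_lunit_natural:
  assumes s: "typed s M N"
  shows "ev (TComp (TTen (TDiff (idt (Diff n X x0) empty_xman)) s) (TDiff (lunit (Diff n X x0) N))) =
    ev (TComp (TDiff (lunit (Diff n X x0) M)) s)"
proof -
  let ?e = "empty_xman :: ('u, 'x) xman"
  let ?i = "TDiff (idt (Diff n X x0) ?e)"
  have o: "x_manifold n X x0 M" "x_manifold n X x0 N" "x_manifold n X x0 ?e"
    using htyped_obj[OF s] x_manifold_empty by auto
  note i = htyped.diff[OF Diff_idt[OF o(3)]]
  note l = ev_large[OF s] ev_large[OF htyped.ten[OF i s]]
  note u = FU_large[unfolded Diff_simps]
  note simps = l u large_simps FC_man FO_large o
  have id: "ev ?i = idt D (FO G ?e)"
    using FA_idt[of ?e] o by simp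
  have "ev (TTen ?i s) \<cdot> FA G (lunit (Diff n X x0) N) =
      (ev (TTen ?i s) \<cdot> FC G (?e, N)) \<cdot> tena D (FU G) (idt D (FO G N)) \<cdot> lunit D (FO G N)"
    using FC_lunit[of N] o by (simp add: simps cmp_assoc_large del: eval_term.simps)
  also have "\<dots> = FC G (?e, M) \<cdot> (tena D (idt D (FO G ?e)) (ev s) \<cdot> tena D (FU G) (idt D (FO G N))) \<cdot> lunit D (FO G N)"
    unfolding ev_ten[OF i s] id by (simp add: simps cmp_assoc_large)
  \<comment> \<open>The isomorphism u and the value of \<open>s\<close> act on different factors, so
    they can be exchanged by the interchange law.\<close>
  also have "tena D (idt D (FO G ?e)) (ev s) \<cdot> tena D (FU G) (idt D (FO G N)) =
      tena D (FU G) (idt D (FO G M)) \<cdot> tena D (idt D (unt D)) (ev s)"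
    by (simp add: simps interchange_large)
  also have "FC G (?e, M) \<cdot> \<dots> \<cdot> lunit D (FO G N) =
      FC G (?e, M) \<cdot> tena D (FU G) (idt D (FO G M)) \<cdot> (tena D (idt D (unt D)) (ev s) \<cdot> lunit D (FO G N))"
    by (simp add: simps cmp_assoc_large)
  also have "tena D (idt D (unt D)) (ev s) \<cdot> lunit D (FO G N) = lunit D (FO G M) \<cdot> ev s"
    using lunit_natural_large[of "ev s"] l by simp
  also have "FC G (?e, M) \<cdot> tena D (FU G) (idt D (FO G M)) \<cdot> \<dots> = FA G (lunit (Diff n X x0) M) \<cdot> ev s"
    using FC_lunit[of M] o by (simp add: simps cmp_assoc_large)
  finally show ?thesis
    by simp
qed

lemma ev_runit_natural:
  assumes s: "typed s M N"
  shows "ev (TComp (TTen s (TDiff (idt (Diff n X x0) empty_xman))) (TDiff (runit (Diff n X x0) N))) =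
    ev (TComp (TDiff (runit (Diff n X x0) M)) s)"
proof -
  let ?e = "empty_xman :: ('u, 'x) xman"
  let ?i = "TDiff (idt (Diff n X x0) ?e)"
  have o: "x_manifold n X x0 M" "x_manifold n X x0 N" "x_manifold n X x0 ?e"
    using htyped_obj[OF s] x_manifold_empty by auto
  note i = htyped.diff[OF Diff_idt[OF o(3)]]
  note l = ev_large[OF s] ev_large[OF htyped.ten[OF s i]]
  note u = FU_large[unfolded Diff_simps]
  note simps = l u large_simps FC_man FO_large o
  have id: "ev ?i = idt D (FO G ?e)"
    using FA_idt[of ?e] o by simp
  have "ev (TTen s ?i) \<cdot> FA G (runit (Diff n X x0) N) =
      (ev (TTen s ?i) \<cdot> FC G (N, ?e)) \<cdot> tena D (idt D (FO G N)) (FU G) \<cdot> runit D (FO G N)"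
    using FC_runit[of N] o by (simp add: simps cmp_assoc_large del: eval_term.simps)
  also have "\<dots> = FC G (M, ?e) \<cdot> (tena D (ev s) (idt D (FO G ?e)) \<cdot> tena D (idt D (FO G N)) (FU G)) \<cdot> runit D (FO G N)"
    unfolding ev_ten[OF s i] id by (simp add: simps cmp_assoc_large)
  also have "tena D (ev s) (idt D (FO G ?e)) \<cdot> tena D (idt D (FO G N)) (FU G) =
      tena D (idt D (FO G M)) (FU G) \<cdot> tena D (ev s) (idt D (unt D))"
    by (simp add: simps interchange_large)
  also have "FC G (M, ?e) \<cdot> \<dots> \<cdot> runit D (FO G N) =
      FC G (M, ?e) \<cdot> tena D (idt D (FO G M)) (FU G) \<cdot> (tena D (ev s) (idt D (unt D)) \<cdot> runit D (FO G N))"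
    by (simp add: simps cmp_assoc_large)
  also have "tena D (ev s) (idt D (unt D)) \<cdot> runit D (FO G N) = runit D (FO G M) \<cdot> ev s"
    using runit_natural_large[of "ev s"] l by simp
  also have "FC G (M, ?e) \<cdot> tena D (idt D (FO G M)) (FU G) \<cdot> \<dots> = FA G (runit (Diff n X x0) M) \<cdot> ev s"
    using FC_runit[of M] o by (simp add: simps cmp_assoc_large)
  finally show ?thesis
    by simp
qed

lemma ev_symm_natural:
  assumes s: "typed s M N" and t: "typed t M' N'"
  shows "ev (TComp (TTen s t) (TDiff (symm (Diff n X x0) N N'))) =
    ev (TComp (TDiff (symm (Diff n X x0) M M')) (TTen t s))"
proof -
  let ?\<sigma> = "FA G (symm (Diff n X x0) M M')" and ?\<sigma>' = "FA G (symm (Diff n X x0) N N')"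
  have o: "x_manifold n X x0 M" "x_manifold n X x0 N" "x_manifold n X x0 M'" "x_manifold n X x0 N'"
    using htyped_obj[OF s] htyped_obj[OF t] by auto
  note l = ev_large[OF s] ev_large[OF t] ev_large[OF htyped.ten[OF s t]] ev_large[OF htyped.ten[OF t s]]
  note a = FA_diff[OF Diff_symm[OF o(1,3)]] FA_diff[OF Diff_symm[OF o(2,4)]]
  note simps = l a large_simps FC_man FO_large o
  have "ev (TTen s t) \<cdot> ?\<sigma>' \<cdot> FC G (N', N) = ev (TTen s t) \<cdot> (?\<sigma>' \<cdot> FC G (N', N))"
    by (simp add: simps cmp_assoc_large del: eval_term.simps)
  also have "\<dots> = ev (TTen s t) \<cdot> FC G (N, N') \<cdot> symm D (FO G N) (FO G N')"
    using FC_symm[of N N'] o by (simp add: simps cmp_assoc_large del: eval_term.simps)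
  also have "\<dots> = FC G (M, M') \<cdot> (tena D (ev s) (ev t) \<cdot> symm D (FO G N) (FO G N'))"
    unfolding ev_ten[OF s t] by (simp add: simps cmp_assoc_large)
  also have "tena D (ev s) (ev t) \<cdot> symm D (FO G N) (FO G N') =
      symm D (FO G M) (FO G M') \<cdot> tena D (ev t) (ev s)"
    using symm_natural_large[of "ev s" "ev t"] l by simp
  also have "FC G (M, M') \<cdot> \<dots> = (FC G (M, M') \<cdot> symm D (FO G M) (FO G M')) \<cdot> tena D (ev t) (ev s)"
    by (simp add: simps cmp_assoc_large)
  also have "\<dots> = ?\<sigma> \<cdot> FC G (M', M) \<cdot> tena D (ev t) (ev s)"
    using FC_symm[of M M'] o by simp
  also have "\<dots> = ?\<sigma> \<cdot> (ev (TTen t s) \<cdot> FC G (N', N))"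
    unfolding ev_ten[OF t s] by (simp add: simps cmp_assoc_large)
  also have "\<dots> = ?\<sigma> \<cdot> ev (TTen t s) \<cdot> FC G (N', N)"
    by (simp add: simps cmp_assoc_large del: eval_term.simps)
  finally have eq: "ev (TTen s t) \<cdot> ?\<sigma>' \<cdot> FC G (N', N) = ?\<sigma> \<cdot> ev (TTen t s) \<cdot> FC G (N', N)" .
  have "ev (TTen s t) \<cdot> ?\<sigma>' = ?\<sigma> \<cdot> ev (TTen t s)"
    by (rule cancel_right[OF _ _ _ _ _ eq]) (simp_all add: simps del: eval_term.simps)
  then show ?thesis
    by simp
qed

text \<open>The common endpoints belong to the induction hypothesis because \<open>hrel\<close> does
  not record types: transitivity joins two equalities only after the types of the middle term are
  identified, by uniqueness of types.\<close>

lemma ev_sound: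
  "hrel n X x0 s t \<Longrightarrow> \<exists>M N. typed s M N \<and> typed t M N \<and> ev s = ev t"
proof (induction rule: hrel.induct)
  case (refl s M N)
  then show ?case by blast
next
  case (sym s t)
  then show ?case by metis
next
  case (trans s t r)
  then show ?case using htyped_unique by metis
next
  case (comp_cong s s' t t' M N P)
  then show ?case by (metis eval_term.simps(3) htyped.comp)
next
  case (ten_cong s s' t t' M N M' N')
  \<comment> \<open>The isomorphisms c in the two values are the same because related factors have
    the same endpoints.\<close>
  have "ev (TTen s t) = ev (TTen s' t')"
    using ten_cong htyped_endpoints by (metis eval_term.simps(4))
  then show ?case
    using htyped.ten[OF ten_cong.hyps(3,5)] htyped.ten[OF ten_cong.hyps(4,6)] by blast
next
  case (comp_assoc r M N s P t Q)
  then have "ev (TComp (TComp r s) t) = ev (TComp r (TComp s t))"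
    by (simp add: cmp_assoc_large ev_large[OF comp_assoc(1)] ev_large[OF comp_assoc(2)] ev_large[OF comp_assoc(3)])
  then show ?case
    using comp_assoc htyped.comp by metis
next
  case (id_left s M N)
  have M: "x_manifold n X x0 M"
    using htyped_obj[OF id_left] by simp
  then have "ev (TComp (TDiff (idt (Diff n X x0) M)) s) = ev s"
    using FA_idt[of M] by (simp add: idt_left_large ev_large[OF id_left])
  then show ?case
    using id_left htyped.comp[OF htyped.diff[OF Diff_idt[OF M]] id_left] by blast
next
  case (id_right s M N)
  have N: "x_manifold n X x0 N"
    using htyped_obj[OF id_right] by simp
  then have "ev (TComp s (TDiff (idt (Diff n X x0) N))) = ev s"
    using FA_idt[of N] by (simp add: idt_right_large ev_large[OF id_right])
  then show ?case
    using id_right htyped.comp[OF id_right htyped.diff[OF Diff_idt[OF N]]] by blast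
next
  case (interchange s M N s' P t M' N' t' P')
  note s = interchange(1,2) and t = interchange(3,4)
  have o: "x_manifold n X x0 M" "x_manifold n X x0 N" "x_manifold n X x0 P"
    "x_manifold n X x0 M'" "x_manifold n X x0 N'" "x_manifold n X x0 P'"
    using interchange htyped_obj by metis+
  note T = htyped.ten[OF s(1) t(1)] htyped.ten[OF s(2) t(2)]
  note l = ev_large[OF s(1)] ev_large[OF s(2)] ev_large[OF t(1)] ev_large[OF t(2)] ev_large[OF T(1)] ev_large[OF T(2)]
  note simps = l large_simps FC_man FO_large o
  note C = htyped.comp[OF s] htyped.comp[OF t]
  have "ev (TTen (TComp s s') (TComp t t')) = ev (TComp (TTen s t) (TTen s' t'))"
  proof (rule ev_ten_eqI[OF C])
    show "ev (TComp (TTen s t) (TTen s' t')) \<in> hom_arr D (FO G (sum_xman n M M')) (FO G (sum_xman n P P'))"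
      by (rule ev_hom[OF htyped.comp[OF T]])
    have "ev (TComp (TTen s t) (TTen s' t')) \<cdot> FC G (P, P') = ev (TTen s t) \<cdot> (ev (TTen s' t') \<cdot> FC G (P, P'))"
      unfolding eval_term.simps(3) by (simp add: simps cmp_assoc_large del: eval_term.simps)
    also have "\<dots> = (ev (TTen s t) \<cdot> FC G (N, N')) \<cdot> tena D (ev s') (ev t')"
      unfolding ev_ten[OF s(2) t(2)] by (simp add: simps cmp_assoc_large del: eval_term.simps)
    also have "\<dots> = FC G (M, M') \<cdot> tena D (ev s \<cdot> ev s') (ev t \<cdot> ev t')"
      unfolding ev_ten[OF s(1) t(1)] by (simp add: simps cmp_assoc_large interchange_large)
    finally show "ev (TComp (TTen s t) (TTen s' t')) \<cdot> FC G (P, P') =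
        FC G (M, M') \<cdot> tena D (ev (TComp s s')) (ev (TComp t t'))"
      by simp
  qed
  then show ?case
    using htyped.comp[OF T] htyped.ten[OF C] by metis
next
  case (ten_diff \<psi> \<xi>)
  note h = hom_arr_source_target[OF ten_diff(1)] hom_arr_source_target[OF ten_diff(2)]
  note t = htyped.diff[OF h(1)] htyped.diff[OF h(2)] htyped.diff[OF Diff_tena[OF h]]
  have "ev (TTen (TDiff \<psi>) (TDiff \<xi>)) = ev (TDiff (tena (Diff n X x0) \<psi> \<xi>))"
    by (rule ev_ten_eqI[OF t(1,2) ev_hom[OF t(3)]]) (simp add: FC_natural ten_diff)
  then show ?case
    using htyped.ten[OF t(1,2)] t(3) by blast
next
  case (ten_cob W V)
  note t = htyped.cob[OF ten_cob(1)] htyped.cob[OF ten_cob(2)] htyped.cob[OF x_cobordism_sum[OF ten_cob]]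
  have st: "src (sum_xcob n W V) = sum_xman n (src W) (src V)" "tgt (sum_xcob n W V) = sum_xman n (tgt W) (tgt V)"
    by (simp_all add: sum_xcob_def)
  have "ev (TTen (TCob W) (TCob V)) = ev (TCob (sum_xcob n W V))"
    by (rule ev_ten_eqI[OF t(1,2) ev_hom[OF t(3), unfolded st]]) (simp add: K_sum ten_cob)
  then show ?case
    using htyped.ten[OF t(1,2)] t(3)[unfolded st] by blast
next
  case (comp_diff \<psi> M N \<xi> P)
  have "ev (TComp (TDiff \<psi>) (TDiff \<xi>)) = ev (TDiff (\<psi> \<cdot>\<^bsub>Diff n X x0\<^esub> \<xi>))"
    using FA_cmp[of \<psi> \<xi>] hom_arrE[OF comp_diff(1)] hom_arrE[OF comp_diff(2)] by simp
  then show ?case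
    using htyped.comp[OF htyped.diff[OF comp_diff(1)] htyped.diff[OF comp_diff(2)]]
      htyped.diff[OF Diff_cmp[OF comp_diff]] by blast
next
  case (assoc_nat r L L' s M M' t N N')
  then have "x_manifold n X x0 L" "x_manifold n X x0 M" "x_manifold n X x0 N"
    "x_manifold n X x0 L'" "x_manifold n X x0 M'" "x_manifold n X x0 N'"
    using htyped_obj by metis+
  then show ?case
    using ev_assoc_natural[OF assoc_nat] assoc_nat
    by (blast intro: htyped.comp htyped.ten htyped.diff Diff_assoc)
next
  case (lunit_nat s M N)
  then have "x_manifold n X x0 M" "x_manifold n X x0 N"
    using htyped_obj by metis+
  then show ?case
    using ev_lunit_natural[OF lunit_nat] lunit_nat
    by (blast intro: htyped.comp htyped.ten htyped.diff Diff_lunit Diff_idt x_manifold_empty)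
next
  case (runit_nat s M N)
  then have "x_manifold n X x0 M" "x_manifold n X x0 N"
    using htyped_obj by metis+
  then show ?case
    using ev_runit_natural[OF runit_nat] runit_nat
    by (blast intro: htyped.comp htyped.ten htyped.diff Diff_runit Diff_idt x_manifold_empty)
next
  case (symm_nat s M N t M' N')
  then have "x_manifold n X x0 M" "x_manifold n X x0 M'" "x_manifold n X x0 N" "x_manifold n X x0 N'"
    using htyped_obj by metis+
  then show ?case
    using ev_symm_natural[OF symm_nat] symm_nat
    by (blast intro: htyped.comp htyped.ten htyped.diff Diff_symm)
next
  case (cob_diffeo W V \<Psi>)
  then have W: "x_cobordism n X x0 W" "x_cobordism n X x0 V"
    and r: "restr_in W V \<Psi> \<in> hom_arr (Diff n X x0) (src W) (src V)"
      "restr_out W V \<Psi> \<in> hom_arr (Diff n X x0) (tgt W) (tgt V)"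
    by (simp_all add: cob_diffeo_def hom_arr_def restr_in_def restr_out_def)
  show ?case
    using htyped.comp[OF htyped.cob[OF W(1)] htyped.diff[OF r(2)]]
      htyped.comp[OF htyped.diff[OF r(1)] htyped.cob[OF W(2)]] K_diffeo[OF cob_diffeo]
    by (metis eval_term.simps(1-3))
next
  case (gluing W \<psi> V U)
  then have W: "x_cobordism n X x0 W" "x_cobordism n X x0 V" "x_cobordism n X x0 U"
    "src U = src W" "tgt U = tgt V" "\<psi> \<in> hom_arr (Diff n X x0) (tgt W) (src V)"
    by (simp_all add: gluing_def)
  show ?case
    using htyped.comp[OF htyped.comp[OF htyped.cob[OF W(1)] htyped.diff[OF W(6)]] htyped.cob[OF W(2)]]
      htyped.cob[OF W(3)] K_gluing[OF gluing] W(4,5) by (metis eval_term.simps(1-3))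
next
  case (cylinder M W)
  then have W: "x_cobordism n X x0 W" "src W = M" "tgt W = M"
    by (simp_all add: is_cylinder_def)
  then have M: "x_manifold n X x0 M"
    by (simp add: x_cobordism_def)
  show ?case
    using htyped.cob[OF W(1)] htyped.diff[OF Diff_idt[OF M]] W K_cylinder[OF cylinder] FA_idt[of M] M
    by (metis Diff_simps(1) eval_term.simps(1,2) mem_Collect_eq)
qed

end

section \<open>The homotopy cobordism category\<close>

lemma HCobord_simps [simp]:
  "obj (HCobord n X x0) = {M. x_manifold n X x0 M}"
  "source (HCobord n X x0) (M, N, A) = M" "target (HCobord n X x0) (M, N, A) = N"
  "unt (HCobord n X x0) = empty_xman" "teno (HCobord n X x0) = sum_xman n"
  "idt (HCobord n X x0) M = diff_class n X x0 (idt (Diff n X x0) M)"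
  "assoc (HCobord n X x0) L M N = diff_class n X x0 (assoc (Diff n X x0) L M N)"
  "lunit (HCobord n X x0) M = diff_class n X x0 (lunit (Diff n X x0) M)"
  "runit (HCobord n X x0) M = diff_class n X x0 (runit (Diff n X x0) M)"
  "symm (HCobord n X x0) M N = diff_class n X x0 (symm (Diff n X x0) M N)"
  by (simp_all add: HCobord_def)

lemma hclass_endpoints [simp]:
  "source (HCobord n X x0) (hclass n X x0 M N s) = M" "target (HCobord n X x0) (hclass n X x0 M N s) = N"
  by (simp_all add: hclass_def)

lemma hclass_arr: "htyped n X x0 s M N \<Longrightarrow> hclass n X x0 M N s \<in> arr (HCobord n X x0)"
  by (auto simp: HCobord_def)

lemma HCobord_arrE:
  assumes "f \<in> arr (HCobord n X x0)"
  obtains M N s where "f = hclass n X x0 M N s" "htyped n X x0 s M N"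
  using assms by (auto simp: HCobord_def)

lemma hclass_cong: "hrel n X x0 s t \<Longrightarrow> hclass n X x0 M N s = hclass n X x0 M N t"
  unfolding hclass_def by (blast intro: hrel.sym hrel.trans)

lemma hclass_eqD: "hclass n X x0 M N s = hclass n X x0 M N t \<Longrightarrow> htyped n X x0 t M N \<Longrightarrow> hrel n X x0 s t"
  unfolding hclass_def using hrel.refl[of n X x0 t M N] by blast

text \<open>The composite of classes is closed up under \<open>hrel\<close> over all pairs of
  representatives; by the congruence rule a single pair already gives everything.\<close>

lemma cmp_hclass:
  assumes s: "htyped n X x0 s M N" and t: "htyped n X x0 t N P"
  shows "hclass n X x0 M N s \<cdot>\<^bsub>HCobord n X x0\<^esub> hclass n X x0 N P t = hclass n X x0 M P (TComp s t)"
proof -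
  have "hrel n X x0 (TComp s t) r"
    if "htyped n X x0 s' M N" "hrel n X x0 s s'" "htyped n X x0 t' N P" "hrel n X x0 t t'"
      "hrel n X x0 (TComp s' t') r" for s' t' r
    using hrel.comp_cong[OF that(2,4) s that(1) t that(3)] that(5) by (rule hrel.trans)
  then show ?thesis
    using hrel.refl[OF s] hrel.refl[OF t] s t by (auto simp: HCobord_def hclass_def)
qed

lemma tena_hclass:
  assumes s: "htyped n X x0 s M N" and t: "htyped n X x0 t M' N'"
  shows "tena (HCobord n X x0) (hclass n X x0 M N s) (hclass n X x0 M' N' t) =
    hclass n X x0 (sum_xman n M M') (sum_xman n N N') (TTen s t)"
proof -
  have "hrel n X x0 (TTen s t) r"
    if "htyped n X x0 s' M N" "hrel n X x0 s s'" "htyped n X x0 t' M' N'" "hrel n X x0 t t'"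
      "hrel n X x0 (TTen s' t') r" for s' t' r
    using hrel.ten_cong[OF that(2,4) s that(1) t that(3)] that(5) by (rule hrel.trans)
  then show ?thesis
    using hrel.refl[OF s] hrel.refl[OF t] s t by (auto simp: HCobord_def hclass_def)
qed

lemma diff_class_eq: "\<psi> \<in> hom_arr (Diff n X x0) M N \<Longrightarrow> diff_class n X x0 \<psi> = hclass n X x0 M N (TDiff \<psi>)"
  by (auto simp: diff_class_def hom_arr_def)

lemma monoidal_signature_HCobord: "monoidal_signature (HCobord n X x0)"
  by unfold_locales (auto elim!: HCobord_arrE dest: htyped_obj simp: x_manifold_sum x_manifold_empty)

section \<open>The comparison functor\<close>

text \<open>The parameter \<open>point_type\<close> fixes the type of the points of manifolds, on which nothing else
  depends, so that the abbreviations below are not polymorphic.\<close>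

locale hqft_context = large_monoidal D Ob hom
  for D :: "(('r, 'm) rmod, ('r, 'm) rmap) smcat" (structure) and Ob hom +
  fixes R :: "'r ring" and n :: nat and X :: "'x topology" and x0 :: 'x and point_type :: "'u itself"
  assumes D_eq: "D = FMod R"
begin

abbreviation dcat :: "(('u, 'x) xman, ('u, 'x) xdiff) smcat" where "dcat \<equiv> Diff n X x0"
abbreviation hcat :: "(('u, 'x) xman, ('u, 'x) harr) smcat" where "hcat \<equiv> HCobord n X x0"
abbreviation welltyped :: "('u, 'x) hterm \<Rightarrow> ('u, 'x) xman \<Rightarrow> ('u, 'x) xman \<Rightarrow> bool" where
  "welltyped \<equiv> htyped n X x0"
abbreviation cls :: "('u, 'x) xman \<Rightarrow> ('u, 'x) xman \<Rightarrow> ('u, 'x) hterm \<Rightarrow> ('u, 'x) harr" where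
  "cls \<equiv> hclass n X x0"
abbreviation restr ::
  "(('u, 'x) xman, ('u, 'x) harr, ('r, 'm) rmod, ('r, 'm) rmap) smfun \<Rightarrow> ('u, 'x, 'r, 'm) hqft" where
  "restr \<equiv> restr_functor n X x0"

lemma strong_functor_Diff: "sm_functor dcat D G \<Longrightarrow> strong_functor D Ob hom dcat G"
  by (intro strong_functor.intro strong_functor_axioms.intro monoidal_signature_Diff) unfold_locales

lemma strong_functor_HCobord: "sm_functor hcat D F \<Longrightarrow> strong_functor D Ob hom hcat F"
  by (intro strong_functor.intro strong_functor_axioms.intro monoidal_signature_HCobord) unfold_locales

lemma is_hqft_iff:
  fixes \<tau> :: "('u, 'x, 'r, 'm) hqft"
  shows "is_hqft n X x0 R \<tau> \<longleftrightarrow> cobordism_theory D Ob hom n X x0 (DF \<tau>) (CF \<tau>) \<and>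
    CF \<tau> \<in> extensional {W. x_cobordism n X x0 W}" (is "?L \<longleftrightarrow> ?R")
proof
  assume L: ?L
  then have "sm_functor dcat D (DF \<tau>)"
    by (simp add: is_hqft_def D_eq)
  then interpret strong_functor D Ob hom dcat "DF \<tau>"
    by (rule strong_functor_Diff)
  have "cobordism_theory D Ob hom n X x0 (DF \<tau>) (CF \<tau>)"
    by unfold_locales (use L in \<open>auto simp: is_hqft_def D_eq\<close>)
  then show ?R
    using L by (simp add: is_hqft_def)
next
  assume R: ?R
  then interpret cobordism_theory D Ob hom n X x0 "DF \<tau>" "CF \<tau>"
    by simp
  have "CF \<tau> empty_xcob \<cdot> FU (DF \<tau>) = FU (DF \<tau>)"
    using FU_large by (simp add: K_cylinder[OF empty_xcob_is_cylinder] idt_left_large)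
  then show ?L
    unfolding is_hqft_def D_eq[symmetric]
    using R F K_hom K_gluing K_cylinder K_sum K_diffeo by blast
qed

context
  fixes F :: "(('u, 'x) xman, ('u, 'x) harr, ('r, 'm) rmod, ('r, 'm) rmap) smfun"
  assumes F: "sm_functor hcat D F"
begin

interpretation F: strong_functor D Ob hom hcat F
  by (rule strong_functor_HCobord[OF F])

lemma restr_components [simp]:
  "FO (DF (restr F)) = FO F" "FC (DF (restr F)) = FC F" "FU (DF (restr F)) = FU F"
  by (simp_all add: restr_functor_def)

lemma restr_FA: "\<psi> \<in> arr dcat \<Longrightarrow> FA (DF (restr F)) \<psi> = FA F (diff_class n X x0 \<psi>)"
  by (simp add: restr_functor_def)

lemma restr_FA_hom: "\<psi> \<in> hom_arr dcat M N \<Longrightarrow> FA (DF (restr F)) \<psi> = FA F (cls M N (TDiff \<psi>))"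
  by (simp add: restr_FA diff_class_eq[symmetric] hom_arrE)

lemma restr_CF: "x_cobordism n X x0 W \<Longrightarrow> CF (restr F) W = FA F (cls (src W) (tgt W) (TCob W))"
  by (simp add: restr_functor_def cob_class_def)

lemma FA_comp:
  "welltyped s M N \<Longrightarrow> welltyped t N P \<Longrightarrow> FA F (cls M P (TComp s t)) = FA F (cls M N s) \<cdot> FA F (cls N P t)"
  using F.FA_cmp[OF hclass_arr hclass_arr, of s M N t N P] by (simp add: cmp_hclass)

lemma FA_ten:
  "welltyped s M N \<Longrightarrow> welltyped t M' N' \<Longrightarrow>
    FA F (cls (sum_xman n M M') (sum_xman n N N') (TTen s t)) \<cdot> FC F (N, N') =
    FC F (M, M') \<cdot> tena D (FA F (cls M N s)) (FA F (cls M' N' t))"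
  using F.FC_natural[OF hclass_arr hclass_arr, of s M N t M' N'] by (simp add: tena_hclass)

lemma FA_hom: "welltyped s M N \<Longrightarrow> FA F (cls M N s) \<in> hom_arr D (FO F M) (FO F N)"
  using F.FA_large[OF hclass_arr, of s M N] F.FO_obj[of M] F.FO_obj[of N] htyped_obj[of n X x0 s M N]
  by (auto intro: hom_arrI)

lemma restr_sm_functor: "sm_functor dcat D (DF (restr F))"
proof (rule sm_functor_transfer[OF F])
  show "FA (DF (restr F)) \<in> extensional (arr dcat)"
    by (simp add: restr_functor_def)
  show "is_functor dcat D (FO F) (FA (DF (restr F)))"
    unfolding is_functor_def
  proof (intro conjI ballI impI)
    fix M assume "M \<in> obj dcat"
    then have M: "x_manifold n X x0 M" by simp
    show "FO F M \<in> obj D"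
      using M F.FO_obj by simp
    show "FA (DF (restr F)) (idt dcat M) = idt D (FO F M)"
      using F.FA_idt[of M] M restr_FA_hom[OF Diff_idt[OF M]] diff_class_eq[OF Diff_idt[OF M]] by simp
  next
    fix \<psi> assume "\<psi> \<in> arr dcat"
    from hom_arr_source_target[OF this]
    show "FA (DF (restr F)) \<psi> \<in> hom_arr D (FO F (source dcat \<psi>)) (FO F (target dcat \<psi>))"
      by (simp add: restr_FA_hom FA_hom htyped.diff)
  next
    fix \<psi> \<xi> assume "\<psi> \<in> arr dcat" "\<xi> \<in> arr dcat" "target dcat \<psi> = source dcat \<xi>"
    then have h: "\<psi> \<in> hom_arr dcat (source dcat \<psi>) (source dcat \<xi>)" "\<xi> \<in> hom_arr dcat (source dcat \<xi>) (target dcat \<xi>)"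
      by (simp_all add: hom_arr_def)
    show "FA (DF (restr F)) (\<psi> \<cdot>\<^bsub>dcat\<^esub> \<xi>) = FA (DF (restr F)) \<psi> \<cdot> FA (DF (restr F)) \<xi>"
      by (simp add: restr_FA_hom[OF h(1)] restr_FA_hom[OF h(2)] restr_FA_hom[OF Diff_cmp[OF h]]
          FA_comp[OF htyped.diff[OF h(1)] htyped.diff[OF h(2)], symmetric]
          hclass_cong[OF hrel.comp_diff[OF h]])
  qed
next
  fix \<psi> \<xi> assume a: "\<psi> \<in> arr dcat" "\<xi> \<in> arr dcat"
  note h = hom_arr_source_target[OF a(1)] hom_arr_source_target[OF a(2)]
  show "FA (DF (restr F)) (tena dcat \<psi> \<xi>) \<cdot> FC F (target dcat \<psi>, target dcat \<xi>) =
        FC F (source dcat \<psi>, source dcat \<xi>) \<cdot> tena D (FA (DF (restr F)) \<psi>) (FA (DF (restr F)) \<xi>)"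
    by (simp add: restr_FA_hom[OF h(1)] restr_FA_hom[OF h(2)] restr_FA_hom[OF Diff_tena[OF h]]
        FA_ten[OF htyped.diff[OF h(1)] htyped.diff[OF h(2)], symmetric]
        hclass_cong[OF hrel.ten_diff[OF a]])
qed (simp_all add: restr_FA hom_arrE[OF Diff_assoc] hom_arrE[OF Diff_lunit] hom_arrE[OF Diff_runit] hom_arrE[OF Diff_symm])

text \<open>The equational axioms are generating relations of \<open>hrel\<close> seen through
  \<open>F\<close>: related terms have the same class, and \<open>FA_comp\<close> and
  \<open>FA_ten\<close> decompose the value of \<open>F\<close> on composites and products.\<close>

lemma restr_cobordism_theory: "cobordism_theory D Ob hom n X x0 (DF (restr F)) (CF (restr F))"
proof -
  interpret G: strong_functor D Ob hom dcat "DF (restr F)"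
    by (rule strong_functor_Diff[OF restr_sm_functor])
  show ?thesis
  proof
    fix W V :: "('u, 'x) xcob"
    assume W: "x_cobordism n X x0 W"
    show "CF (restr F) W \<in> hom_arr D (FO (DF (restr F)) (src W)) (FO (DF (restr F)) (tgt W))"
      using W by (simp add: restr_CF FA_hom htyped.cob)
    assume V: "x_cobordism n X x0 V"
    have st: "src (sum_xcob n W V) = sum_xman n (src W) (src V)" "tgt (sum_xcob n W V) = sum_xman n (tgt W) (tgt V)"
      by (simp_all add: sum_xcob_def)
    show "CF (restr F) (sum_xcob n W V) \<cdot> FC (DF (restr F)) (tgt W, tgt V) =
       FC (DF (restr F)) (src W, src V) \<cdot> tena D (CF (restr F) W) (CF (restr F) V)"
      using FA_ten[OF htyped.cob[OF W] htyped.cob[OF V]]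
      by (simp add: restr_CF W V x_cobordism_sum st hclass_cong[OF hrel.ten_cob[OF W V]])
  next
    fix W V U :: "('u, 'x) xcob" and \<psi>
    assume g: "gluing n X x0 W \<psi> V U"
    then have W: "x_cobordism n X x0 W" "x_cobordism n X x0 V" "x_cobordism n X x0 U"
      "src U = src W" "tgt U = tgt V" "\<psi> \<in> hom_arr (Diff n X x0) (tgt W) (src V)"
      by (simp_all add: gluing_def)
    note t = htyped.cob[OF W(1)] htyped.diff[OF W(6)] htyped.cob[OF W(2)]
    show "CF (restr F) U = CF (restr F) W \<cdot> FA (DF (restr F)) \<psi> \<cdot> CF (restr F) V"
      by (simp add: restr_CF W restr_FA_hom[OF W(6)] hclass_cong[OF hrel.gluing[OF g]]
          FA_comp[OF htyped.comp[OF t(1,2)] t(3)] FA_comp[OF t(1,2)])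
  next
    fix M and W :: "('u, 'x) xcob"
    assume c: "is_cylinder n X x0 M W"
    then have W: "x_cobordism n X x0 W" "src W = M" "tgt W = M"
      by (simp_all add: is_cylinder_def)
    then have M: "x_manifold n X x0 M"
      by (simp add: x_cobordism_def)
    show "CF (restr F) W = idt D (FO (DF (restr F)) M)"
      using F.FA_idt[of M] M by (simp add: restr_CF W hclass_cong[OF hrel.cylinder[OF c]] diff_class_eq[OF Diff_idt[OF M]])
  next
    fix W V :: "('u, 'x) xcob" and \<Psi>
    assume c: "cob_diffeo n X x0 W V \<Psi>"
    then have W: "x_cobordism n X x0 W" "x_cobordism n X x0 V"
      and r: "restr_in W V \<Psi> \<in> hom_arr (Diff n X x0) (src W) (src V)"
        "restr_out W V \<Psi> \<in> hom_arr (Diff n X x0) (tgt W) (tgt V)"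
      by (simp_all add: cob_diffeo_def hom_arr_def restr_in_def restr_out_def)
    show "CF (restr F) W \<cdot> FA (DF (restr F)) (restr_out W V \<Psi>) = FA (DF (restr F)) (restr_in W V \<Psi>) \<cdot> CF (restr F) V"
      by (simp add: restr_CF W restr_FA_hom[OF r(1)] restr_FA_hom[OF r(2)]
          FA_comp[OF htyped.cob[OF W(1)] htyped.diff[OF r(2)], symmetric]
          FA_comp[OF htyped.diff[OF r(1)] htyped.cob[OF W(2)], symmetric] hclass_cong[OF hrel.cob_diffeo[OF c]])
  qed
qed

lemma restr_is_hqft: "is_hqft n X x0 R (restr F)"
  using restr_cobordism_theory by (simp add: is_hqft_iff) (simp add: restr_functor_def)

text \<open>On a product the naturality square of \<open>FC F\<close> leaves only one possible
  value, the one singled out by \<open>ev_ten_eqI\<close>. Hence the restriction of \<open>F\<close>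
  remembers all of \<open>F\<close>.\<close>

lemma FA_eq_eval_term:
  "welltyped s M N \<Longrightarrow> FA F (cls M N s) = eval_term n (DF (restr F)) (CF (restr F)) s"
proof (induction rule: htyped.induct)
  case (ten s M N t M' N')
  interpret G: cobordism_theory D Ob hom n X x0 "DF (restr F)" "CF (restr F)"
    by (rule restr_cobordism_theory)
  show ?case
    by (rule G.ev_ten_eqI[OF ten(1,2), symmetric])
      (use ten in \<open>auto intro!: FA_hom htyped.ten simp: FA_ten\<close>)
next
  case (comp s M N t P)
  then show ?case
    by (simp add: FA_comp[OF comp(1,2)])
qed (simp_all add: restr_FA_hom restr_CF)

end

section \<open>Extending an HQFT to the homotopy cobordism category\<close>

text \<open>An arrow is a class of terms, so its value is taken on a chosen well-typed
  representative; \<open>hqft_functor_FA\<close> then allows any other one.\<close>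

definition hqft_functor ::
  "('u, 'x, 'r, 'm) hqft \<Rightarrow> (('u, 'x) xman, ('u, 'x) harr, ('r, 'm) rmod, ('r, 'm) rmap) smfun" where
  "hqft_functor \<tau> =
     \<lparr> FO = FO (DF \<tau>),
       FA = (\<lambda>f\<in>arr hcat. eval_term n (DF \<tau>) (CF \<tau>)
         (SOME s. welltyped s (source hcat f) (target hcat f) \<and> f = cls (source hcat f) (target hcat f) s)),
       FC = FC (DF \<tau>), FU = FU (DF \<tau>) \<rparr>"

lemma hqft_functor_components [simp]:
  "FO (hqft_functor \<tau>) = FO (DF \<tau>)" "FC (hqft_functor \<tau>) = FC (DF \<tau>)" "FU (hqft_functor \<tau>) = FU (DF \<tau>)"
  by (simp_all add: hqft_functor_def)

context
  fixes \<tau> :: "('u, 'x, 'r, 'm) hqft"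
  assumes \<tau>: "is_hqft n X x0 R \<tau>"
begin

interpretation T: cobordism_theory D Ob hom n X x0 "DF \<tau>" "CF \<tau>"
  using \<tau> by (simp add: is_hqft_iff)

text \<open>The chosen term has the same class as \<open>s\<close>, hence is related to it, and
  soundness gives equal values.\<close>

lemma hqft_functor_FA: "welltyped s M N \<Longrightarrow> FA (hqft_functor \<tau>) (cls M N s) = T.ev s"
proof -
  assume s: "welltyped s M N"
  let ?r = "SOME r. welltyped r M N \<and> cls M N s = cls M N r"
  have "welltyped ?r M N \<and> cls M N s = cls M N ?r"
    by (rule someI[of _ s]) (simp add: s)
  then have "cls M N ?r = cls M N s"
    by (simp only:)
  then have "hrel n X x0 ?r s"
    using s by (rule hclass_eqD)
  then have "T.ev ?r = T.ev s"
    using T.ev_sound by blast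
  moreover have "FA (hqft_functor \<tau>) (cls M N s) = T.ev ?r"
    unfolding hqft_functor_def smfun.select_convs restrict_apply'[OF hclass_arr[OF s]] hclass_endpoints
    by (rule HOL.refl)
  ultimately show ?thesis
    by metis
qed

lemma hqft_functor_diff: "\<psi> \<in> hom_arr dcat M N \<Longrightarrow> FA (hqft_functor \<tau>) (diff_class n X x0 \<psi>) = FA (DF \<tau>) \<psi>"
  by (simp add: diff_class_eq hqft_functor_FA[OF htyped.diff])

lemma hqft_functor_sm_functor: "sm_functor hcat D (hqft_functor \<tau>)"
proof (rule sm_functor_transfer[OF T.F])
  show "FA (hqft_functor \<tau>) \<in> extensional (arr hcat)"
    by (simp add: hqft_functor_def)
  show "is_functor hcat D (FO (DF \<tau>)) (FA (hqft_functor \<tau>))"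
    unfolding is_functor_def
  proof (intro conjI ballI impI)
    fix M assume "M \<in> obj hcat"
    then have M: "x_manifold n X x0 M" by simp
    show "FO (DF \<tau>) M \<in> obj D"
      using M T.FO_obj by simp
    show "FA (hqft_functor \<tau>) (idt hcat M) = idt D (FO (DF \<tau>) M)"
      using T.FA_idt[of M] M by (simp add: hqft_functor_diff[OF Diff_idt[OF M]])
  next
    fix f assume "f \<in> arr hcat"
    then show "FA (hqft_functor \<tau>) f \<in> hom_arr D (FO (DF \<tau>) (source hcat f)) (FO (DF \<tau>) (target hcat f))"
      by (auto elim!: HCobord_arrE simp: hqft_functor_FA T.ev_hom)
  next
    fix f g assume f: "f \<in> arr hcat" and g: "g \<in> arr hcat" and fg: "target hcat f = source hcat g"
    obtain M N s where s: "f = cls M N s" "welltyped s M N"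
      using f by (rule HCobord_arrE)
    obtain N' P t where t: "g = cls N' P t" "welltyped t N' P"
      using g by (rule HCobord_arrE)
    have "N' = N"
      using fg s t by simp
    then show "FA (hqft_functor \<tau>) (f \<cdot>\<^bsub>hcat\<^esub> g) = FA (hqft_functor \<tau>) f \<cdot> FA (hqft_functor \<tau>) g"
      using s t by (simp add: cmp_hclass hqft_functor_FA htyped.comp[of n X x0 s M N t P])
  qed
next
  fix f g assume f: "f \<in> arr hcat" and g: "g \<in> arr hcat"
  obtain M N s where s: "f = cls M N s" "welltyped s M N"
    using f by (rule HCobord_arrE)
  obtain M' N' t where t: "g = cls M' N' t" "welltyped t M' N'"
    using g by (rule HCobord_arrE)
  show "FA (hqft_functor \<tau>) (tena hcat f g) \<cdot> FC (DF \<tau>) (target hcat f, target hcat g) =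
        FC (DF \<tau>) (source hcat f, source hcat g) \<cdot> tena D (FA (hqft_functor \<tau>) f) (FA (hqft_functor \<tau>) g)"
    using T.ev_ten[OF s(2) t(2)]
    by (simp add: s t tena_hclass hqft_functor_FA htyped.ten del: eval_term.simps)
qed (simp_all add: hqft_functor_diff[OF Diff_assoc] hqft_functor_diff[OF Diff_lunit]
    hqft_functor_diff[OF Diff_runit] hqft_functor_diff[OF Diff_symm])

text \<open>Equality of records also compares values outside the intended domains; there the
  extensionality conditions in \<open>sm_functor\<close> and \<open>is_hqft\<close> make both sides
  undefined.\<close>

lemma restr_hqft_functor: "restr (hqft_functor \<tau>) = \<tau>"
proof -
  have "(\<lambda>\<psi>\<in>arr dcat. FA (hqft_functor \<tau>) (diff_class n X x0 \<psi>)) = FA (DF \<tau>)"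
  proof (rule extensionalityI[OF restrict_extensional])
    show "FA (DF \<tau>) \<in> extensional (arr dcat)"
      using T.F by (simp add: sm_functor_def)
    show "(\<lambda>\<psi>\<in>arr dcat. FA (hqft_functor \<tau>) (diff_class n X x0 \<psi>)) \<psi> = FA (DF \<tau>) \<psi>" if "\<psi> \<in> arr dcat" for \<psi>
      using hqft_functor_diff[OF hom_arr_source_target[OF that]] that by simp
  qed
  moreover have "(\<lambda>W\<in>{W. x_cobordism n X x0 W}. FA (hqft_functor \<tau>) (cob_class n X x0 W)) = CF \<tau>"
    by (rule extensionalityI[OF restrict_extensional])
      (use \<tau> in \<open>auto simp: cob_class_def hqft_functor_FA[OF htyped.cob] is_hqft_iff\<close>)
  ultimately show ?thesis
    by (simp add: restr_functor_def)
qed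

end

lemma hqft_functor_restr:
  assumes F: "sm_functor hcat D F"
  shows "hqft_functor (restr F) = F"
proof -
  have "FA (hqft_functor (restr F)) = FA F"
  proof (rule extensionalityI)
    show "FA (hqft_functor (restr F)) \<in> extensional (arr hcat)"
      by (simp add: hqft_functor_def)
    show "FA F \<in> extensional (arr hcat)"
      using F by (simp add: sm_functor_def)
    fix f assume "f \<in> arr hcat"
    then show "FA (hqft_functor (restr F)) f = FA F f"
      by (rule HCobord_arrE) (simp add: hqft_functor_FA[OF restr_is_hqft[OF F]] FA_eq_eval_term[OF F])
  qed
  then show ?thesis
    by (intro smfun.equality) (simp_all add: restr_components[OF F])
qed

section \<open>Transformations and maps of HQFTs\<close>

text \<open>The comparison functor keeps the components of a transformation, so this equivalence is
  its bijectivity on arrows with given endpoints. For composites the squares are pasted; for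
  products they are tensored, and the isomorphism c of \<open>G\<close> is cancelled.\<close>

lemma transformation_iff:
  assumes F: "sm_functor hcat D F" and G: "sm_functor hcat D G"
  shows "sm_transformation hcat D F G \<theta> \<longleftrightarrow> hqft_map n X x0 R (restr F) (restr G) \<theta>"
proof
  assume \<theta>: "sm_transformation hcat D F G \<theta>"
  have nat: "FA F (cls M N s) \<cdot> \<theta> N = \<theta> M \<cdot> FA G (cls M N s)" if "welltyped s M N" for s M N
    using \<theta> hclass_arr[OF that] unfolding sm_transformation_def
    by (metis hclass_endpoints)
  have "FA (DF (restr F)) \<psi> \<cdot> \<theta> (target dcat \<psi>) = \<theta> (source dcat \<psi>) \<cdot> FA (DF (restr G)) \<psi>" if "\<psi> \<in> arr dcat" for \<psi>
    using nat[OF htyped.diff[OF hom_arr_source_target[OF that]]]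
    by (simp add: restr_FA_hom[OF F hom_arr_source_target[OF that]] restr_FA_hom[OF G hom_arr_source_target[OF that]])
  moreover have "CF (restr F) W \<cdot> \<theta> (tgt W) = \<theta> (src W) \<cdot> CF (restr G) W" if "x_cobordism n X x0 W" for W
    using nat[OF htyped.cob[OF that]] by (simp add: restr_CF[OF F that] restr_CF[OF G that])
  ultimately show "hqft_map n X x0 R (restr F) (restr G) \<theta>"
    using \<theta> unfolding hqft_map_def D_eq[symmetric]
    by (simp add: sm_transformation_def restr_components[OF F] restr_components[OF G])
next
  assume L: "hqft_map n X x0 R (restr F) (restr G) \<theta>"
  interpret F: strong_functor D Ob hom hcat F
    by (rule strong_functor_HCobord[OF F])
  interpret G: strong_functor D Ob hom hcat G
    by (rule strong_functor_HCobord[OF G])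
  have \<theta>: "sm_transformation dcat D (DF (restr F)) (DF (restr G)) \<theta>"
    and cob_natural: "x_cobordism n X x0 W \<Longrightarrow> CF (restr F) W \<cdot> \<theta> (tgt W) = \<theta> (src W) \<cdot> CF (restr G) W" for W
    using L unfolding hqft_map_def D_eq[symmetric] by auto
  have t: "large (\<theta> M)" "source D (\<theta> M) = FO F M" "target D (\<theta> M) = FO G M" if "x_manifold n X x0 M" for M
    using \<theta> that hom_arrD[of "\<theta> M" "FO F M" "FO G M"]
    by (auto simp: sm_transformation_def restr_components[OF F] restr_components[OF G])
  have \<theta>_sum: "\<theta> (sum_xman n M N) \<cdot> FC G (M, N) = FC F (M, N) \<cdot> tena D (\<theta> M) (\<theta> N)"
    if "x_manifold n X x0 M" "x_manifold n X x0 N" for M N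
    using \<theta> that by (simp add: sm_transformation_def restr_components[OF F] restr_components[OF G])
  have "FA F (cls M N s) \<cdot> \<theta> N = \<theta> M \<cdot> FA G (cls M N s)" if "welltyped s M N" for M N s
    using that
  proof (induction rule: htyped.induct)
    case (diff \<psi> M N)
    then show ?case
      using \<theta> hom_arrE[OF diff] unfolding sm_transformation_def
      by (metis restr_FA_hom[OF F diff] restr_FA_hom[OF G diff])
  next
    case (cob W)
    then show ?case
      using cob_natural[OF cob] by (simp add: restr_CF[OF F] restr_CF[OF G])
  next
    case (comp s M N t P)
    have o: "x_manifold n X x0 M" "x_manifold n X x0 N" "x_manifold n X x0 P"
      using htyped_obj[OF comp(1)] htyped_obj[OF comp(2)] by auto
    note l = F.FA_large[OF hclass_arr[OF comp(1)]] F.FA_large[OF hclass_arr[OF comp(2)]]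
      G.FA_large[OF hclass_arr[OF comp(1)]] G.FA_large[OF hclass_arr[OF comp(2)]]
    let ?s = "cls M N s" and ?t = "cls N P t"
    have "FA F ?s \<cdot> FA F ?t \<cdot> \<theta> P = FA F ?s \<cdot> (FA F ?t \<cdot> \<theta> P)"
      using o by (simp add: l t cmp_assoc_large)
    also have "\<dots> = (FA F ?s \<cdot> \<theta> N) \<cdot> FA G ?t"
      unfolding comp.IH(2) using o by (simp add: l t cmp_assoc_large)
    also have "\<dots> = \<theta> M \<cdot> (FA G ?s \<cdot> FA G ?t)"
      unfolding comp.IH(1) using o by (simp add: l t cmp_assoc_large)
    finally show ?case
      by (simp add: FA_comp[OF F comp(1,2)] FA_comp[OF G comp(1,2)])
  next
    case (ten s M N u M' N')
    have o: "x_manifold n X x0 M" "x_manifold n X x0 N" "x_manifold n X x0 M'" "x_manifold n X x0 N'"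
      using htyped_obj[OF ten(1)] htyped_obj[OF ten(2)] by auto
    note T = htyped.ten[OF ten(1,2)]
    note l = F.FA_large[OF hclass_arr[OF ten(1)]] F.FA_large[OF hclass_arr[OF ten(2)]] F.FA_large[OF hclass_arr[OF T]]
      G.FA_large[OF hclass_arr[OF ten(1)]] G.FA_large[OF hclass_arr[OF ten(2)]] G.FA_large[OF hclass_arr[OF T]]
    let ?S = "sum_xman n M M'" and ?S' = "sum_xman n N N'" and ?s = "cls M N s" and ?u = "cls M' N' u"
    let ?T = "cls ?S ?S' (TTen s u)"
    note simps = o l t x_manifold_sum F.FC_large G.FC_large large_simps
    have "FA F ?T \<cdot> \<theta> ?S' \<cdot> FC G (N, N') = FA F ?T \<cdot> (\<theta> ?S' \<cdot> FC G (N, N'))"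
      by (simp add: simps cmp_assoc_large)
    also have "\<dots> = (FA F ?T \<cdot> FC F (N, N')) \<cdot> tena D (\<theta> N) (\<theta> N')"
      unfolding \<theta>_sum[OF o(2,4)] by (simp add: simps cmp_assoc_large)
    also have "\<dots> = FC F (M, M') \<cdot> tena D (FA F ?s \<cdot> \<theta> N) (FA F ?u \<cdot> \<theta> N')"
      unfolding FA_ten[OF F ten(1,2)] by (simp add: simps cmp_assoc_large interchange_large)
    also have "\<dots> = FC F (M, M') \<cdot> tena D (\<theta> M) (\<theta> M') \<cdot> tena D (FA G ?s) (FA G ?u)"
      unfolding ten.IH by (simp add: simps cmp_assoc_large interchange_large)
    also have "\<dots> = \<theta> ?S \<cdot> (FC G (M, M') \<cdot> tena D (FA G ?s) (FA G ?u))"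
      unfolding \<theta>_sum[OF o(1,3), symmetric] by (simp add: simps cmp_assoc_large)
    also have "\<dots> = \<theta> ?S \<cdot> FA G ?T \<cdot> FC G (N, N')"
      unfolding FA_ten[OF G ten(1,2), symmetric] by (simp add: simps cmp_assoc_large)
    finally show ?case
      by (rule cancel_right[rotated -1]) (simp_all add: simps iso_has_right_inverse G.FC_iso)
  qed
  then have "FA F f \<cdot> \<theta> (target hcat f) = \<theta> (source hcat f) \<cdot> FA G f" if "f \<in> arr hcat" for f
    using that by (auto elim!: HCobord_arrE)
  then show "sm_transformation hcat D F G \<theta>"
    using \<theta> by (simp add: sm_transformation_def restr_components[OF F] restr_components[OF G])
qed

section \<open>The two categories and their isomorphism\<close>

lemma category_functors: "category (sm_functor_category (hcat :: (('u, 'x) xman, ('u, 'x) harr) smcat) D)"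
  using transformation_category[OF monoidal_signature_HCobord, where U = "\<lambda>F. F" and T = "{F. sm_functor hcat D F}" and P = "\<lambda>_ _ _. True"]
  by (simp add: sm_functor_category_def)

lemma category_HQFT: "category (HQFT n X x0 R :: (('u, 'x, 'r, 'm) hqft, _) cat)"
proof -
  let ?P = "\<lambda>(\<tau> :: ('u, 'x, 'r, 'm) hqft) \<rho> \<theta>. \<forall>W. x_cobordism n X x0 W \<longrightarrow> CF \<tau> W \<cdot> \<theta> (tgt W) = \<theta> (src W) \<cdot> CF \<rho> W"
  let ?T = "{\<tau> :: ('u, 'x, 'r, 'm) hqft. is_hqft n X x0 R \<tau>}"
  have ct: "cobordism_theory D Ob hom n X x0 (DF \<tau>) (CF \<tau>)" if "\<tau> \<in> ?T" for \<tau>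
    using that by (simp add: is_hqft_iff)
  have K: "large (CF \<tau> W)" "source D (CF \<tau> W) = FO (DF \<tau>) (src W)" "target D (CF \<tau> W) = FO (DF \<tau>) (tgt W)"
    "x_manifold n X x0 (src W)" "x_manifold n X x0 (tgt W)"
    if "\<tau> \<in> ?T" "x_cobordism n X x0 W" for \<tau> W
    using hom_arrD[OF cobordism_theory.K_hom[OF ct[OF that(1)] that(2)]] that(2) by (auto simp: x_cobordism_def)
  have t: "large (\<theta> M)" "source D (\<theta> M) = FO (DF \<tau>) M" "target D (\<theta> M) = FO (DF \<rho>) M"
    if "sm_transformation dcat D (DF \<tau>) (DF \<rho>) \<theta>" "x_manifold n X x0 M" for \<theta> M and \<tau> \<rho> :: "('u, 'x, 'r, 'm) hqft"
    using that hom_arrD[of "\<theta> M"] by (auto simp: sm_transformation_def)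
  have "category \<lparr> obj = ?T,
    arr = {(\<tau>, \<rho>, \<theta>). \<tau> \<in> ?T \<and> \<rho> \<in> ?T \<and> sm_transformation dcat D (DF \<tau>) (DF \<rho>) \<theta> \<and> ?P \<tau> \<rho> \<theta>},
    source = (\<lambda>(\<tau>, \<rho>, \<theta>). \<tau>), target = (\<lambda>(\<tau>, \<rho>, \<theta>). \<rho>),
    idt = (\<lambda>\<tau>. (\<tau>, \<tau>, \<lambda>x\<in>obj dcat. idt D (FO (DF \<tau>) x))),
    cmp = (\<lambda>(\<tau>, \<rho>, \<theta>) (\<rho>', \<kappa>, \<eta>). (\<tau>, \<kappa>, \<lambda>x\<in>obj dcat. \<theta> x \<cdot> \<eta> x)) \<rparr>"
  proof (rule transformation_category[OF monoidal_signature_Diff, where P = ?P])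
    fix \<tau> assume \<tau>: "\<tau> \<in> ?T"
    then show "sm_functor dcat D (DF \<tau>)"
      by (simp add: is_hqft_def D_eq)
    show "?P \<tau> \<tau> (\<lambda>x\<in>obj dcat. idt D (FO (DF \<tau>) x))"
      using K[OF \<tau>] by (simp add: idt_left_large idt_right_large)
  next
    fix \<tau> \<rho> \<kappa> \<theta> \<eta>
    assume T: "\<tau> \<in> ?T" "\<rho> \<in> ?T" "\<kappa> \<in> ?T"
      and \<theta>: "sm_transformation dcat D (DF \<tau>) (DF \<rho>) \<theta>" and \<eta>: "sm_transformation dcat D (DF \<rho>) (DF \<kappa>) \<eta>"
      and P: "?P \<tau> \<rho> \<theta>" "?P \<rho> \<kappa> \<eta>"
    show "?P \<tau> \<kappa> (\<lambda>x\<in>obj dcat. \<theta> x \<cdot> \<eta> x)"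
    proof (intro allI impI)
      fix W :: "('u, 'x) xcob" assume W: "x_cobordism n X x0 W"
      note k = K[OF T(1) W] K[OF T(2) W] K[OF T(3) W]
      note simps = k t[OF \<theta>] t[OF \<eta>] cmp_assoc_large large_cmp
      have "CF \<tau> W \<cdot> (\<theta> (tgt W) \<cdot> \<eta> (tgt W)) = (CF \<tau> W \<cdot> \<theta> (tgt W)) \<cdot> \<eta> (tgt W)"
        by (simp add: simps)
      also have "\<dots> = \<theta> (src W) \<cdot> (CF \<rho> W \<cdot> \<eta> (tgt W))"
        using P(1) W by (simp add: simps)
      also have "\<dots> = \<theta> (src W) \<cdot> \<eta> (src W) \<cdot> CF \<kappa> W"
        using P(2) W by (simp add: simps)
      finally show "CF \<tau> W \<cdot> (\<lambda>x\<in>obj dcat. \<theta> x \<cdot> \<eta> x) (tgt W) = (\<lambda>x\<in>obj dcat. \<theta> x \<cdot> \<eta> x) (src W) \<cdot> CF \<kappa> W"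
        using k by simp
    qed
  qed
  then show ?thesis
    by (simp add: HQFT_def hqft_map_def D_eq[symmetric])
qed

lemma isomorphism_restr:
  "isomorphism_of_categories (sm_functor_category (hcat :: (('u, 'x) xman, ('u, 'x) harr) smcat) D)
     (HQFT n X x0 R) restr (restr_transformation n X x0)"
proof -
  let ?A = "sm_functor_category (hcat :: (('u, 'x) xman, ('u, 'x) harr) smcat) D"
  let ?H = "HQFT n X x0 R :: (('u, 'x, 'r, 'm) hqft, _) cat"
  have functorial: "is_functor ?A ?H restr (restr_transformation n X x0)"
    unfolding is_functor_def
    by (auto simp: sm_functor_category_def HQFT_def hom_arr_def restr_transformation_def restr_is_hqft
        transformation_iff restr_components D_eq[symmetric])
  have obj: "bij_betw restr (obj ?A) (obj ?H)"
    by (rule bij_betw_byWitness[where f' = hqft_functor])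
      (auto simp: sm_functor_category_def HQFT_def hqft_functor_restr restr_hqft_functor restr_is_hqft
        hqft_functor_sm_functor)
  have arr: "bij_betw (restr_transformation n X x0) (arr ?A) (arr ?H)"
    by (rule bij_betw_byWitness[where f' = "\<lambda>(\<tau>, \<rho>, \<theta>). (hqft_functor \<tau>, hqft_functor \<rho>, \<theta>)"])
      (auto simp: sm_functor_category_def HQFT_def restr_transformation_def hqft_functor_restr restr_hqft_functor
        restr_is_hqft hqft_functor_sm_functor transformation_iff)
  show ?thesis
    unfolding isomorphism_of_categories_def
    using category_functors category_HQFT functorial obj arr by blast
qed

end

theorem mainTheorem1:
  fixes X :: "'x topology" and x0 :: 'x and n :: nat and R :: "'r ring"
  assumes "path_connected_space X" and "x0 \<in> topspace X" and "cring R"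
  shows "isomorphism_of_categories
           (sm_functor_category
              (HCobord n X x0 :: (('u, 'x) xman, ('u, 'x) harr) smcat)
              (FMod R :: (('r, 'm) rmod, ('r, 'm) rmap) smcat))
           (HQFT n X x0 R)
           (restr_functor n X x0) (restr_transformation n X x0)"
proof -
  interpret large_monoidal "FMod R :: (('r, 'm) rmod, ('r, 'm) rmap) smcat" "{M. module R M}" "module_hom R"
    using assms(3) by (rule large_monoidal_FMod)
  interpret hqft_context "FMod R :: (('r, 'm) rmod, ('r, 'm) rmap) smcat" "{M. module R M}" "module_hom R" R n X x0 "TYPE('u)"
    by unfold_locales (rule HOL.refl)
  show ?thesis
    by (rule isomorphism_restr)
qed

end
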